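(* Let $G=(V,E)$ be a $\sigma$-semialgebraic graph. Then the following are equivalent: (1) $\chi_\ell(G)\le \aleph_0$; (2) $\mathrm{Col}(G)\le \aleph_0$; (3) $G$ does not contain a Cantor graph.
   Context: A graph $G=(V,E)$ consists of a (possibly infinite) vertex set $V$ and a symmetric, irreflexive relation $E\subseteq V^2$. A coloring $\varphi$ of $G$ (a function with domain $V$) is proper if $\varphi(x)\ne\varphi(y)$ whenever $\langle x,y\rangle\in E$. For a cardinal $\kappa$, a $\kappa$-listing of $G$ is a function $\Lambda$ on $V$ such that $\Lambda(x)$ is a set with $|\Lambda(x)|=\kappa$ for every $x\in V$; a $\Lambda$-coloring is a coloring $\varphi$ with $\varphi(x)\in\Lambda(x)$ for all $x\in V$. The list-chromatic number $\chi_\ell(G)$ is the least cardinal $\kappa$ such that for every $\kappa$-listing $\Lambda$ of $G$ there is a proper $\Lambda$-coloring of $G$. The coloring number $\mathrm{Col}(G)$ is the least cardinal $\kappa$ for which there is a well-ordering $\prec$ of $V$ such that $|\{y\in V:\langle x,y\rangle\in E \text{ and } y\prec x\}|<\kappa$ for every $x\in V$. $G_1=(V_1,E_1)$ is a subgraph of $G_2=(V_2,E_2)$ if $V_1\subseteq V_2$ and $E_1\subseteq E_2$ (not necessarily induced); $G_2$ contains a $G_1$ if $G_2$ has a subgraph isomorphic to $G_1$. A set $X\subseteq\mathbb{R}^n$ is semialgebraic if it is definable in the ordered field $(\mathbb{R},+,\cdot,0,1,\le)$ by a first-order formula in which parameters from $\mathbb{R}$ are allowed, and $\sigma$-semialgebraic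 if it is a union of countably many semialgebraic subsets of $\mathbb{R}^n$. A graph $(V,E)$, with $V\subseteq\mathbb{R}^n$ for some $n<\omega$ and $E\subseteq V^2\subseteq\mathbb{R}^{2n}$, is $\sigma$-semialgebraic if both $V$ and $E$ are $\sigma$-semialgebraic. The Cantor graph: let $P\subseteq[0,1]$ be Cantor's middle-third set and let $I_2,I_3,I_4,\ldots$ be the natural one-to-one enumeration of all the closed subintervals of $[0,1]$ involved in the construction of $P$, level by level, so that for each $i<\omega$ the intervals $I_j$ with $2^i<j\le 2^{i+1}$ are the $2^i$ closed intervals of length $3^{-i}$ at stage $i$ (e.g. $I_2=[0,1]$, $I_3=[0,1/3]$, $I_4=[2/3,1]$, $I_5=[0,1/9]$, etc.), and $P=\bigcap_{i<\omega}\bigcup\{I_j:2^i<j\le 2^{i+1}\}$. The Cantor graph is the bipartite graph with parts $\{j<\omega:j\ge 2\}$ and $[0,1]$ in which, for $2\le j<\omega$ and $x\in[0,1]$, $j$ and $x$ are joined by an edge iff $x\in I_j$. *)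

theory Defs
  imports Complex_Main "HOL-Library.Countable_Set"
begin

unbundle cardinal_syntax

section \<open>Graphs\<close>

type_synonym 'v graph = "'v set \<times> 'v rel"

abbreviation verts :: "'v graph \<Rightarrow> 'v set" where "verts \<equiv> fst"
abbreviation edges :: "'v graph \<Rightarrow> 'v rel" where "edges \<equiv> snd"

definition is_graph :: "'v graph \<Rightarrow> bool" where
  "is_graph G \<longleftrightarrow> edges G \<subseteq> verts G \<times> verts G \<and> sym (edges G) \<and> irrefl (edges G)"

definition subgraph :: "'v graph \<Rightarrow> 'v graph \<Rightarrow> bool" where
  "subgraph G1 G2 \<longleftrightarrow> is_graph G1 \<and> is_graph G2 \<and>
     verts G1 \<subseteq> verts G2 \<and> edges G1 \<subseteq> edges G2"

definition isomorphic_graphs :: "'v graph \<Rightarrow> 'w graph \<Rightarrow> bool" where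
  "isomorphic_graphs G H \<longleftrightarrow>
     (\<exists>f. bij_betw f (verts G) (verts H) \<and>
          (\<forall>x\<in>verts G. \<forall>y\<in>verts G. (x, y) \<in> edges G \<longleftrightarrow> (f x, f y) \<in> edges H))"

definition contains_a :: "'v graph \<Rightarrow> 'w graph \<Rightarrow> bool" where
  "contains_a G H \<longleftrightarrow> (\<exists>G'. subgraph G' G \<and> isomorphic_graphs H G')"


section \<open>Cardinal invariants\<close>

text \<open>
  Cardinals are represented as usual by \<^const>\<open>Card_order\<close> relations, which are unique only up to
  \<open>=o\<close>; hence the choice operator. The minimum ranges over the cardinals
  \<open>\<kappa> \<le> |UNIV :: 'k set|\<close>, so it is the minimum over all cardinals as soon as some such \<open>\<kappa>\<close>
  satisfies \<open>P\<close>. For both invariants below \<open>\<kappa> = |verts G|\<close> does.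
\<close>

definition least_cardinal :: "('k rel \<Rightarrow> bool) \<Rightarrow> 'k rel" where
  "least_cardinal P =
     (SOME \<kappa>. Card_order \<kappa> \<and> P \<kappa> \<and> (\<forall>\<kappa>'. Card_order \<kappa>' \<and> P \<kappa>' \<longrightarrow> \<kappa> \<le>o \<kappa>'))"

definition proper_coloring :: "'v graph \<Rightarrow> ('v \<Rightarrow> 'c) \<Rightarrow> bool" where
  "proper_coloring G \<phi> \<longleftrightarrow> (\<forall>(x, y)\<in>edges G. \<phi> x \<noteq> \<phi> y)"

definition listing :: "'v graph \<Rightarrow> 'k rel \<Rightarrow> ('v \<Rightarrow> 'c set) \<Rightarrow> bool" where
  "listing G \<kappa> \<Lambda> \<longleftrightarrow> (\<forall>x\<in>verts G. |\<Lambda> x| =o \<kappa>)"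

definition list_coloring :: "'v graph \<Rightarrow> ('v \<Rightarrow> 'c set) \<Rightarrow> ('v \<Rightarrow> 'c) \<Rightarrow> bool" where
  "list_coloring G \<Lambda> \<phi> \<longleftrightarrow> (\<forall>x\<in>verts G. \<phi> x \<in> \<Lambda> x)"

text \<open>
  The type \<open>'c\<close> is the universe from which the lists are drawn. The sets of a \<open>\<kappa>\<close>-listing have a union
  of size at most \<open>|verts G| \<cdot> \<kappa>\<close>; so if \<open>'c\<close> is infinite and \<open>|verts G| \<le> |UNIV :: 'c set|\<close>, then for
  every \<open>\<kappa> \<le> |UNIV :: 'c set|\<close> each \<open>\<kappa>\<close>-listing by arbitrary sets can be renamed injectively into
  \<open>'c\<close>. For smaller \<open>'c\<close> the number below need not be the list-chromatic number.
\<close>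

definition list_chromatic_number :: "'v graph \<Rightarrow> 'c rel" where
  "list_chromatic_number G =
     least_cardinal (\<lambda>\<kappa> :: 'c rel. \<forall>\<Lambda> :: 'v \<Rightarrow> 'c set. listing G \<kappa> \<Lambda> \<longrightarrow>
       (\<exists>\<phi>. proper_coloring G \<phi> \<and> list_coloring G \<Lambda> \<phi>))"

text \<open>A well-ordering \<open>r\<close> is reflexive here, as in the library; \<open>y \<prec> x\<close> is its strict part.\<close>

definition coloring_number :: "'v graph \<Rightarrow> 'v rel" where
  "coloring_number G =
     least_cardinal (\<lambda>\<kappa> :: 'v rel. \<exists>r. well_order_on (verts G) r \<and>
       (\<forall>x\<in>verts G. |{y \<in> verts G. (x, y) \<in> edges G \<and> (y, x) \<in> r \<and> y \<noteq> x}| <o \<kappa>))"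

lemma least_cardinal:
  assumes "Card_order \<kappa>" "P \<kappa>"
  shows "Card_order (least_cardinal P)" "P (least_cardinal P)"
    "\<And>\<kappa>'. Card_order \<kappa>' \<Longrightarrow> P \<kappa>' \<Longrightarrow> least_cardinal P \<le>o \<kappa>'"
proof -
  let ?R = "{\<kappa>. Card_order \<kappa> \<and> P \<kappa>}"
  have "\<exists>\<kappa>. Card_order \<kappa> \<and> P \<kappa> \<and> (\<forall>\<kappa>'. Card_order \<kappa>' \<and> P \<kappa>' \<longrightarrow> \<kappa> \<le>o \<kappa>')"
    using exists_minim_Card_order[of ?R] assms by blast
  from someI_ex[OF this]
  show "Card_order (least_cardinal P)" "P (least_cardinal P)"
    "\<And>\<kappa>'. Card_order \<kappa>' \<Longrightarrow> P \<kappa>' \<Longrightarrow> least_cardinal P \<le>o \<kappa>'"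
    unfolding least_cardinal_def by blast+
qed

lemma coloring_number_attained:
  "\<exists>r. well_order_on (verts G) r \<and>
     (\<forall>x\<in>verts G. |{y \<in> verts G. (x, y) \<in> edges G \<and> (y, x) \<in> r \<and> y \<noteq> x}| <o |verts G| )"
proof (intro exI conjI ballI)
  show "well_order_on (verts G) |verts G|" by (rule card_of_well_order_on)
  fix x assume "x \<in> verts G"
  then have "|underS |verts G| x| <o |verts G|"
    by (intro card_of_underS card_of_Card_order) (simp add: Field_card_of)
  moreover have "|{y \<in> verts G. (x, y) \<in> edges G \<and> (y, x) \<in> |verts G| \<and> y \<noteq> x}|
      \<le>o |underS |verts G| x|"
    by (rule card_of_mono1) (auto simp: underS_def)
  ultimately show "|{y \<in> verts G. (x, y) \<in> edges G \<and> (y, x) \<in> |verts G| \<and> y \<noteq> x}| <o |verts G|"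
    by (rule ordLeq_ordLess_trans[rotated])
qed

lemma list_chromatic_number_attained:
  assumes "is_graph G" and "\<kappa> =o |verts G|" and "listing G \<kappa> \<Lambda>"
  shows "\<exists>\<phi>. proper_coloring G \<phi> \<and> list_coloring G \<Lambda> \<phi>"
proof -
  let ?V = "verts G" and ?r = "|verts G|"
  have wo: "well_order_on ?V ?r" by (rule card_of_well_order_on)
  then have wf: "wf (?r - Id)" by (simp add: well_order_on_def)
  have tot: "total_on ?V ?r"
    using wo by (simp add: well_order_on_def linear_order_on_def)
  define \<phi> where
    "\<phi> = wfrec (?r - Id) (\<lambda>f x. SOME c. c \<in> \<Lambda> x \<and> c \<notin> f ` underS ?r x)"
  have \<phi>: "\<phi> x = (SOME c. c \<in> \<Lambda> x \<and> c \<notin> \<phi> ` underS ?r x)" for x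
  proof -
    have "cut \<phi> (?r - Id) x ` underS ?r x = \<phi> ` underS ?r x"
      by (rule image_cong) (auto simp: cut_def underS_def)
    then show ?thesis
      using wfrec[OF wf, of "\<lambda>f x. SOME c. c \<in> \<Lambda> x \<and> c \<notin> f ` underS ?r x" x]
      unfolding \<phi>_def[symmetric] by simp
  qed
  have *: "\<phi> x \<in> \<Lambda> x \<and> \<phi> x \<notin> \<phi> ` underS ?r x" if x: "x \<in> ?V" for x
  proof -
    have "|\<phi> ` underS ?r x| \<le>o |underS ?r x|" by (rule card_of_image)
    also have "|underS ?r x| <o ?r"
      using x by (intro card_of_underS card_of_Card_order) (simp add: Field_card_of)
    also have "?r =o |\<Lambda> x|"
      using assms(2,3) x ordIso_symmetric ordIso_transitive unfolding listing_def by blast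
    finally have "|\<phi> ` underS ?r x| <o |\<Lambda> x|" .
    then have "\<not> \<Lambda> x \<subseteq> \<phi> ` underS ?r x"
      using card_of_mono1 not_ordLess_ordLeq by blast
    then have "\<exists>c. c \<in> \<Lambda> x \<and> c \<notin> \<phi> ` underS ?r x" by blast
    from someI_ex[OF this] show ?thesis unfolding \<phi>[symmetric] .
  qed
  have "\<phi> x \<noteq> \<phi> y" if "(x, y) \<in> edges G" for x y
  proof -
    have "x \<in> ?V" "y \<in> ?V" "x \<noteq> y"
      using that assms(1) by (auto simp: is_graph_def irrefl_on_def)
    then have "x \<in> underS ?r y \<or> y \<in> underS ?r x"
      using tot by (auto simp: total_on_def underS_def)
    then show ?thesis
      using *[OF \<open>x \<in> ?V\<close>] *[OF \<open>y \<in> ?V\<close>] by (metis imageI)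
  qed
  then show ?thesis
    using * unfolding proper_coloring_def list_coloring_def by blast
qed


section \<open>Semialgebraic sets\<close>

datatype trm = Var nat | Zero | One | Plus trm trm | Times trm trm

datatype fml = Equal trm trm | LessEq trm trm | Neg fml | Conj fml fml | Exists nat fml

primrec trm_val :: "(nat \<Rightarrow> real) \<Rightarrow> trm \<Rightarrow> real" where
  "trm_val e (Var i) = e i"
| "trm_val e Zero = 0"
| "trm_val e One = 1"
| "trm_val e (Plus s t) = trm_val e s + trm_val e t"
| "trm_val e (Times s t) = trm_val e s * trm_val e t"

primrec sat :: "(nat \<Rightarrow> real) \<Rightarrow> fml \<Rightarrow> bool" where
  "sat e (Equal s t) \<longleftrightarrow> trm_val e s = trm_val e t"
| "sat e (LessEq s t) \<longleftrightarrow> trm_val e s \<le> trm_val e t"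
| "sat e (Neg F) \<longleftrightarrow> \<not> sat e F"
| "sat e (Conj F1 F2) \<longleftrightarrow> sat e F1 \<and> sat e F2"
| "sat e (Exists i F) \<longleftrightarrow> (\<exists>a. sat (e(i := a)) F)"

text \<open>
  Points of real \<open>n\<close>-space are the real lists of length \<open>n\<close>, so that concatenation identifies
  pairs of points of \<open>n\<close>-space with points of \<open>2n\<close>-space.
  The free variables below \<open>n\<close> are the coordinates, the others stand for the parameters \<open>p\<close>
  (of which a formula involves only finitely many).
\<close>

definition semialgebraic :: "nat \<Rightarrow> real list set \<Rightarrow> bool" where
  "semialgebraic n X \<longleftrightarrow>
     (\<exists>F p. X = {x. length x = n \<and> sat (\<lambda>i. if i < n then x ! i else p i) F})"

definition sigma_semialgebraic :: "nat \<Rightarrow> real list set \<Rightarrow> bool" where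
  "sigma_semialgebraic n X \<longleftrightarrow>
     (\<exists>\<S>. countable \<S> \<and> (\<forall>S\<in>\<S>. semialgebraic n S) \<and> X = \<Union>\<S>)"

definition sigma_semialgebraic_graph :: "real list graph \<Rightarrow> bool" where
  "sigma_semialgebraic_graph G \<longleftrightarrow> is_graph G \<and>
     (\<exists>n. sigma_semialgebraic n (verts G) \<and>
          sigma_semialgebraic (2 * n) {x @ y | x y. (x, y) \<in> edges G})"


section \<open>The Cantor graph\<close>

text \<open>
  End points of \<open>I\<^sub>j\<close> for \<open>j \<ge> 2\<close> (values at \<open>j < 2\<close> are irrelevant). Stage \<open>i\<close> consists of the indices
  \<open>2 ^ i < j \<le> 2 ^ (i + 1)\<close>, from left to right; hence the left and right thirds of \<open>I\<^sub>j\<close> have the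
  indices \<open>2 * j - 1\<close> and \<open>2 * j\<close> at the next stage, and the parent of \<open>j > 2\<close> is \<open>(j + 1) div 2\<close>.
\<close>

fun cantor_interval :: "nat \<Rightarrow> real \<times> real" where
  "cantor_interval j =
     (if j \<le> 2 then (0, 1)
      else let (a, b) = cantor_interval ((j + 1) div 2)
           in if odd j then (a, a + (b - a) / 3) else (b - (b - a) / 3, b))"

declare cantor_interval.simps [simp del]

lemma cantor_interval_values:
  "cantor_interval 2 = (0, 1)"
  "cantor_interval 3 = (0, 1/3)" "cantor_interval 4 = (2/3, 1)"
  "cantor_interval 5 = (0, 1/9)" "cantor_interval 6 = (2/9, 1/3)"
  "cantor_interval 7 = (2/3, 7/9)" "cantor_interval 8 = (8/9, 1)"
  by (simp_all add: cantor_interval.simps)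

definition cantor_adj :: "nat \<Rightarrow> real \<Rightarrow> bool" where
  "cantor_adj j x \<longleftrightarrow> x \<in> {fst (cantor_interval j)..snd (cantor_interval j)}"

definition cantor_graph :: "(nat + real) graph" where
  "cantor_graph =
     (Inl ` {2..} \<union> Inr ` {0..1},
      {(Inl j, Inr x) | j x. 2 \<le> j \<and> x \<in> {0..1} \<and> cantor_adj j x} \<union>
      {(Inr x, Inl j) | j x. 2 \<le> j \<and> x \<in> {0..1} \<and> cantor_adj j x})"

end

theory Submission
  imports
    Defs
    "HOL-Library.Function_Algebras"
    "HOL-Computational_Algebra.Polynomial"
    "HOL-Analysis.Function_Metric"
    "HOL-Analysis.Topology_Euclidean_Space"
begin

text \<open>
  Two of the implications are short. If the coloring number is countable, every vertex has only
  finitely many smaller neighbours, so countable lists can be obeyed greedily along the ordering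
  (\<open>greedy_list_coloring\<close>). If \<open>G\<close> contains a Cantor graph, give the intervals \<open>I\<^sub>j\<close> pairwise disjoint
  countable lists. A coloring of the intervals is a function \<open>nat \<Rightarrow> nat\<close>; there are only continuum
  many of these, so each can be assigned a point of the Cantor set of its own, and the list of that
  point consists of the colors which the function gives to the intervals containing it. No coloring
  obeys these lists (\<open>cantor_system_not_list_colorable\<close>).

  For the remaining implication let \<open>G\<close> be \<open>\<sigma>\<close>-semialgebraic without a Cantor graph.

  \<^item> \<^bold>\<open>Set theory.\<close> Suppose some operation assigns to each finite set of vertices a countable set, and
    call a set of vertices closed if it absorbs the values of the operation on its finite subsets.
    If a vertex outside a closed set \<open>M\<close> always has only finitely many neighbours in \<open>M\<close>, then an
    ordering with finite back-neighbourhoods exists: write a closed set as an increasing union of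
    smaller closed sets and order the successive differences by induction on the cardinality
    (\<open>finite_back_order_exists\<close>).

  \<^item> \<^bold>\<open>Algebra.\<close> Suppose a vertex \<open>x\<close> outside a closed set \<open>M\<close> has infinitely many neighbours in \<open>M\<close>. Let
    \<open>C\<close> contain the coordinates of the points of \<open>M\<close> and all parameters of the formulas defining the
    edges. Finitely many polynomials with coefficients from \<open>C\<close> cut out a set \<open>V\<close> containing \<open>x\<close> such
    that every other such polynomial vanishing at \<open>x\<close> vanishes on \<open>V\<close> near \<open>x\<close> (\<open>generic_locus\<close>). By
    quantifier elimination (\<open>sign_decides_exists\<close>), whether a point \<open>z\<close> is joined to a given \<open>y \<in> M\<close>
    by a given semialgebraic part of the edge relation depends only on the signs at \<open>z\<close> of finitely
    many polynomials over \<open>C\<close>. Near \<open>x\<close> these signs are constant on \<open>V\<close>: a polynomial that vanishes at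
    \<open>x\<close> vanishes on \<open>V\<close> nearby, and the others keep their sign by continuity. So every neighbour of
    \<open>x\<close> in \<open>M\<close> is a neighbour of all points of \<open>V\<close> close to \<open>x\<close> (\<open>formula_persists_on_locus\<close>).

  \<^item> \<^bold>\<open>Topology.\<close> Let \<open>D\<close> be the set of all \<open>z \<in> V\<close> that are interior, relative to \<open>V\<close>, to the
    neighbourhoods of infinitely many vertices. If \<open>D\<close> is uncountable, one builds a binary tree of
    balls around condensation points of \<open>D\<close> together with distinct vertices, such that the vertex at
    a node is joined to all points of \<open>V\<close> in the ball at that node. The branches yield a Cantor set
    of points of \<open>V\<close>, each joined to the vertices along its branch (\<open>cantor_scheme\<close>), and hence a
    Cantor graph. Therefore \<open>D\<close> is countable for every choice of the finitely many polynomials.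

  Now let the operation adjoin all these countable sets \<open>D\<close>. The set \<open>D\<close> belonging to \<open>x\<close> is determined
  by finitely many elements of \<open>M\<close>, so \<open>x \<in> D \<subseteq> M\<close>, contrary to the choice of \<open>x\<close>.
\<close>

section \<open>Well-orderings with finite back-neighbourhoods\<close>

text \<open>
  Closure under a finitary, set-valued operation plays the part of closure under Skolem functions:
  below, \<open>f F\<close> collects the points that are determined up to countably many choices by \<open>F\<close>.
\<close>

definition op_closed :: "('a set \<Rightarrow> 'a set) \<Rightarrow> 'a set \<Rightarrow> bool" where
  "op_closed f M \<longleftrightarrow> (\<forall>F. finite F \<and> F \<subseteq> M \<longrightarrow> f F \<subseteq> M)"

lemma op_closed_Inter: "(\<And>M. M \<in> \<M> \<Longrightarrow> op_closed f M) \<Longrightarrow> op_closed f (\<Inter>\<M>)"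
  unfolding op_closed_def by blast

lemma op_closed_chain_Union:
  assumes "\<C> \<noteq> {}" and "\<And>M. M \<in> \<C> \<Longrightarrow> op_closed f M" and "subset.chain UNIV \<C>"
  shows "op_closed f (\<Union>\<C>)"
  unfolding op_closed_def
proof (intro allI impI, elim conjE)
  fix F assume "finite F" "F \<subseteq> \<Union>\<C>"
  then obtain M where "M \<in> \<C>" "F \<subseteq> M"
    using finite_subset_Union_chain[of F \<C> UNIV] assms(1,3) by metis
  then show "f F \<subseteq> \<Union>\<C>"
    using assms(2) \<open>finite F\<close> unfolding op_closed_def by blast
qed

lemma countable_iff_card_of: "countable A \<longleftrightarrow> |A| \<le>o |UNIV :: nat set|"
  unfolding countable_def card_of_ordLeq[symmetric] by auto

lemma card_of_Fpow_ordLeq: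
  assumes "infinite A"
  shows "|Fpow A| \<le>o |A|"
proof -
  define L where "L n = {xs. set xs \<subseteq> A \<and> length xs = n}" for n :: nat
  have L: "|L n| \<le>o |A|" for n
  proof (induction n)
    case 0
    have "L 0 = {[]}" by (auto simp: L_def)
    moreover have "A \<noteq> {}" using assms by auto
    ultimately show ?case by (simp add: card_of_singl_ordLeq)
  next
    case (Suc n)
    have "L (Suc n) = (\<lambda>(x, xs). x # xs) ` (A \<times> L n)"
      by (auto simp: L_def length_Suc_conv image_iff)
    then have "|L (Suc n)| \<le>o |A \<times> L n|" by (simp add: card_of_image)
    also have "|A \<times> L n| \<le>o |A \<times> A|" using Suc card_of_Times_mono2 by blast
    also have "|A \<times> A| =o |A|" using assms by (rule card_of_Times_same_infinite)
    finally show ?case .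
  qed
  have "Fpow A \<subseteq> set ` (\<Union>n. L n)"
  proof
    fix F assume "F \<in> Fpow A"
    then obtain xs where "set xs = F" "F \<subseteq> A" using finite_list unfolding Fpow_def by blast
    then show "F \<in> set ` (\<Union>n. L n)" unfolding L_def by blast
  qed
  then have "|Fpow A| \<le>o |\<Union>n. L n|"
    by (rule ordLeq_transitive[OF card_of_mono1 card_of_image])
  also have "|\<Union>n. L n| \<le>o |A|"
    using assms L by (intro card_of_UNION_ordLeq_infinite) (auto simp: infinite_iff_card_of_nat)
  finally show ?thesis .
qed

text \<open>
  The downward Loewenheim-Skolem bound: the closure arises in \<open>\<omega>\<close> stages, and an infinite set has no
  more finite subsets than elements.
\<close>

lemma card_of_op_hull:
  assumes "\<And>F. finite F \<Longrightarrow> countable (f F)" and "infinite B" and "|A| \<le>o |B|"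
  shows "|op_closed f hull A| \<le>o |B|"
proof -
  define S where "S = rec_nat A (\<lambda>_ X. X \<union> (\<Union>F\<in>Fpow X. f F))"
  have S0: "S 0 = A" and SS: "S (Suc n) = S n \<union> (\<Union>F\<in>Fpow (S n). f F)" for n
    by (simp_all add: S_def)
  have natB: "|UNIV :: nat set| \<le>o |B|" using assms(2) infinite_iff_card_of_nat by blast
  have fB: "|f F| \<le>o |B|" if "finite F" for F
    using ordLeq_transitive[OF _ natB] assms(1)[OF that] by (simp add: countable_iff_card_of)
  have S: "|S n| \<le>o |B|" for n
  proof (induction n)
    case (Suc n)
    have "|Fpow (S n)| \<le>o |B|"
    proof (cases "finite (S n)")
      case True
      then have "countable (Fpow (S n))" by (simp add: countable_Fpow countable_finite)
      then show ?thesis using ordLeq_transitive[OF _ natB] by (simp add: countable_iff_card_of)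
    next
      case False
      then show ?thesis by (rule ordLeq_transitive[OF card_of_Fpow_ordLeq Suc])
    qed
    then have "|\<Union>F\<in>Fpow (S n). f F| \<le>o |B|"
      using fB assms(2) by (intro card_of_UNION_ordLeq_infinite) (auto simp: Fpow_def)
    with Suc show ?case
      unfolding SS using assms(2) by (intro card_of_Un_ordLeq_infinite_Field) (auto simp: Field_card_of card_of_card_order_on)
  qed (simp add: S0 assms(3))
  have mono: "S m \<subseteq> S n" if "m \<le> n" for m n
    using that by (rule lift_Suc_mono_le[rotated]) (auto simp: SS)
  have "op_closed f (\<Union>n. S n)"
    unfolding op_closed_def
  proof (intro allI impI, elim conjE)
    fix F assume F: "finite F" "F \<subseteq> (\<Union>n. S n)"
    have "S m \<subseteq> S n \<or> S n \<subseteq> S m" for m n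
      using mono[of m n] mono[of n m] by linarith
    then have "subset.chain UNIV (range S)"
      unfolding subset_chain_def by auto
    then obtain X where "X \<in> range S" "F \<subseteq> X"
      using finite_subset_Union_chain[OF F] by blast
    then obtain n where "F \<subseteq> S n" by auto
    with F have "f F \<subseteq> S (Suc n)" unfolding SS Fpow_def by blast
    then show "f F \<subseteq> (\<Union>n. S n)" by blast
  qed
  moreover have "A \<subseteq> (\<Union>n. S n)" unfolding S0[symmetric] by blast
  ultimately have "op_closed f hull A \<subseteq> (\<Union>n. S n)" by (intro hull_minimal)
  then have "|op_closed f hull A| \<le>o |\<Union>n. S n|" by (rule card_of_mono1)
  also have "|\<Union>n. S n| \<le>o |B|"
    using assms(2) S natB by (intro card_of_UNION_ordLeq_infinite) auto
  finally show ?thesis .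
qed

definition finite_back_order :: "'v rel \<Rightarrow> 'v set \<Rightarrow> 'v rel \<Rightarrow> bool" where
  "finite_back_order E M r \<longleftrightarrow> well_order_on M r \<and>
     (\<forall>x\<in>M. finite {y \<in> M. (x, y) \<in> E \<and> (y, x) \<in> r \<and> y \<noteq> x})"

text \<open>
  The lexicographic order: first by the layer \<open>\<alpha> x\<close>, then inside the layer.
\<close>

lemma well_order_on_layers:
  fixes M :: "'a set"
  assumes w: "well_order_on I w" and \<alpha>: "\<And>x. x \<in> M \<Longrightarrow> \<alpha> x \<in> I"
    and r: "\<And>a. a \<in> I \<Longrightarrow> well_order_on (K a) (r a)"
    and K: "\<And>x. x \<in> M \<Longrightarrow> x \<in> K (\<alpha> x)"
  shows "well_order_on M {(x, y). x \<in> M \<and> y \<in> M \<and>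
     ((\<alpha> x, \<alpha> y) \<in> w - Id \<or> \<alpha> x = \<alpha> y \<and> (x, y) \<in> r (\<alpha> x))}" (is "well_order_on M ?R")
proof -
  have wl: "trans w" "antisym w" "total_on I w" "wf (w - Id)"
    using w by (auto simp: order_on_defs)
  have rl: "refl_on (K a) (r a)" "trans (r a)" "antisym (r a)" "total_on (K a) (r a)" "wf (r a - Id)"
    if "a \<in> I" for a
    using r[OF that]
    by (auto simp: order_on_defs)
  have "refl_on M ?R"
    using rl(1) \<alpha> K by (auto simp: refl_on_def)
  moreover have "?R \<subseteq> M \<times> M" by auto
  moreover have "trans ?R"
  proof (rule transI)
    fix x y z assume xy: "(x, y) \<in> ?R" and yz: "(y, z) \<in> ?R"
    then have M: "x \<in> M" "y \<in> M" "z \<in> M" by auto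
    have le: "(\<alpha> x, \<alpha> y) \<in> w" "(\<alpha> y, \<alpha> z) \<in> w"
      using xy yz w \<alpha>[OF M(1)] \<alpha>[OF M(2)]
      by (auto simp: order_on_defs refl_on_def)
    then have "(\<alpha> x, \<alpha> z) \<in> w" using wl(1) by (blast dest: transD)
    moreover have "(x, z) \<in> r (\<alpha> x)" if eq: "\<alpha> x = \<alpha> z"
    proof -
      have "\<alpha> x = \<alpha> y" using le eq wl(2) by (auto dest: antisymD)
      then have "(x, y) \<in> r (\<alpha> x)" "(y, z) \<in> r (\<alpha> x)" using xy yz eq by auto
      then show ?thesis using rl(2)[OF \<alpha>[OF M(1)]] by (blast dest: transD)
    qed
    ultimately show "(x, z) \<in> ?R" using M by auto
  qed
  moreover have "antisym ?R"
  proof (rule antisymI)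
    fix x y assume xy: "(x, y) \<in> ?R" and yx: "(y, x) \<in> ?R"
    then have M: "x \<in> M" "y \<in> M" by auto
    have "\<alpha> x = \<alpha> y" using xy yx wl(2) by (auto dest: antisymD)
    then have "(x, y) \<in> r (\<alpha> x)" "(y, x) \<in> r (\<alpha> x)" using xy yx by auto
    then show "x = y" using rl(3)[OF \<alpha>[OF M(1)]] by (blast dest: antisymD)
  qed
  moreover have "total_on M ?R"
  proof (rule total_onI)
    fix x y assume M: "x \<in> M" "y \<in> M" "x \<noteq> y"
    show "(x, y) \<in> ?R \<or> (y, x) \<in> ?R"
    proof (cases "\<alpha> x = \<alpha> y")
      case True
      then have "(x, y) \<in> r (\<alpha> x) \<or> (y, x) \<in> r (\<alpha> x)"
        using rl(4)[OF \<alpha>[OF M(1)]] K[OF M(1)] K[OF M(2)] M(3) by (simp add: total_on_def)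
      then show ?thesis using M True by auto
    next
      case False
      then have "(\<alpha> x, \<alpha> y) \<in> w \<or> (\<alpha> y, \<alpha> x) \<in> w"
        using wl(3) \<alpha>[OF M(1)] \<alpha>[OF M(2)] by (simp add: total_on_def)
      then show ?thesis using M False by auto
    qed
  qed
  moreover have "wf (?R - Id)"
  proof (rule wfI_min)
    fix x and Q :: "'a set" assume "x \<in> Q"
    show "\<exists>z\<in>Q. \<forall>y. (y, z) \<in> ?R - Id \<longrightarrow> y \<notin> Q"
    proof (cases "Q \<inter> M = {}")
      case True
      then show ?thesis using \<open>x \<in> Q\<close> by auto
    next
      case False
      then obtain a where a: "a \<in> \<alpha> ` (Q \<inter> M)" "\<And>b. (b, a) \<in> w - Id \<Longrightarrow> b \<notin> \<alpha> ` (Q \<inter> M)"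
        using wfE_min'[OF wl(4), of "\<alpha> ` (Q \<inter> M)"] by auto
      then have "a \<in> I" using \<alpha> by auto
      obtain z where z: "z \<in> Q \<inter> M \<inter> \<alpha> -` {a}"
        "\<And>y. (y, z) \<in> r a - Id \<Longrightarrow> y \<notin> Q \<inter> M \<inter> \<alpha> -` {a}"
        using wfE_min'[OF rl(5)[OF \<open>a \<in> I\<close>], of "Q \<inter> M \<inter> \<alpha> -` {a}"] a(1) by auto
      then show ?thesis using a(2) by (intro bexI[of _ z]) auto
    qed
  qed
  ultimately show ?thesis
    by (simp add: order_on_defs)
qed

lemma finite_back_order_countable:
  assumes "countable M"
  shows "\<exists>r. finite_back_order E M r"
proof -
  let ?c = "to_nat_on M"
  let ?r = "{(x, y). x \<in> M \<and> y \<in> M \<and> ?c x \<le> ?c y}"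
  have inj: "inj_on ?c M" using assms by auto
  have "well_order_on M ?r"
    unfolding order_on_defs
  proof (intro conjI)
    show "wf (?r - Id)"
    proof (rule wf_subset)
      show "wf (inv_image less_than ?c)" by simp
      show "?r - Id \<subseteq> inv_image less_than ?c"
      proof (rule subrelI)
        fix x y assume "(x, y) \<in> ?r - Id"
        then show "(x, y) \<in> inv_image less_than ?c" using inj_onD[OF inj, of x y] by force
      qed
    qed
    show "antisym ?r"
      using inj by (intro antisymI) (auto dest: inj_onD)
  qed (auto simp: refl_on_def trans_def total_on_def)
  moreover have "finite {y \<in> M. (x, y) \<in> E \<and> (y, x) \<in> ?r \<and> y \<noteq> x}" for x
  proof (rule inj_on_finite[of ?c _ "{..?c x}"])
    show "inj_on ?c {y \<in> M. (x, y) \<in> E \<and> (y, x) \<in> ?r \<and> y \<noteq> x}"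
      using inj by (rule inj_on_subset) auto
  qed auto
  ultimately show ?thesis unfolding finite_back_order_def by blast
qed

text \<open>
  Induction on the cardinality of the closed set \<open>M\<close>. If \<open>M\<close> is uncountable, let \<open>K a\<close> be the closure of
  the elements before \<open>a\<close> in a well-ordering of \<open>M\<close> of minimal type. Each \<open>K a\<close> is smaller than \<open>M\<close>, so
  it has a good order; \<open>x\<close> is placed in the layer of the first \<open>a\<close> with \<open>x \<in> K a\<close>. The neighbours of
  \<open>x\<close> in earlier layers lie in a union of a chain of closed sets that omits \<open>x\<close>, so there are only
  finitely many of them, and inside its own layer \<open>x\<close> has finitely many by the choice of the order on
  \<open>K a\<close>.
\<close>

lemma finite_back_order_exists:
  fixes E :: "'v rel"
  assumes cnt: "\<And>F. finite F \<Longrightarrow> countable (f F)"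
    and fin: "\<And>M x. op_closed f M \<Longrightarrow> M \<subseteq> V \<Longrightarrow> x \<in> V - M \<Longrightarrow> finite {y \<in> M. (x, y) \<in> E}"
    and V: "op_closed f V"
  shows "\<exists>r. finite_back_order E V r"
proof -
  have "op_closed f M \<Longrightarrow> M \<subseteq> V \<Longrightarrow> \<exists>r. finite_back_order E M r" for M
  proof (induction M rule: wf_induct_rule[OF wf_inv_image[OF wf_ordLess, of card_of]])
    case (1 M)
    show ?case
    proof (cases "countable M")
      case True
      then show ?thesis by (rule finite_back_order_countable)
    next
      case unc: False
      then have infM: "infinite M" using countable_finite by blast
      let ?w = "|M|"
      have wo: "well_order_on M ?w" by (rule card_of_well_order_on)
      have wl: "trans ?w" "antisym ?w" "total_on M ?w" "wf (?w - Id)"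
        using wo by (auto simp: order_on_defs)
      define K where "K a = op_closed f hull (underS ?w a)" for a
      have Kcl: "op_closed f (K a)" for a
        unfolding K_def by (rule hull_in) (blast intro: op_closed_Inter)
      have uM: "underS ?w a \<subseteq> M" for a
        using well_order_on_domain[OF wo] by (auto simp: underS_def)
      have KM: "K a \<subseteq> M" for a
        unfolding K_def using 1(2) uM by (intro hull_minimal)
      have Ksmall: "|K a| <o |M|" if "a \<in> M" for a
      proof (cases "finite (underS ?w a)")
        case True
        have "|underS ?w a| \<le>o |UNIV :: nat set|"
          using True by (simp add: countable_iff_card_of[symmetric] countable_finite)
        then have "|K a| \<le>o |UNIV :: nat set|"
          unfolding K_def by (intro card_of_op_hull cnt) auto
        also have "|UNIV :: nat set| <o |M|"
          using unc countable_iff_card_of[of M]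
            not_ordLeq_iff_ordLess[OF card_of_Well_order card_of_Well_order] by blast
        finally show ?thesis .
      next
        case False
        then have "|K a| \<le>o |underS ?w a|"
          unfolding K_def using cnt by (intro card_of_op_hull) (auto intro: card_of_mono1)
        also have "|underS ?w a| <o ?w"
          using that by (intro card_of_underS card_of_Card_order) (simp add: Field_card_of)
        finally show ?thesis .
      qed
      have Kmono: "K a \<subseteq> K b" if "(a, b) \<in> ?w" for a b
        unfolding K_def
      proof (intro hull_mono subsetI)
        fix c assume "c \<in> underS ?w a"
        then have c: "(c, a) \<in> ?w" "c \<noteq> a" by (auto simp: underS_def)
        have "c \<noteq> b" using c antisymD[OF wl(2) c(1)] that by blast
        moreover have "(c, b) \<in> ?w" using c(1) that wl(1) by (rule transD[rotated])
        ultimately show "c \<in> underS ?w b" by (simp add: underS_def)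
      qed
      have ex: "\<exists>a\<in>M. x \<in> K a" if x: "x \<in> M" for x
      proof -
        obtain a where "a \<in> M" "x \<noteq> a" "(x, a) \<in> ?w"
          using infinite_Card_order_limit[OF card_of_Card_order, of M x] x infM
          unfolding Field_card_of by blast
        then have "x \<in> underS ?w a" by (auto simp: underS_def)
        then have "x \<in> K a" unfolding K_def by (rule hull_inc)
        then show ?thesis using \<open>a \<in> M\<close> by blast
      qed
      have "\<exists>a\<in>M. x \<in> K a \<and> (\<forall>b. (b, a) \<in> ?w - Id \<longrightarrow> x \<notin> K b)" if x: "x \<in> M" for x
      proof -
        obtain a where "a \<in> {a \<in> M. x \<in> K a}" "\<And>b. (b, a) \<in> ?w - Id \<Longrightarrow> b \<notin> {a \<in> M. x \<in> K a}"
          using wfE_min'[OF wl(4), of "{a \<in> M. x \<in> K a}"] ex[OF x] by blast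
        moreover have "b \<in> M" if "(b, a) \<in> ?w - Id" for b
          using that well_order_on_domain[OF wo] by blast
        ultimately show ?thesis by blast
      qed
      then obtain \<alpha> where \<alpha>: "\<And>x. x \<in> M \<Longrightarrow> \<alpha> x \<in> M" "\<And>x. x \<in> M \<Longrightarrow> x \<in> K (\<alpha> x)"
        "\<And>x b. x \<in> M \<Longrightarrow> (b, \<alpha> x) \<in> ?w - Id \<Longrightarrow> x \<notin> K b"
        by metis
      have "\<exists>r. finite_back_order E (K a) r" if "a \<in> M" for a
        using 1(1)[of "K a"] Ksmall[OF that] Kcl[of a] KM[of a] 1(3) unfolding in_inv_image by blast
      then obtain r where r: "\<And>a. a \<in> M \<Longrightarrow> finite_back_order E (K a) (r a)" by metis
      let ?R = "{(x, y). x \<in> M \<and> y \<in> M \<and>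
         ((\<alpha> x, \<alpha> y) \<in> ?w - Id \<or> \<alpha> x = \<alpha> y \<and> (x, y) \<in> r (\<alpha> x))}"
      have "well_order_on M ?R"
        using \<alpha>(1,2) r unfolding finite_back_order_def
        by (intro well_order_on_layers[OF wo, of M \<alpha> K r]) blast+
      moreover have "finite {y \<in> M. (x, y) \<in> E \<and> (y, x) \<in> ?R \<and> y \<noteq> x}" if x: "x \<in> M" for x
      proof -
        let ?B = "{b. (b, \<alpha> x) \<in> ?w - Id}"
        let ?N = "\<Union>b\<in>?B. K b"
        have "finite {y \<in> ?N. (x, y) \<in> E}"
        \<comment> \<open>the empty union need not be closed, hence the case distinction\<close>
        proof (cases "?B = {}")
          case False
          have "b \<in> M" if "b \<in> ?B" for b
            using that well_order_on_domain[OF wo] by blast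
          then have "K b \<subseteq> K c \<or> K c \<subseteq> K b" if "b \<in> ?B" "c \<in> ?B" for b c
            using Kmono wl(3) that unfolding total_on_def by (metis order_refl)
          then have "subset.chain UNIV (K ` ?B)"
            unfolding subset_chain_def by blast
          then have "op_closed f ?N"
            using False Kcl by (intro op_closed_chain_Union) blast+
          then show ?thesis
            using x \<alpha>(3) KM 1(3) by (intro fin) blast+
        next
          case True
          then show ?thesis by (subst True) simp
        qed
        moreover have "finite {y \<in> K (\<alpha> x). (x, y) \<in> E \<and> (y, x) \<in> r (\<alpha> x) \<and> y \<noteq> x}"
          using r \<alpha>(1,2) x unfolding finite_back_order_def by blast
        moreover have "{y \<in> M. (x, y) \<in> E \<and> (y, x) \<in> ?R \<and> y \<noteq> x} \<subseteq>
          {y \<in> ?N. (x, y) \<in> E} \<union> {y \<in> K (\<alpha> x). (x, y) \<in> E \<and> (y, x) \<in> r (\<alpha> x) \<and> y \<noteq> x}"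
        proof
          fix y assume y: "y \<in> {y \<in> M. (x, y) \<in> E \<and> (y, x) \<in> ?R \<and> y \<noteq> x}"
          then have "y \<in> K (\<alpha> y)" using \<alpha>(2) by blast
          then show "y \<in> {y \<in> ?N. (x, y) \<in> E} \<union>
            {y \<in> K (\<alpha> x). (x, y) \<in> E \<and> (y, x) \<in> r (\<alpha> x) \<and> y \<noteq> x}"
            using y by (cases "\<alpha> y = \<alpha> x") auto
        qed
        ultimately show ?thesis
          by (rule finite_subset[rotated, OF finite_UnI])
      qed
      ultimately show ?thesis unfolding finite_back_order_def by blast
    qed
  qed
  then show ?thesis using V by blast
qed

section \<open>Colouring number, list-chromatic number and countability\<close>

lemma card_of_ordIso_natLeq_iff: "|A| =o natLeq \<longleftrightarrow> countable A \<and> infinite A"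
proof -
  have "|A| =o natLeq \<longleftrightarrow> |A| =o |UNIV :: nat set|"
    using card_of_nat ordIso_symmetric ordIso_transitive by blast
  also have "\<dots> \<longleftrightarrow> countable A \<and> infinite A"
    by (simp add: ordIso_iff_ordLeq countable_iff_card_of infinite_iff_card_of_nat)
  finally show ?thesis .
qed

text \<open>
  The property minimised in the coloring number holds at \<open>\<aleph>\<^sub>0\<close>, represented by a countably infinite set of
  vertices, exactly if all back-neighbourhoods are finite; and it is attained at its minimum.
\<close>

lemma coloring_number_le_natLeq_iff:
  fixes G :: "'v graph"
  assumes "infinite (UNIV :: 'v set)"
  shows "coloring_number G \<le>o natLeq \<longleftrightarrow> (\<exists>r. finite_back_order (edges G) (verts G) r)"
proof -
  define P where "P = (\<lambda>\<kappa> :: 'v rel. \<exists>r. well_order_on (verts G) r \<and>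
       (\<forall>x\<in>verts G. |{y \<in> verts G. (x, y) \<in> edges G \<and> (y, x) \<in> r \<and> y \<noteq> x}| <o \<kappa>))"
  have col: "coloring_number G = least_cardinal P" by (simp add: coloring_number_def P_def)
  have "P |verts G|" unfolding P_def by (rule coloring_number_attained)
  note least = least_cardinal[OF card_of_Card_order, of P, OF this, folded col]
  show ?thesis
  proof
    assume le: "coloring_number G \<le>o natLeq"
    obtain r where r: "well_order_on (verts G) r"
      "\<And>x. x \<in> verts G \<Longrightarrow> |{y \<in> verts G. (x, y) \<in> edges G \<and> (y, x) \<in> r \<and> y \<noteq> x}| <o coloring_number G"
      using least(2) unfolding P_def by blast
    then show "\<exists>r. finite_back_order (edges G) (verts G) r"
      unfolding finite_back_order_def finite_iff_ordLess_natLeq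
      using ordLess_ordLeq_trans[OF _ le] by blast
  next
    assume "\<exists>r. finite_back_order (edges G) (verts G) r"
    then obtain r where r: "finite_back_order (edges G) (verts G) r" ..
    obtain N :: "'v set" where N: "countable N" "infinite N"
      using infinite_countable_subset'[OF assms] by blast
    then have Nn: "|N| =o natLeq" by (simp add: card_of_ordIso_natLeq_iff)
    have "P |N|"
      unfolding P_def
    proof (intro exI conjI ballI)
      show "well_order_on (verts G) r" using r by (simp add: finite_back_order_def)
      fix x assume "x \<in> verts G"
      then have "|{y \<in> verts G. (x, y) \<in> edges G \<and> (y, x) \<in> r \<and> y \<noteq> x}| <o natLeq"
        using r by (simp add: finite_back_order_def finite_iff_ordLess_natLeq[symmetric])
      then show "|{y \<in> verts G. (x, y) \<in> edges G \<and> (y, x) \<in> r \<and> y \<noteq> x}| <o |N|"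
        using ordIso_symmetric[OF Nn] by (rule ordLess_ordIso_trans)
    qed
    then have "coloring_number G \<le>o |N|" by (intro least(3) card_of_Card_order)
    then show "coloring_number G \<le>o natLeq" using Nn by (rule ordLeq_ordIso_trans)
  qed
qed

text \<open>
  If lists of the size of the list-chromatic number always suffice, so do larger ones: shrink every
  list to that size first.
\<close>

lemma list_chromatic_number_le_natLeq_iff:
  fixes G :: "'v graph"
  assumes G: "is_graph G" and le: "|verts G| \<le>o |UNIV :: 'c set|" and inf: "infinite (UNIV :: 'c set)"
  shows "(list_chromatic_number G :: 'c rel) \<le>o natLeq \<longleftrightarrow>
    (\<forall>\<Lambda> :: 'v \<Rightarrow> 'c set. (\<forall>x\<in>verts G. countable (\<Lambda> x) \<and> infinite (\<Lambda> x)) \<longrightarrow>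
      (\<exists>\<phi>. proper_coloring G \<phi> \<and> list_coloring G \<Lambda> \<phi>))"
proof -
  define P where "P = (\<lambda>\<kappa> :: 'c rel. \<forall>\<Lambda> :: 'v \<Rightarrow> 'c set. listing G \<kappa> \<Lambda> \<longrightarrow>
       (\<exists>\<phi>. proper_coloring G \<phi> \<and> list_coloring G \<Lambda> \<phi>))"
  let ?\<chi> = "list_chromatic_number G :: 'c rel"
  have col: "?\<chi> = least_cardinal P" by (simp add: list_chromatic_number_def P_def)
  obtain h :: "'v \<Rightarrow> 'c" where h: "inj_on h (verts G)"
    using le unfolding card_of_ordLeq[symmetric] by blast
  have "|h ` verts G| =o |verts G|"
    using h card_of_ordIso inj_on_imp_bij_betw ordIso_symmetric by blast
  then have "P |h ` verts G|"
    unfolding P_def using list_chromatic_number_attained[OF G] by blast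
  note least = least_cardinal[OF card_of_Card_order, of P, OF this, folded col]
  show ?thesis
  proof (intro iffI allI impI)
    fix \<Lambda> :: "'v \<Rightarrow> 'c set"
    assume le: "?\<chi> \<le>o natLeq" and \<Lambda>: "\<forall>x\<in>verts G. countable (\<Lambda> x) \<and> infinite (\<Lambda> x)"
    have "\<exists>L. L \<subseteq> \<Lambda> x \<and> |L| =o ?\<chi>" if "x \<in> verts G" for x
    proof -
      have "natLeq =o |\<Lambda> x|" using \<Lambda> that card_of_ordIso_natLeq_iff ordIso_symmetric by blast
      then have "?\<chi> \<le>o |\<Lambda> x|" using le by (rule ordLeq_ordIso_trans[rotated])
      then have "|Field ?\<chi>| \<le>o |\<Lambda> x|"
        using card_of_Field_ordIso[OF least(1)] by (rule ordIso_ordLeq_trans[rotated])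
      then obtain f where f: "inj_on f (Field ?\<chi>)" "f ` Field ?\<chi> \<subseteq> \<Lambda> x"
        unfolding card_of_ordLeq[symmetric] by blast
      have "|f ` Field ?\<chi>| =o |Field ?\<chi>|"
        using f(1) card_of_ordIso inj_on_imp_bij_betw ordIso_symmetric by blast
      then have "|f ` Field ?\<chi>| =o ?\<chi>" using card_of_Field_ordIso[OF least(1)] by (rule ordIso_transitive)
      then show ?thesis using f(2) by blast
    qed
    then obtain \<Lambda>' where \<Lambda>': "\<And>x. x \<in> verts G \<Longrightarrow> \<Lambda>' x \<subseteq> \<Lambda> x \<and> |\<Lambda>' x| =o ?\<chi>" by metis
    then have "listing G ?\<chi> \<Lambda>'" by (simp add: listing_def)
    then obtain \<phi> where "proper_coloring G \<phi>" "list_coloring G \<Lambda>' \<phi>" using least(2) unfolding P_def by blast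
    then show "\<exists>\<phi>. proper_coloring G \<phi> \<and> list_coloring G \<Lambda> \<phi>"
      using \<Lambda>' unfolding list_coloring_def by blast
  next
    assume all: "\<forall>\<Lambda> :: 'v \<Rightarrow> 'c set. (\<forall>x\<in>verts G. countable (\<Lambda> x) \<and> infinite (\<Lambda> x)) \<longrightarrow>
      (\<exists>\<phi>. proper_coloring G \<phi> \<and> list_coloring G \<Lambda> \<phi>)"
    obtain N :: "'c set" where N: "countable N" "infinite N"
      using infinite_countable_subset'[OF inf] by blast
    then have Nn: "|N| =o natLeq" by (simp add: card_of_ordIso_natLeq_iff)
    have "P |N|"
      unfolding P_def listing_def
    proof (intro allI impI)
      fix \<Lambda> :: "'v \<Rightarrow> 'c set" assume "\<forall>x\<in>verts G. |\<Lambda> x| =o |N|"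
      then have "\<forall>x\<in>verts G. countable (\<Lambda> x) \<and> infinite (\<Lambda> x)"
        unfolding card_of_ordIso_natLeq_iff[symmetric] using ordIso_transitive[OF _ Nn] by blast
      then show "\<exists>\<phi>. proper_coloring G \<phi> \<and> list_coloring G \<Lambda> \<phi>" using all by blast
    qed
    then have "?\<chi> \<le>o |N|" by (intro least(3) card_of_Card_order)
    then show "?\<chi> \<le>o natLeq" using Nn by (rule ordLeq_ordIso_trans)
  qed
qed

text \<open>
  Each vertex takes a color of its list that differs from the finitely many colors already given to
  its smaller neighbours.
\<close>

lemma greedy_list_coloring:
  fixes \<Lambda> :: "'v \<Rightarrow> 'c set"
  assumes G: "is_graph G" and r: "finite_back_order (edges G) (verts G) r"
    and \<Lambda>: "\<forall>x\<in>verts G. infinite (\<Lambda> x)"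
  shows "\<exists>\<phi>. proper_coloring G \<phi> \<and> list_coloring G \<Lambda> \<phi>"
proof -
  define B where "B x = {y \<in> verts G. (x, y) \<in> edges G \<and> (y, x) \<in> r \<and> y \<noteq> x}" for x
  have wo: "well_order_on (verts G) r" and fin: "\<And>x. x \<in> verts G \<Longrightarrow> finite (B x)"
    using r by (auto simp: finite_back_order_def B_def)
  have wf: "wf (r - Id)" and tot: "total_on (verts G) r" using wo by (auto simp: order_on_defs)
  define \<phi> where "\<phi> = wfrec (r - Id) (\<lambda>f x. SOME c. c \<in> \<Lambda> x \<and> c \<notin> f ` B x)"
  have \<phi>: "\<phi> x = (SOME c. c \<in> \<Lambda> x \<and> c \<notin> \<phi> ` B x)" for x
  proof -
    have "cut \<phi> (r - Id) x ` B x = \<phi> ` B x"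
      by (rule image_cong) (auto simp: cut_def B_def)
    then show ?thesis
      using wfrec[OF wf, of "\<lambda>f x. SOME c. c \<in> \<Lambda> x \<and> c \<notin> f ` B x" x]
      unfolding \<phi>_def[symmetric] by simp
  qed
  have *: "\<phi> x \<in> \<Lambda> x \<and> \<phi> x \<notin> \<phi> ` B x" if x: "x \<in> verts G" for x
  proof -
    have "infinite (\<Lambda> x - \<phi> ` B x)" using \<Lambda> x fin[OF x] by (intro Diff_infinite_finite) auto
    then have "\<exists>c. c \<in> \<Lambda> x \<and> c \<notin> \<phi> ` B x" by (metis DiffD1 DiffD2 finite.emptyI all_not_in_conv)
    from someI_ex[OF this] show ?thesis unfolding \<phi>[symmetric] .
  qed
  have "\<phi> x \<noteq> \<phi> y" if xy: "(x, y) \<in> edges G" for x y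
  proof -
    have V: "x \<in> verts G" "y \<in> verts G" "x \<noteq> y" "(y, x) \<in> edges G"
      using xy G by (auto simp: is_graph_def irrefl_on_def dest: symD)
    then have "x \<in> B y \<or> y \<in> B x"
      using tot xy by (auto simp: total_on_def B_def)
    then show ?thesis using *[OF V(1)] *[OF V(2)] by (metis imageI)
  qed
  then show ?thesis
    using * unfolding proper_coloring_def list_coloring_def by blast
qed

section \<open>Matching the real roots of two polynomials\<close>

text \<open>
  On an interval without interior critical point a polynomial is injective by Rolle's theorem, hence
  strictly monotone.
\<close>

lemma poly_gap_mono:
  fixes P :: "real poly"
  assumes "l < t" "t < u" and "\<And>s. l < s \<Longrightarrow> s < u \<Longrightarrow> poly (pderiv P) s \<noteq> 0"
  shows "(poly P l < poly P t \<and> poly P t < poly P u) \<or> (poly P u < poly P t \<and> poly P t < poly P l)"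
proof (rule continuous_inj_imp_mono[OF assms(1,2)])
  show "continuous_on {l..u} (poly P)" by (intro continuous_intros)
  have "poly P x \<noteq> poly P y" if "l \<le> x" "x < y" "y \<le> u" for x y
    using poly_MVT[OF \<open>x < y\<close>, of P] assms(3) that by fastforce
  then show "inj_on (poly P) {l..u}"
    by (intro linorder_inj_onI) auto
qed

text \<open>
  On such a gap the signs at the two ends determine the whole sign pattern: there is a root inside
  exactly if the ends have opposite signs, and then the sign at \<open>t\<close> depends only on the side of the
  root on which \<open>t\<close> lies. Two polynomials with matching end signs therefore have matching patterns.
\<close>

lemma poly_gap_sgn:
  fixes P P' :: "real poly"
  assumes t: "l < t" "t < u" and d: "\<And>s. l < s \<Longrightarrow> s < u \<Longrightarrow> poly (pderiv P) s \<noteq> 0"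
    and t': "l' < t'" "t' < u'" and d': "\<And>s. l' < s \<Longrightarrow> s < u' \<Longrightarrow> poly (pderiv P') s \<noteq> 0"
    and ends: "sgn (poly P l) = sgn (poly P' l')" "sgn (poly P u) = sgn (poly P' u')"
    and side: "\<And>w w'. l < w \<Longrightarrow> w < u \<Longrightarrow> poly P w = 0 \<Longrightarrow> l' < w' \<Longrightarrow> w' < u' \<Longrightarrow> poly P' w' = 0
      \<Longrightarrow> (t < w \<longleftrightarrow> t' < w') \<and> (w < t \<longleftrightarrow> w' < t')"
  shows "sgn (poly P t) = sgn (poly P' t')"
proof (cases "poly P l * poly P u < 0")
  case True
  then have True': "poly P' l' * poly P' u' < 0"
    using ends by (metis sgn_less sgn_mult)
  obtain w where w: "l < w" "w < u" "poly P w = 0" using poly_IVT[of l u P] t True by auto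
  obtain w' where w': "l' < w'" "w' < u'" "poly P' w' = 0" using poly_IVT[of l' u' P'] t' True' by auto
  note s = side[OF w w']
  consider "t < w" "t' < w'" | "t = w" "t' = w'" | "w < t" "w' < t'"
    using s by linarith
  then show ?thesis
  proof cases
    case 1
    have "sgn (poly P t) = sgn (poly P l)"
      using poly_gap_mono[of l t w P] t w 1 d poly_gap_mono[OF w(1,2) d]
      by (smt (verit) sgn_pos sgn_neg)
    moreover have "sgn (poly P' t') = sgn (poly P' l')"
      using poly_gap_mono[of l' t' w' P'] t' w' 1 d' poly_gap_mono[OF w'(1,2) d']
      by (smt (verit) sgn_pos sgn_neg)
    ultimately show ?thesis using ends by simp
  next
    case 2
    then show ?thesis using w w' by simp
  next
    case 3
    have "sgn (poly P t) = sgn (poly P u)"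
      using poly_gap_mono[of w t u P] t w 3 d poly_gap_mono[OF w(1,2) d]
      by (smt (verit) sgn_pos sgn_neg)
    moreover have "sgn (poly P' t') = sgn (poly P' u')"
      using poly_gap_mono[of w' t' u' P'] t' w' 3 d' poly_gap_mono[OF w'(1,2) d']
      by (smt (verit) sgn_pos sgn_neg)
    ultimately show ?thesis using ends by simp
  qed
next
  case False
  have *: "sgn (poly Q s) = (if poly Q a = 0 then sgn (poly Q b) else sgn (poly Q a))"
    if "a < s" "s < b" "\<not> poly Q a * poly Q b < 0" "\<And>s. a < s \<Longrightarrow> s < b \<Longrightarrow> poly (pderiv Q) s \<noteq> 0"
    for Q :: "real poly" and a b s
    using poly_gap_mono[OF that(1,2,4)] that(3)
    by (smt (verit) mult_neg_pos mult_pos_neg sgn_pos sgn_neg)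
  have "\<not> poly P' l' * poly P' u' < 0"
    using False ends by (metis sgn_less sgn_mult)
  then show ?thesis
    using *[OF t False d] *[OF t' _ d'] ends by (simp add: sgn_0_0 del: sgn_0_0) (metis sgn_0_0)
qed

lemma poly_gap_root_iff:
  fixes P :: "real poly"
  assumes "l < u" and d: "\<And>s. l < s \<Longrightarrow> s < u \<Longrightarrow> poly (pderiv P) s \<noteq> 0"
  shows "(\<exists>w. l < w \<and> w < u \<and> poly P w = 0) \<longleftrightarrow> poly P l * poly P u < 0"
proof
  assume "\<exists>w. l < w \<and> w < u \<and> poly P w = 0"
  then obtain w where "l < w" "w < u" "poly P w = 0" by blast
  then show "poly P l * poly P u < 0"
    using poly_gap_mono[of l w u P] d by (auto simp: mult_less_0_iff)
qed (use poly_IVT[OF assms(1)] in blast)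

lemma poly_sgn_at_ends:
  fixes P :: "real poly"
  assumes "P \<noteq> 0"
  shows "\<exists>B0. \<forall>B\<ge>B0. sgn (poly P B) = sgn (lead_coeff P) \<and>
    sgn (poly P (- B)) = sgn (lead_coeff P) * (-1) ^ degree P"
proof -
  have top: "\<exists>n. \<forall>x\<ge>n. sgn (poly Q x) = sgn (lead_coeff Q)" if "Q \<noteq> 0" for Q :: "real poly"
  proof (cases "lead_coeff Q > 0")
    case True
    then obtain n where "\<forall>x\<ge>n. lead_coeff Q \<le> poly Q x" using poly_pinfty_gt_lc[of Q] by blast
    then have "\<forall>x\<ge>n. 0 < poly Q x" using True by fastforce
    then show ?thesis using True by (intro exI[of _ n]) simp
  next
    case False
    then have "lead_coeff (- Q) > 0" using that by (simp add: order_less_le)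
    then obtain n where "\<forall>x\<ge>n. poly (- Q) x \<ge> lead_coeff (- Q)"
      using poly_pinfty_gt_lc[of "- Q"] by blast
    then have "\<forall>x\<ge>n. poly Q x < 0" using \<open>lead_coeff (- Q) > 0\<close> by fastforce
    then show ?thesis using \<open>lead_coeff (- Q) > 0\<close> by (intro exI[of _ n]) simp
  qed
  define Q where "Q = pcompose P [:0, -1:]"
  have lc: "lead_coeff Q = lead_coeff P * (-1) ^ degree P"
    unfolding Q_def by (subst lead_coeff_comp) auto
  then have "Q \<noteq> 0" using assms by auto
  obtain n1 where n1: "\<forall>x\<ge>n1. sgn (poly P x) = sgn (lead_coeff P)" using top[OF assms] by blast
  obtain n2 where n2: "\<forall>x\<ge>n2. sgn (poly Q x) = sgn (lead_coeff Q)" using top[OF \<open>Q \<noteq> 0\<close>] by blast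
  have "poly Q x = poly P (- x)" for x by (simp add: Q_def poly_pcompose)
  then have "sgn (poly P (- B)) = sgn (lead_coeff P) * (-1) ^ degree P" if "B \<ge> n2" for B
    using n2 that lc by (cases "even (degree P)") (simp_all add: sgn_mult)
  then show ?thesis using n1 by (intro exI[of _ "max n1 n2"]) auto
qed

text \<open>
  A finite set \<open>Z\<close> divides the line into its points and the open intervals between them. The point \<open>t\<close>
  lies among the points of \<open>Z\<close> as \<open>t'\<close> lies among the images of these points.
\<close>

definition same_cell :: "real set \<Rightarrow> (real \<Rightarrow> real) \<Rightarrow> real \<Rightarrow> real \<Rightarrow> bool" where
  "same_cell Z m t t' \<longleftrightarrow> (\<forall>z\<in>Z. (z < t \<longleftrightarrow> m z < t') \<and> (t < z \<longleftrightarrow> t' < m z))"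

lemma between_finite_sets:
  fixes L R :: "real set"
  assumes "finite L" "finite R" "\<And>l r. l \<in> L \<Longrightarrow> r \<in> R \<Longrightarrow> l < r"
  shows "\<exists>t. (\<forall>l\<in>L. l < t) \<and> (\<forall>r\<in>R. t < r)"
proof (cases "L = {} \<or> R = {}")
  case True
  then consider "L = {}" | "R = {}" by blast
  then show ?thesis
  proof cases
    case 1
    have "Min (insert 0 R) - 1 < r" if "r \<in> R" for r
    proof -
      have "Min (insert 0 R) \<le> r" using assms(2) that by (intro Min_le) auto
      then show ?thesis by linarith
    qed
    then show ?thesis using 1 by blast
  next
    case 2
    have "l < Max (insert 0 L) + 1" if "l \<in> L" for l
    proof -
      have "l \<le> Max (insert 0 L)" using assms(1) that by (intro Max_ge) auto
      then show ?thesis by linarith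
    qed
    then show ?thesis using 2 by blast
  qed
next
  case False
  then have "Max L < Min R" using assms by simp
  then obtain t where "Max L < t" "t < Min R" using dense by blast
  then show ?thesis using False assms(1,2) by (intro exI[of _ t]) auto
qed

lemma same_cell_exists:
  assumes "finite Z" "strict_mono_on Z m"
  shows "\<exists>t'. same_cell Z m t t'" and "\<exists>t. same_cell Z m t t'"
proof -
  have less: "m a < m b \<longleftrightarrow> a < b" if "a \<in> Z" "b \<in> Z" for a b
    using assms(2) that by (metis strict_mono_on_less)
  show "\<exists>t'. same_cell Z m t t'"
  proof (cases "t \<in> Z")
    case True
    then show ?thesis using less by (intro exI[of _ "m t"]) (auto simp: same_cell_def)
  next
    case False
    obtain t' where "\<forall>l\<in>m ` {z \<in> Z. z < t}. l < t'" "\<forall>r\<in>m ` {z \<in> Z. t < z}. t' < r"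
      using between_finite_sets[of "m ` {z \<in> Z. z < t}" "m ` {z \<in> Z. t < z}"] assms(1) less by fastforce
    then show ?thesis using False
      unfolding same_cell_def by (intro exI[of _ t'] ballI) (metis (mono_tags, lifting) imageI less_asym linorder_less_linear mem_Collect_eq)
  qed
  show "\<exists>t. same_cell Z m t t'"
  proof (cases "t' \<in> m ` Z")
    case True
    then obtain t where "t \<in> Z" "t' = m t" by blast
    then show ?thesis using less by (intro exI[of _ t]) (auto simp: same_cell_def)
  next
    case False
    obtain t where t: "\<forall>l\<in>{z \<in> Z. m z < t'}. l < t" "\<forall>r\<in>{z \<in> Z. t' < m z}. t < r"
      using between_finite_sets[of "{z \<in> Z. m z < t'}" "{z \<in> Z. t' < m z}"] assms(1) less by fastforce
    have "m z < t' \<or> t' < m z" if "z \<in> Z" for z using False that by (metis imageI linorder_less_linear)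
    then show ?thesis using t
      unfolding same_cell_def by (intro exI[of _ t] ballI) (metis (mono_tags, lifting) less_asym mem_Collect_eq)
  qed
qed


lemma same_cell_memD:
  assumes "same_cell Z m t t'"
  shows "t \<in> Z \<Longrightarrow> t' = m t" and "z \<in> Z \<Longrightarrow> t' = m z \<Longrightarrow> t = z"
proof -
  show "t \<in> Z \<Longrightarrow> t' = m t" using assms unfolding same_cell_def by (metis linorder_less_linear less_irrefl)
  show "z \<in> Z \<Longrightarrow> t' = m z \<Longrightarrow> t = z" using assms unfolding same_cell_def by (metis linorder_less_linear less_irrefl)
qed

lemma same_cell_trans:
  assumes "same_cell Z m s t'" "same_cell Z m t t'" "same_cell Z m t s'"
  shows "same_cell Z m s s'"
  using assms unfolding same_cell_def by blast

text \<open>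
  Points of one open cell, together with matching points of the corresponding cell, can be enclosed in
  bounded gaps at whose ends the polynomials have equal signs. Where a cell is bounded its end points
  serve; towards infinity a far away point does, since there the sign is that of the leading
  coefficient, up to the parity of the degree.
\<close>

lemma cell_gap:
  fixes P P' :: "real poly"
  assumes Z: "finite Z" "strict_mono_on Z m"
    and P: "degree P = degree P'" "P \<noteq> 0" "P' \<noteq> 0" "sgn (lead_coeff P) = sgn (lead_coeff P')"
    and sg: "\<And>z. z \<in> Z \<Longrightarrow> sgn (poly P z) = sgn (poly P' (m z))"
    and t: "t \<notin> Z" "same_cell Z m t t'"
    and x: "same_cell Z m x t'" and x': "same_cell Z m t x'"
  obtains l u l' u' where
    "l < t" "t < u" "l < x" "x < u" "l' < t'" "t' < u'" "l' < x'" "x' < u'"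
    "sgn (poly P l) = sgn (poly P' l')" "sgn (poly P u) = sgn (poly P' u')"
    "\<forall>s. l < s \<and> s < u \<longrightarrow> s \<notin> Z" "\<forall>s. l < s \<and> s < u \<longrightarrow> same_cell Z m s t'"
    "\<forall>s. l' < s \<and> s < u' \<longrightarrow> s \<notin> m ` Z" "\<forall>s. l' < s \<and> s < u' \<longrightarrow> same_cell Z m t s"
proof -
  obtain B0 where B0: "\<forall>B\<ge>B0. sgn (poly P B) = sgn (lead_coeff P) \<and>
    sgn (poly P (- B)) = sgn (lead_coeff P) * (-1) ^ degree P"
    using poly_sgn_at_ends[OF P(2)] by blast
  obtain B1 where B1: "\<forall>B\<ge>B1. sgn (poly P' B) = sgn (lead_coeff P') \<and>
    sgn (poly P' (- B)) = sgn (lead_coeff P') * (-1) ^ degree P'"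
    using poly_sgn_at_ends[OF P(3)] by blast
  define B where "B = Max {B0, B1, \<bar>t\<bar> + 1, \<bar>x\<bar> + 1, \<bar>t'\<bar> + 1, \<bar>x'\<bar> + 1}"
  have B: "B \<ge> B0" "B \<ge> B1" "B \<ge> \<bar>t\<bar> + 1" "B \<ge> \<bar>x\<bar> + 1" "B \<ge> \<bar>t'\<bar> + 1" "B \<ge> \<bar>x'\<bar> + 1"
    unfolding B_def by (rule Max_ge; simp)+
  have le: "m a \<le> m b \<longleftrightarrow> a \<le> b" if "a \<in> Z" "b \<in> Z" for a b
    using strict_mono_on_less_eq[OF Z(2)] that by simp
  have "\<exists>l l'. l < t \<and> l < x \<and> l' < t' \<and> l' < x' \<and> sgn (poly P l) = sgn (poly P' l') \<and>
    (\<forall>z\<in>Z. z < t \<longrightarrow> z \<le> l \<and> m z \<le> l')"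
  proof (cases "{z \<in> Z. z < t} = {}")
    case True
    have "sgn (poly P (- B)) = sgn (poly P' (- B))" using B0 B1 B(1,2) P by simp
    then show ?thesis using True B by (intro exI[of _ "- B"]) auto
  next
    case False
    define l where "l = Max {z \<in> Z. z < t}"
    have "l \<in> {z \<in> Z. z < t}" unfolding l_def using False Z(1) by (intro Max_in) auto
    moreover have "z \<le> l" if "z \<in> Z" "z < t" for z
      unfolding l_def using that Z(1) by (intro Max_ge) auto
    ultimately show ?thesis
      using sg le t(2) x x' by (intro exI[of _ l] exI[of _ "m l"]) (auto simp: same_cell_def)
  qed
  then obtain l l' where l: "l < t" "l < x" "l' < t'" "l' < x'" "sgn (poly P l) = sgn (poly P' l')"
    "\<And>z. z \<in> Z \<Longrightarrow> z < t \<Longrightarrow> z \<le> l \<and> m z \<le> l'" by blast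
  have "\<exists>u u'. t < u \<and> x < u \<and> t' < u' \<and> x' < u' \<and> sgn (poly P u) = sgn (poly P' u') \<and>
    (\<forall>z\<in>Z. t < z \<longrightarrow> u \<le> z \<and> u' \<le> m z)"
  proof (cases "{z \<in> Z. t < z} = {}")
    case True
    have "sgn (poly P B) = sgn (poly P' B)" using B0 B1 B(1,2) P by simp
    then show ?thesis using True B by (intro exI[of _ B]) auto
  next
    case False
    define u where "u = Min {z \<in> Z. t < z}"
    have "u \<in> {z \<in> Z. t < z}" unfolding u_def using False Z(1) by (intro Min_in) auto
    moreover have "u \<le> z" if "z \<in> Z" "t < z" for z
      unfolding u_def using that Z(1) by (intro Min_le) auto
    ultimately show ?thesis
      using sg le t(2) x x' by (intro exI[of _ u] exI[of _ "m u"]) (auto simp: same_cell_def)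
  qed
  then obtain u u' where u: "t < u" "x < u" "t' < u'" "x' < u'" "sgn (poly P u) = sgn (poly P' u')"
    "\<And>z. z \<in> Z \<Longrightarrow> t < z \<Longrightarrow> u \<le> z \<and> u' \<le> m z" by blast
  have Zt: "z < t \<and> m z < t' \<or> t < z \<and> t' < m z" if "z \<in> Z" for z
    using t that unfolding same_cell_def by (metis linorder_less_linear less_irrefl)
  have "s \<notin> Z \<and> same_cell Z m s t'" if "l < s" "s < u" for s
  proof -
    have *: "z < s \<and> z < t \<and> m z < t' \<or> s < z \<and> t < z \<and> t' < m z" if z: "z \<in> Z" for z
      using Zt[OF z] l(6)[OF z] u(6)[OF z] \<open>l < s\<close> \<open>s < u\<close> by linarith
    then show ?thesis unfolding same_cell_def by (meson less_asym)
  qed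
  moreover have "s \<notin> m ` Z \<and> same_cell Z m t s" if "l' < s" "s < u'" for s
  proof -
    have *: "m z < s \<and> z < t \<or> s < m z \<and> t < z" if z: "z \<in> Z" for z
      using Zt[OF z] l(6)[OF z] u(6)[OF z] \<open>l' < s\<close> \<open>s < u'\<close> by linarith
    then show ?thesis unfolding same_cell_def by (metis imageE less_asym less_irrefl)
  qed
  ultimately show ?thesis
    using l(1-5) u(1-5) by (intro that[of l u l' u'] allI impI) blast+
qed

text \<open>
  The inductive step of sign matching. \<open>Z\<close> contains all critical points of \<open>P\<close>, its image those of
  \<open>P'\<close>, and the signs of \<open>P\<close> and \<open>P'\<close> agree along \<open>m\<close>. By Rolle each open cell contains at most one root
  of \<open>P\<close>, and it contains one exactly if the corresponding cell contains a root of \<open>P'\<close>; so \<open>m\<close> can be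
  extended to the roots, and the extension again matches signs.
\<close>

lemma match_roots_step:
  fixes P P' :: "real poly"
  assumes Z: "finite Z" "strict_mono_on Z m"
    and P: "degree P = degree P'" "P \<noteq> 0" "P' \<noteq> 0" "sgn (lead_coeff P) = sgn (lead_coeff P')"
    and d: "\<And>t. poly (pderiv P) t = 0 \<Longrightarrow> t \<in> Z"
    and d': "\<And>t. poly (pderiv P') t = 0 \<Longrightarrow> t \<in> m ` Z"
    and sg: "\<And>z. z \<in> Z \<Longrightarrow> sgn (poly P z) = sgn (poly P' (m z))"
  defines "W \<equiv> {t. poly P t = 0}" and "W' \<equiv> {t. poly P' t = 0}"
  shows "\<exists>m1. strict_mono_on (Z \<union> W) m1 \<and> (\<forall>z\<in>Z. m1 z = m z) \<and> m1 ` (Z \<union> W) = m ` Z \<union> W' \<and>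
    (\<forall>t t'. same_cell (Z \<union> W) m1 t t' \<longrightarrow> sgn (poly P t) = sgn (poly P' t'))"
proof -
  note gap = cell_gap[OF Z P sg]
  have rolle: "\<exists>s\<in>Z. a < s \<and> s < b" if "a < b" "a \<in> W" "b \<in> W" for a b
    using poly_MVT[OF that(1), of P] that d unfolding W_def by fastforce
  have rolle': "\<exists>s\<in>Z. a < m s \<and> m s < b" if "a < b" "a \<in> W'" "b \<in> W'" for a b
    using poly_MVT[OF that(1), of P'] that d' unfolding W'_def by fastforce
  have uniq': "a = b" if "a \<in> W'" "b \<in> W'" "same_cell Z m t a" "same_cell Z m t b" for a b t
    using rolle'[of a b] rolle'[of b a] that unfolding same_cell_def
    by (metis linorder_less_linear less_asym)
  have root_iff: "(\<exists>w\<in>W. same_cell Z m w t') \<longleftrightarrow> (\<exists>w'\<in>W'. same_cell Z m t w')"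
    if t: "t \<notin> Z" "same_cell Z m t t'" for t t'
  proof
    assume "\<exists>w\<in>W. same_cell Z m w t'"
    then obtain w where w: "w \<in> W" "same_cell Z m w t'" by blast
    obtain l u l' u' where g: "l < t" "t < u" "l < w" "w < u" "l' < t'" "t' < u'" "l' < t'" "t' < u'"
    "sgn (poly P l) = sgn (poly P' l')" "sgn (poly P u) = sgn (poly P' u')"
    "\<forall>s. l < s \<and> s < u \<longrightarrow> s \<notin> Z" "\<forall>s. l < s \<and> s < u \<longrightarrow> same_cell Z m s t'"
    "\<forall>s. l' < s \<and> s < u' \<longrightarrow> s \<notin> m ` Z" "\<forall>s. l' < s \<and> s < u' \<longrightarrow> same_cell Z m t s"
      by (rule gap[OF _ t w(2) t(2)])
    have "poly P l * poly P u < 0"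
      using poly_gap_root_iff[of l u P] g(3,4,11) d w(1) unfolding W_def by force
    then have "poly P' l' * poly P' u' < 0" using g(9,10) by (metis sgn_less sgn_mult)
    then obtain w' where "l' < w'" "w' < u'" "poly P' w' = 0"
      using poly_IVT[of l' u' P'] g(5,6) by auto
    then show "\<exists>w'\<in>W'. same_cell Z m t w'" using g(14) unfolding W'_def by blast
  next
    assume "\<exists>w'\<in>W'. same_cell Z m t w'"
    then obtain w' where w': "w' \<in> W'" "same_cell Z m t w'" by blast
    obtain l u l' u' where g: "l < t" "t < u" "l < t" "t < u" "l' < t'" "t' < u'" "l' < w'" "w' < u'"
    "sgn (poly P l) = sgn (poly P' l')" "sgn (poly P u) = sgn (poly P' u')"
    "\<forall>s. l < s \<and> s < u \<longrightarrow> s \<notin> Z" "\<forall>s. l < s \<and> s < u \<longrightarrow> same_cell Z m s t'"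
    "\<forall>s. l' < s \<and> s < u' \<longrightarrow> s \<notin> m ` Z" "\<forall>s. l' < s \<and> s < u' \<longrightarrow> same_cell Z m t s"
      by (rule gap[OF _ t t(2) w'(2)])
    have "poly P' l' * poly P' u' < 0"
      using poly_gap_root_iff[of l' u' P'] g(7,8,13) d' w'(1) unfolding W'_def by force
    then have "poly P l * poly P u < 0" using g(9,10) by (metis sgn_less sgn_mult)
    then obtain w where "l < w" "w < u" "poly P w = 0"
      using poly_IVT[of l u P] g(1,2) by auto
    then show "\<exists>w\<in>W. same_cell Z m w t'" using g(12) unfolding W_def by blast
  qed
  have "\<exists>w'\<in>W'. same_cell Z m w w'" if "w \<in> W - Z" for w
  proof -
    obtain t' where "same_cell Z m w t'" using same_cell_exists(1)[OF Z] by blast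
    then show ?thesis using root_iff[of w t'] that by blast
  qed
  then obtain c where c: "\<And>w. w \<in> W - Z \<Longrightarrow> c w \<in> W'" "\<And>w. w \<in> W - Z \<Longrightarrow> same_cell Z m w (c w)"
    by metis
  define m1 where "m1 t = (if t \<in> Z then m t else c t)" for t
  have m1Z: "m1 z = m z" if "z \<in> Z" for z using that by (simp add: m1_def)
  have m1W: "m1 w \<in> W'" "same_cell Z m w (m1 w)" if "w \<in> W - Z" for w
    using c[OF that] that by (auto simp: m1_def)
  have WW': "m1 w \<in> W'" if "w \<in> W" for w
    using m1W(1)[of w] m1Z[of w] sg[of w] that by (cases "w \<in> Z") (auto simp: W_def W'_def sgn_0_0)
  have "strict_mono_on (Z \<union> W) m1"
  proof (rule strict_mono_onI)
    fix a b assume ab: "a \<in> Z \<union> W" "b \<in> Z \<union> W" "a < b"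
    consider "a \<in> Z" "b \<in> Z" | "a \<in> Z" "b \<in> W - Z" | "a \<in> W - Z" "b \<in> Z" | "a \<in> W - Z" "b \<in> W - Z"
      using ab by blast
    then show "m1 a < m1 b"
    proof cases
      case 1
      then show ?thesis using strict_mono_onD[OF Z(2)] ab(3) by (simp add: m1Z)
    next
      case 2
      then show ?thesis using m1W(2)[of b] ab(3) by (auto simp: same_cell_def m1Z)
    next
      case 3
      then show ?thesis using m1W(2)[of a] ab(3) by (auto simp: same_cell_def m1Z)
    next
      case 4
      then obtain s where "s \<in> Z" "a < s" "s < b" using rolle[OF ab(3)] by blast
      then have "m1 a < m s" "m s < m1 b" using m1W(2)[OF 4(1)] m1W(2)[OF 4(2)] by (auto simp: same_cell_def)
      then show ?thesis by simp
    qed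
  qed
  moreover have "m1 ` (Z \<union> W) = m ` Z \<union> W'"
  proof
    show "m1 ` (Z \<union> W) \<subseteq> m ` Z \<union> W'" using WW' m1Z by auto
    have "w' \<in> m1 ` (Z \<union> W)" if w': "w' \<in> W'" "w' \<notin> m ` Z" for w'
    proof -
      obtain t where t: "same_cell Z m t w'" using same_cell_exists(2)[OF Z] by blast
      have "t \<notin> Z" using same_cell_memD(1)[OF t] w'(2) by blast
      then obtain w where w: "w \<in> W" "same_cell Z m w w'" using root_iff[of t w'] t w'(1) by blast
      then have "w \<in> W - Z" using same_cell_memD(1)[OF w(2)] w'(2) by blast
      then have "m1 w = w'" using uniq'[OF _ w'(1) _ w(2)] m1W by blast
      then show ?thesis using w(1) by blast
    qed
    moreover have "m ` Z \<subseteq> m1 ` (Z \<union> W)" using m1Z by (metis UnCI image_eqI image_subsetI)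
    ultimately show "m ` Z \<union> W' \<subseteq> m1 ` (Z \<union> W)" by blast
  qed
  moreover have "sgn (poly P t) = sgn (poly P' t')" if tt: "same_cell (Z \<union> W) m1 t t'" for t t'
  proof -
    have tZ: "same_cell Z m t t'" using tt m1Z unfolding same_cell_def by auto
    consider "t \<in> Z" | "t \<in> W - Z" | "t \<notin> Z \<union> W" by blast
    then show ?thesis
    proof cases
      case 1
      then show ?thesis using same_cell_memD(1)[OF tZ] sg by simp
    next
      case 2
      then have "t' = m1 t" using same_cell_memD(1)[OF tt] by blast
      then show ?thesis using 2 WW'[of t] by (simp add: W_def W'_def)
    next
      case 3
      then have "t \<notin> Z" by blast
      obtain l u l' u' where g: "l < t" "t < u" "l < t" "t < u" "l' < t'" "t' < u'" "l' < t'" "t' < u'"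
    "sgn (poly P l) = sgn (poly P' l')" "sgn (poly P u) = sgn (poly P' u')"
    "\<forall>s. l < s \<and> s < u \<longrightarrow> s \<notin> Z" "\<forall>s. l < s \<and> s < u \<longrightarrow> same_cell Z m s t'"
    "\<forall>s. l' < s \<and> s < u' \<longrightarrow> s \<notin> m ` Z" "\<forall>s. l' < s \<and> s < u' \<longrightarrow> same_cell Z m t s"
        by (rule gap[OF _ \<open>t \<notin> Z\<close> tZ tZ tZ])
      show ?thesis
      proof (rule poly_gap_sgn[OF g(1,2) _ g(5,6) _ g(9,10)])
        fix w w' assume w: "l < w" "w < u" "poly P w = 0" and w': "l' < w'" "w' < u'" "poly P' w' = 0"
        have wW: "w \<in> W - Z" using g(11) w by (auto simp: W_def)
        have "same_cell Z m w w'"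
          using same_cell_trans[OF _ tZ, of w w'] g(12,14) w(1,2) w'(1,2) by simp
        then have "m1 w = w'" using uniq'[OF _ _ m1W(2)[OF wW]] m1W(1)[OF wW] w'(3) by (simp add: W'_def)
        then show "(t < w \<longleftrightarrow> t' < w') \<and> (w < t \<longleftrightarrow> w' < t')"
          using tt wW unfolding same_cell_def by blast
      qed (use g(11,13) d d' in blast)+
    qed
  qed
  ultimately show ?thesis using m1Z by blast
qed

section \<open>Polynomials with varying coefficients\<close>

text \<open>
  The polynomial functions in the variables \<open>I\<close> with coefficients in the subring generated by \<open>C\<close>.
  Functions rather than formal polynomials are used because they form a commutative ring, and univariate
  polynomials over this ring serve to single out one variable.
\<close>

inductive_set polyfun :: "real set \<Rightarrow> nat set \<Rightarrow> ((nat \<Rightarrow> real) \<Rightarrow> real) set" for C I where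
  polyfun_minus_one: "- 1 \<in> polyfun C I"
| polyfun_const: "c \<in> C \<Longrightarrow> (\<lambda>_. c) \<in> polyfun C I"
| polyfun_var: "i \<in> I \<Longrightarrow> (\<lambda>e. e i) \<in> polyfun C I"
| polyfun_add: "f \<in> polyfun C I \<Longrightarrow> g \<in> polyfun C I \<Longrightarrow> f + g \<in> polyfun C I"
| polyfun_mult: "f \<in> polyfun C I \<Longrightarrow> g \<in> polyfun C I \<Longrightarrow> f * g \<in> polyfun C I"

definition subring_set :: "'a::comm_ring_1 set \<Rightarrow> bool" where
  "subring_set A \<longleftrightarrow> - 1 \<in> A \<and> (\<forall>x\<in>A. \<forall>y\<in>A. x + y \<in> A \<and> x * y \<in> A)"

lemma subring_set_polyfun: "subring_set (polyfun C I)"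
  by (simp add: subring_set_def polyfun.intros)

lemma subring_setD:
  assumes "subring_set A"
  shows "1 \<in> A" "0 \<in> A" "x \<in> A \<Longrightarrow> - x \<in> A"
    "x \<in> A \<Longrightarrow> y \<in> A \<Longrightarrow> x + y \<in> A" "x \<in> A \<Longrightarrow> y \<in> A \<Longrightarrow> x * y \<in> A"
    "x \<in> A \<Longrightarrow> y \<in> A \<Longrightarrow> x - y \<in> A"
proof -
  have m: "- 1 \<in> A" and c: "\<And>x y. x \<in> A \<Longrightarrow> y \<in> A \<Longrightarrow> x + y \<in> A \<and> x * y \<in> A"
    using assms by (auto simp: subring_set_def)
  show 1: "1 \<in> A" using c[OF m m] by simp
  show "0 \<in> A" using c[OF m 1] by simp
  have n: "- x \<in> A" if "x \<in> A" for x using c[OF m that] by simp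
  then show "x \<in> A \<Longrightarrow> - x \<in> A" .
  show "x \<in> A \<Longrightarrow> y \<in> A \<Longrightarrow> x + y \<in> A" "x \<in> A \<Longrightarrow> y \<in> A \<Longrightarrow> x * y \<in> A" using c by auto
  show "x \<in> A \<Longrightarrow> y \<in> A \<Longrightarrow> x - y \<in> A" using c[of x "- y"] n by simp
qed

lemma subring_set_sum:
  "subring_set A \<Longrightarrow> (\<And>i. i \<in> J \<Longrightarrow> f i \<in> A) \<Longrightarrow> sum f J \<in> A"
  by (induction J rule: infinite_finite_induct) (auto intro: subring_setD)

lemma subring_set_of_nat: "subring_set A \<Longrightarrow> of_nat n \<in> A"
  by (induction n) (auto intro: subring_setD)

definition polys_over :: "'a::comm_ring_1 set \<Rightarrow> 'a poly set" where
  "polys_over A = {p. \<forall>k. coeff p k \<in> A}"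

lemma polys_over_coeff: "p \<in> polys_over A \<Longrightarrow> coeff p k \<in> A"
  by (simp add: polys_over_def)

lemma polys_over_intros:
  assumes A: "subring_set A"
  shows "p \<in> polys_over A \<Longrightarrow> q \<in> polys_over A \<Longrightarrow> p + q \<in> polys_over A"
    "p \<in> polys_over A \<Longrightarrow> q \<in> polys_over A \<Longrightarrow> p - q \<in> polys_over A"
    "p \<in> polys_over A \<Longrightarrow> q \<in> polys_over A \<Longrightarrow> p * q \<in> polys_over A"
    "c \<in> A \<Longrightarrow> p \<in> polys_over A \<Longrightarrow> smult c p \<in> polys_over A"
    "c \<in> A \<Longrightarrow> monom c n \<in> polys_over A"
    "c \<in> A \<Longrightarrow> [:c:] \<in> polys_over A"
  using subring_setD[OF A]
  by (auto simp: polys_over_def coeff_mult coeff_pCons intro!: subring_set_sum[OF A] split: nat.splits)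

definition truncate_lead :: "'a::comm_ring_1 poly \<Rightarrow> 'a poly" where
  "truncate_lead p = p - monom (lead_coeff p) (degree p)"

text \<open>
  Given by its coefficients, since the coefficient ring will be a ring of functions, which has zero
  divisors.
\<close>

definition formal_deriv :: "'a::comm_ring_1 poly \<Rightarrow> 'a poly" where
  "formal_deriv p = (\<Sum>i<degree p. monom (of_nat (Suc i) * coeff p (Suc i)) i)"

lemma coeff_formal_deriv: "coeff (formal_deriv p) k = of_nat (Suc k) * coeff p (Suc k)"
  unfolding formal_deriv_def coeff_sum
  by (cases "k < degree p") (auto simp: coeff_eq_0 if_distrib cong: if_cong)

lemma degree_le_pred: 
  assumes "degree p > 0" "\<And>i. i \<ge> degree p \<Longrightarrow> coeff q i = 0"
  shows "degree q < degree p"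
proof -
  have "degree q \<le> degree p - 1" using assms by (intro degree_le) auto
  then show ?thesis using assms(1) by simp
qed

lemma degree_truncate_lead: "degree p > 0 \<Longrightarrow> degree (truncate_lead p) < degree p"
  by (rule degree_le_pred) (auto simp: truncate_lead_def coeff_eq_0)

lemma degree_formal_deriv: "degree p > 0 \<Longrightarrow> degree (formal_deriv p) < degree p"
  by (rule degree_le_pred) (auto simp: coeff_formal_deriv coeff_eq_0)

lemma pseudo_division:
  fixes p q :: "'a::comm_ring_1 poly"
  assumes A: "subring_set A" and q: "q \<in> polys_over A" "degree q > 0"
  shows "p \<in> polys_over A \<Longrightarrow>
    \<exists>a r k. r \<in> polys_over A \<and> smult (lead_coeff q ^ k) p = a * q + r \<and> degree r < degree q"
proof (induction "degree p" arbitrary: p rule: less_induct)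
  case less
  show ?case
  proof (cases "degree p < degree q")
    case True
    then show ?thesis using less.prems by (intro exI[of _ 0] exI[of _ p]) auto
  next
    case False
    let ?c = "lead_coeff q" and ?s = "monom (lead_coeff p) (degree p - degree q)"
    define p1 where "p1 = smult ?c p - ?s * q"
    have p1: "p1 \<in> polys_over A"
      unfolding p1_def using less.prems q(1) by (intro polys_over_intros[OF A] polys_over_coeff)
    have "degree p1 < degree p"
    proof (rule degree_le_pred)
      show "degree p > 0" using False q(2) by simp
      fix i assume i: "i \<ge> degree p"
      show "coeff p1 i = 0"
      proof (cases "i = degree p")
        case True
        then show ?thesis using False by (simp add: p1_def coeff_monom_mult)
      next
        case neq: False
        then have "coeff p i = 0" "coeff q (i - (degree p - degree q)) = 0"
          using i False by (auto intro!: coeff_eq_0)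
        then show ?thesis by (simp add: p1_def coeff_monom_mult)
      qed
    qed
    then obtain a r k where r: "r \<in> polys_over A" "smult (?c ^ k) p1 = a * q + r" "degree r < degree q"
      using less.hyps p1 by blast
    have "smult (?c ^ Suc k) p = smult (?c ^ k) p1 + smult (?c ^ k) (?s * q)"
      by (simp add: p1_def smult_diff_right mult.commute)
    also have "\<dots> = (a + smult (?c ^ k) ?s) * q + r"
      using r(2) by (simp add: algebra_simps)
    finally show ?thesis using r by blast
  qed
qed

text \<open>
  What the induction on the degree consumes: derivatives (for the gaps between roots), truncations
  (in case the leading coefficient vanishes after specialization), leading coefficients, and
  pseudo-remainders (to compare signs at roots of other members).
\<close>

definition elimination_closed :: "'a::comm_ring_1 poly set \<Rightarrow> bool" where
  "elimination_closed S \<longleftrightarrow>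
    (\<forall>q\<in>S. degree q > 0 \<longrightarrow> formal_deriv q \<in> S \<and> truncate_lead q \<in> S \<and> [:lead_coeff q:] \<in> S) \<and>
    (\<forall>p\<in>S. \<forall>q\<in>S. 0 < degree q \<and> degree q \<le> degree p \<longrightarrow>
      (\<exists>a r k. r \<in> S \<and> smult (lead_coeff q ^ k) p = a * q + r \<and> degree r < degree q))"

text \<open>
  Every operation applied to \<open>p\<close> and \<open>q\<close> yields a polynomial of smaller degree than \<open>q\<close>. So one can treat
  the degrees of \<open>q\<close> in descending order, and each step leaves the previous ones intact.
\<close>

lemma elimination_closure_exists:
  assumes A: "subring_set A" and S: "finite S" "S \<subseteq> polys_over A"
  shows "\<exists>S'. finite S' \<and> S \<subseteq> S' \<and> S' \<subseteq> polys_over A \<and> elimination_closed S'"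
proof -
  define rem where "rem p q = (SOME r. r \<in> polys_over A \<and> degree r < degree q \<and>
    (\<exists>a k. smult (lead_coeff q ^ k) p = a * q + r))" for p q :: "'a poly"
  have rem: "rem p q \<in> polys_over A" "degree (rem p q) < degree q"
    "\<exists>a k. smult (lead_coeff q ^ k) p = a * q + rem p q"
    if "p \<in> polys_over A" "q \<in> polys_over A" "degree q > 0" for p q
  proof -
    have "\<exists>r. r \<in> polys_over A \<and> degree r < degree q \<and> (\<exists>a k. smult (lead_coeff q ^ k) p = a * q + r)"
      using pseudo_division[OF A that(2,3,1)] by blast
    from someI_ex[OF this]
    show "rem p q \<in> polys_over A" "degree (rem p q) < degree q"
      "\<exists>a k. smult (lead_coeff q ^ k) p = a * q + rem p q"
      unfolding rem_def by auto
  qed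
  define ops where "ops p q = {formal_deriv q, truncate_lead q, [:lead_coeff q:], rem p q}" for p q :: "'a poly"
  have ops: "ops p q \<subseteq> polys_over A" "\<And>x. x \<in> ops p q \<Longrightarrow> degree x < degree q"
    if pq: "p \<in> polys_over A" "q \<in> polys_over A" "degree q > 0" for p q
  proof -
    have "formal_deriv q \<in> polys_over A"
      using subring_setD(5)[OF A subring_set_of_nat[OF A] polys_over_coeff[OF pq(2)]]
      by (simp only: polys_over_def coeff_formal_deriv mem_Collect_eq) blast
    moreover have "truncate_lead q \<in> polys_over A" "[:lead_coeff q:] \<in> polys_over A"
      unfolding truncate_lead_def using pq(2)
      by (auto intro!: polys_over_intros[OF A] intro: polys_over_coeff)
    ultimately show "ops p q \<subseteq> polys_over A" using rem(1)[OF pq] by (simp add: ops_def)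
    show "degree x < degree q" if x: "x \<in> ops p q" for x
      using x rem(2)[OF pq] degree_truncate_lead[OF pq(3)]
        degree_formal_deriv[OF pq(3)] pq(3)
      by (auto simp: ops_def)
  qed
  define N where "N = Suc (Max (insert 0 (degree ` S)))"
  have N: "degree p < N" if "p \<in> S" for p
    unfolding N_def less_Suc_eq_le using that S(1) by (intro Max_ge) auto
  have "\<exists>S'. finite S' \<and> S \<subseteq> S' \<and> S' \<subseteq> polys_over A \<and>
    (\<forall>p\<in>S'. \<forall>q\<in>S'. d \<le> degree q \<and> degree q \<le> degree p \<longrightarrow> ops p q \<subseteq> S')" if "1 \<le> d" "d \<le> N" for d
    using that(2,1)
  proof (induction rule: inc_induct)
    case base
    have "\<not> N \<le> degree q" if "q \<in> S" for q using N[OF that] by simp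
    then show ?case using S by blast
  next
    case (step d)
    then obtain S1 where S1: "finite S1" "S \<subseteq> S1" "S1 \<subseteq> polys_over A"
      "\<And>p q. p \<in> S1 \<Longrightarrow> q \<in> S1 \<Longrightarrow> Suc d \<le> degree q \<Longrightarrow> degree q \<le> degree p \<Longrightarrow> ops p q \<subseteq> S1"
      by (metis le_SucI)
    define D where "D = {q \<in> S1. degree q = d}"
    define S2 where "S2 = S1 \<union> (\<Union>p\<in>S1. \<Union>q\<in>D. ops p q)"
    have D: "q \<in> polys_over A" "degree q > 0" "degree q = d" "q \<in> S1" if "q \<in> D" for q
      using that S1(3) step.prems by (auto simp: D_def)
    have new: "x \<in> S1" if x: "x \<in> S2" "d \<le> degree x" for x
    proof (rule ccontr)
      assume "x \<notin> S1"
      then obtain p q where "p \<in> S1" "q \<in> D" "x \<in> ops p q" using x(1) by (auto simp: S2_def)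
      then show False using ops(2)[of p q x] D[of q] S1(3) x(2) by auto
    qed
    have "finite S2" using S1(1) by (auto simp: S2_def D_def ops_def)
    moreover have "S \<subseteq> S2" using S1(2) by (auto simp: S2_def)
    moreover have "S2 \<subseteq> polys_over A"
      using S1(3) ops(1) D(1,2) unfolding S2_def by blast
    moreover have "ops p q \<subseteq> S2" if "p \<in> S2" "q \<in> S2" "d \<le> degree q" "degree q \<le> degree p" for p q
    proof -
      have "p \<in> S1" "q \<in> S1" using new that by auto
      show ?thesis
      proof (cases "degree q = d")
        case True
        then have "q \<in> D" using \<open>q \<in> S1\<close> by (simp add: D_def)
        then show ?thesis using \<open>p \<in> S1\<close> unfolding S2_def by blast
      next
        case False
        then have "ops p q \<subseteq> S1" using S1(4) \<open>p \<in> S1\<close> \<open>q \<in> S1\<close> that(3,4) by simp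
        then show ?thesis unfolding S2_def by blast
      qed
    qed
    ultimately show ?case by (intro exI[of _ S2] conjI ballI impI) blast+
  qed
  moreover have "1 \<le> N" by (simp add: N_def)
  ultimately obtain S' where S': "finite S'" "S \<subseteq> S'" "S' \<subseteq> polys_over A"
    "\<forall>p\<in>S'. \<forall>q\<in>S'. 1 \<le> degree q \<and> degree q \<le> degree p \<longrightarrow> ops p q \<subseteq> S'"
    by (meson order_refl)
  have "elimination_closed S'"
    unfolding elimination_closed_def
  proof (intro conjI ballI impI)
    fix q assume q: "q \<in> S'" "degree q > 0"
    show "formal_deriv q \<in> S'" "truncate_lead q \<in> S'" "[:lead_coeff q:] \<in> S'"
      using S'(4)[rule_format, OF q(1) q(1)] q(2) by (simp_all add: ops_def)
  next
    fix p q assume pq: "p \<in> S'" "q \<in> S'" "0 < degree q \<and> degree q \<le> degree p"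
    then have P: "p \<in> polys_over A" "q \<in> polys_over A" "degree q > 0" using S'(3) by auto
    have "rem p q \<in> S'" using S'(4)[rule_format, OF pq(1,2)] pq(3) by (simp add: ops_def)
    then show "\<exists>a r k. r \<in> S' \<and> smult (lead_coeff q ^ k) p = a * q + r \<and> degree r < degree q"
      using rem(2,3)[OF P] by blast
  qed
  then show ?thesis using S' by blast
qed

definition specialize :: "'e \<Rightarrow> ('e \<Rightarrow> real) poly \<Rightarrow> real poly" where
  "specialize e p = map_poly (\<lambda>c. c e) p"

lemma coeff_specialize [simp]: "coeff (specialize e p) k = coeff p k e"
  by (simp add: specialize_def coeff_map_poly)

lemma sum_fun_apply': "(sum f J) e = (\<Sum>i\<in>J. f i e :: real)"
  by (induction J rule: infinite_finite_induct) auto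

lemma power_fun_apply': "((c :: 'e \<Rightarrow> real) ^ k) e = c e ^ k"
  by (induction k) auto

lemma specialize_simps [simp]:
  "specialize e (p + q) = specialize e p + specialize e q"
  "specialize e (p - q) = specialize e p - specialize e q"
  "specialize e (p * q) = specialize e p * specialize e q"
  "specialize e (smult c p) = smult (c e) (specialize e p)"
  "specialize e (monom c n) = monom (c e) n"
  "specialize e [:c:] = [:c e:]"
  "specialize e 0 = 0"
  by (auto simp: poly_eq_iff coeff_mult sum_fun_apply' coeff_pCons fun_diff_def split: nat.splits)

lemma specialize_formal_deriv: "specialize e (formal_deriv p) = pderiv (specialize e p)"
  by (auto simp: poly_eq_iff coeff_formal_deriv coeff_pderiv)

lemma degree_specialize_le: "degree (specialize e p) \<le> degree p"
  by (rule degree_le) (simp add: coeff_eq_0)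

lemma lead_coeff_specialize:
  assumes "lead_coeff p e \<noteq> 0"
  shows "degree (specialize e p) = degree p" "lead_coeff (specialize e p) = lead_coeff p e"
proof -
  show "degree (specialize e p) = degree p"
    using assms le_degree[of "specialize e p" "degree p"] degree_specialize_le[of e p] by simp
  then show "lead_coeff (specialize e p) = lead_coeff p e" by simp
qed

lemma specialize_truncate_lead: "lead_coeff p e = 0 \<Longrightarrow> specialize e (truncate_lead p) = specialize e p"
  by (simp add: truncate_lead_def)

section \<open>Quantifier elimination through sign patterns\<close>

definition roots_of :: "'e \<Rightarrow> ('e \<Rightarrow> real) poly set \<Rightarrow> real set" where
  "roots_of e S = {t. \<exists>q\<in>S. specialize e q \<noteq> 0 \<and> poly (specialize e q) t = 0}"

lemma finite_roots_of: "finite S \<Longrightarrow> finite (roots_of e S)"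
proof -
  assume "finite S"
  then have "finite (\<Union>q\<in>{q\<in>S. specialize e q \<noteq> 0}. {t. poly (specialize e q) t = 0})"
    by (intro finite_UN_I) (auto intro: poly_roots_finite)
  moreover have "roots_of e S = (\<Union>q\<in>{q\<in>S. specialize e q \<noteq> 0}. {t. poly (specialize e q) t = 0})"
    by (auto simp: roots_of_def)
  ultimately show ?thesis by simp
qed

lemma roots_of_insert:
  "roots_of e (insert p S) = (if specialize e p = 0 then {} else {t. poly (specialize e p) t = 0}) \<union> roots_of e S"
  by (auto simp: roots_of_def)

text \<open>
  The map \<open>m\<close> carries the roots of the members of \<open>S\<close> specialized at \<open>e\<close> in increasing order onto those at
  \<open>e'\<close>, and corresponding points of the line have the same sign vector. Members that vanish identically
  after specialization contribute no roots.
\<close>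

definition sign_match :: "'e \<Rightarrow> 'e \<Rightarrow> ('e \<Rightarrow> real) poly set \<Rightarrow> (real \<Rightarrow> real) \<Rightarrow> bool" where
  "sign_match e e' S m \<longleftrightarrow> strict_mono_on (roots_of e S) m \<and> m ` roots_of e S = roots_of e' S \<and>
    (\<forall>t t'. same_cell (roots_of e S) m t t' \<longrightarrow>
      (\<forall>p\<in>S. sgn (poly (specialize e p) t) = sgn (poly (specialize e' p) t')))"

lemma sign_match_insert_same_roots:
  assumes "sign_match e e' T m" and "roots_of e (insert p T) = roots_of e T"
    and "roots_of e' (insert p T) = roots_of e' T"
    and "\<And>t t'. same_cell (roots_of e T) m t t' \<Longrightarrow>
      sgn (poly (specialize e p) t) = sgn (poly (specialize e' p) t')"
  shows "sign_match e e' (insert p T) m"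
  using assms unfolding sign_match_def by auto

lemma same_cell_self: "strict_mono_on Z m \<Longrightarrow> z \<in> Z \<Longrightarrow> same_cell Z m z (m z)"
  unfolding same_cell_def using strict_mono_on_less by blast

text \<open>
  If \<open>q\<close> vanishes at \<open>z\<close>, then up to a power of the leading coefficient of \<open>q\<close> the value of \<open>p\<close> at \<open>z\<close> is that
  of the pseudo-remainder of \<open>p\<close> by \<open>q\<close>, whose sign is already matched. Choosing \<open>q\<close> of least degree
  makes its leading coefficient nonzero at \<open>e\<close>.
\<close>

lemma root_sign_by_remainder:
  assumes S: "elimination_closed S" "T \<subseteq> S" "\<And>x. x \<in> S \<Longrightarrow> degree x < degree p \<Longrightarrow> x \<in> T"
    and p: "p \<in> S" "\<And>x. x \<in> T \<Longrightarrow> degree x \<le> degree p"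
    and const: "\<And>x. x \<in> S \<Longrightarrow> degree x = 0 \<Longrightarrow> sgn (coeff x 0 e) = sgn (coeff x 0 e')"
    and z: "z \<in> roots_of e T"
    and sg: "\<And>x. x \<in> T \<Longrightarrow> sgn (poly (specialize e x) z) = sgn (poly (specialize e' x) z')"
  shows "sgn (poly (specialize e p) z) = sgn (poly (specialize e' p) z')"
proof -
  let ?Q = "\<lambda>q. q \<in> T \<and> specialize e q \<noteq> 0 \<and> poly (specialize e q) z = 0"
  obtain q where q: "?Q q" "\<And>x. ?Q x \<Longrightarrow> degree q \<le> degree x"
    using z ex_has_least_nat[of ?Q _ degree] unfolding roots_of_def by blast
  have qS: "q \<in> S" using q(1) S(2) by blast
  have dq: "degree q > 0"
  proof (rule ccontr)
    assume "\<not> degree q > 0"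
    then have "degree (specialize e q) = 0" using degree_specialize_le[of e q] by simp
    then obtain c where "specialize e q = [:c:]" by (rule degree_eq_zeroE)
    then show False using q(1) by auto
  qed
  have lc: "lead_coeff q e \<noteq> 0"
  proof
    assume "lead_coeff q e = 0"
    then have "specialize e (truncate_lead q) = specialize e q" by (rule specialize_truncate_lead)
    moreover have "degree (truncate_lead q) < degree q" using dq by (rule degree_truncate_lead)
    moreover have "truncate_lead q \<in> T"
      using S(1,3) qS dq calculation(2) p(2)[of q] q(1) unfolding elimination_closed_def
      by (meson less_le_trans)
    ultimately show False using q(1) q(2)[of "truncate_lead q"] by simp
  qed
  have "[:lead_coeff q:] \<in> S" using S(1) qS dq unfolding elimination_closed_def by blast
  from const[OF this] have lcs: "sgn (lead_coeff q e) = sgn (lead_coeff q e')" by simp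
  obtain a r k where r: "r \<in> S" "smult (lead_coeff q ^ k) p = a * q + r" "degree r < degree q"
    using S(1) p(1) qS dq p(2)[of q] q(1) unfolding elimination_closed_def by blast
  have rT: "r \<in> T" using S(3)[OF r(1)] r(3) p(2)[of q] q(1) by simp
  have eq: "lead_coeff q x ^ k * poly (specialize x p) s = poly (specialize x r) s"
    if "poly (specialize x q) s = 0" for x s
    using arg_cong[OF r(2), of "\<lambda>u. poly (specialize x u) s"] that by (simp add: power_fun_apply')
  have "sgn (poly (specialize e' q) z') = 0" using sg[of q] q(1) by simp
  then have root': "poly (specialize e' q) z' = 0" by (simp add: sgn_0_0)
  have sgn_eq: "sgn (lead_coeff q x) ^ k * sgn (poly (specialize x p) s) = sgn (poly (specialize x r) s)"
    if "poly (specialize x q) s = 0" for x s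
  proof -
    have "sgn (c ^ k) = sgn c ^ k" for c :: real by (induction k) (auto simp: sgn_mult)
    then show ?thesis using eq[OF that] by (metis sgn_mult)
  qed
  have "sgn (lead_coeff q e) ^ k * sgn (poly (specialize e p) z) =
    sgn (lead_coeff q e) ^ k * sgn (poly (specialize e' p) z')"
    using sgn_eq[of e z] sgn_eq[OF root'] q(1) sg[OF rT] lcs by simp
  moreover have "sgn (lead_coeff q e) ^ k \<noteq> 0" using lc by (metis power_not_zero sgn_0_0)
  ultimately show ?thesis using mult_left_cancel by blast
qed

text \<open>
  Induction on \<open>S\<close>, removing a member \<open>p\<close> of maximal degree, which leaves \<open>S\<close> closed. If \<open>p\<close> is constant, or
  equal to its truncation at both \<open>e\<close> and \<open>e'\<close>, the old matching works. Otherwise its derivative is a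
  nonzero member of the rest, and the roots of \<open>p\<close> are inserted by \<open>match_roots_step\<close>.
\<close>

lemma sign_match_exists:
  fixes S :: "('e \<Rightarrow> real) poly set"
  assumes "finite S" and "elimination_closed S"
    and "\<And>p. p \<in> S \<Longrightarrow> degree p = 0 \<Longrightarrow> sgn (coeff p 0 e) = sgn (coeff p 0 e')"
  shows "\<exists>m. sign_match e e' S m"
  using assms
proof (induction S rule: finite_psubset_induct)
  case (psubset S)
  note closed = psubset.prems(1) and const = psubset.prems(2)
  show ?case
  proof (cases "S = {}")
    case True
    then show ?thesis by (auto simp: sign_match_def roots_of_def strict_mono_on_def)
  next
    case False
    have "Max (degree ` S) \<in> degree ` S" using False psubset.hyps by (intro Max_in) auto
    then obtain p where p: "p \<in> S" "degree p = Max (degree ` S)" by force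
    have pmax: "degree x \<le> degree p" if "x \<in> S" for x
      unfolding p(2) using that psubset.hyps by simp
    define T where "T = S - {p}"
    have S: "S = insert p T" and TS: "T \<subset> S" "T \<subseteq> S" using p(1) by (auto simp: T_def)
    have inT: "x \<in> T" if "x \<in> S" "degree x < degree p" for x using that by (auto simp: T_def)
    have inT': "x \<in> T" if "x \<in> S" "degree x < degree q" "q \<in> T" for x q
      using inT[OF that(1)] that pmax[of q] TS(2) by fastforce
    have "elimination_closed T"
      unfolding elimination_closed_def
    proof (intro conjI ballI impI)
      fix q assume q: "q \<in> T" "degree q > 0"
      then have "formal_deriv q \<in> S" "truncate_lead q \<in> S" "[:lead_coeff q:] \<in> S"
        using closed TS(2) unfolding elimination_closed_def by auto
      then show "formal_deriv q \<in> T" "truncate_lead q \<in> T" "[:lead_coeff q:] \<in> T"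
        using inT'[OF _ _ q(1)] q(2) degree_formal_deriv[OF q(2)] degree_truncate_lead[OF q(2)] by auto
    next
      fix x q assume q: "x \<in> T" "q \<in> T" "0 < degree q \<and> degree q \<le> degree x"
      then obtain a r k where "r \<in> S" "smult (lead_coeff q ^ k) x = a * q + r" "degree r < degree q"
        using closed TS(2) unfolding elimination_closed_def by blast
      then show "\<exists>a r k. r \<in> T \<and> smult (lead_coeff q ^ k) x = a * q + r \<and> degree r < degree q"
        using inT'[OF _ _ q(2)] by blast
    qed
    then obtain m where m: "sign_match e e' T m"
      using psubset.IH[OF TS(1)] const TS(2) by blast
    show ?thesis
    proof (cases "degree p = 0")
      case True
      then obtain c where c: "p = [:c:]" by (rule degree_eq_zeroE)
      have "sgn (c e) = sgn (c e')" using const[OF p(1) True] c by simp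
      then have "sign_match e e' (insert p T) m"
        using c by (intro sign_match_insert_same_roots[OF m]) (auto simp: roots_of_insert)
      then show ?thesis using S by auto
    next
      case False
      then have dp: "degree p > 0" by simp
      have cl: "formal_deriv p \<in> T" "truncate_lead p \<in> T" "[:lead_coeff p:] \<in> S"
        using closed p(1) dp inT degree_formal_deriv[OF dp] degree_truncate_lead[OF dp]
        unfolding elimination_closed_def by blast+
      have lcs: "sgn (lead_coeff p e) = sgn (lead_coeff p e')" using const[OF cl(3)] by simp
      show ?thesis
      proof (cases "lead_coeff p e = 0")
        case True
        then have "lead_coeff p e' = 0" using lcs by (simp add: sgn_0_0)
        note eq = specialize_truncate_lead[OF True] specialize_truncate_lead[OF this]
        have "sign_match e e' (insert p T) m"
        proof (rule sign_match_insert_same_roots[OF m])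
          show "roots_of e (insert p T) = roots_of e T" "roots_of e' (insert p T) = roots_of e' T"
            using cl(2) eq unfolding roots_of_def by (metis (mono_tags, lifting) insert_iff)+
          show "sgn (poly (specialize e p) t) = sgn (poly (specialize e' p) t')"
            if "same_cell (roots_of e T) m t t'" for t t'
            using m cl(2) that unfolding sign_match_def eq[symmetric] by blast
        qed
        then show ?thesis using S by auto
      next
        case lc: False
        then have lc': "lead_coeff p e' \<noteq> 0" using lcs by (auto simp: sgn_0_0)
        let ?P = "specialize e p" and ?P' = "specialize e' p" and ?Z = "roots_of e T"
        have Z: "finite ?Z" "strict_mono_on ?Z m" "m ` ?Z = roots_of e' T"
          using m finite_roots_of[OF finite_subset[OF TS(2) psubset.hyps]] unfolding sign_match_def by simp_all
        have sm: "sgn (poly (specialize e x) t) = sgn (poly (specialize e' x) t')"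
          if "same_cell ?Z m t t'" "x \<in> T" for x t t'
          using m that unfolding sign_match_def by blast
        have P: "degree ?P = degree ?P'" "?P \<noteq> 0" "?P' \<noteq> 0"
          "sgn (lead_coeff ?P) = sgn (lead_coeff ?P')" "degree ?P > 0" "degree ?P' > 0"
          unfolding lead_coeff_specialize[OF lc] lead_coeff_specialize[OF lc']
          using lead_coeff_specialize(1)[OF lc] lead_coeff_specialize(1)[OF lc'] lcs dp by auto
        have d: "t \<in> roots_of x T" if "poly (pderiv (specialize x p)) t = 0" "degree (specialize x p) > 0" for t x
        proof -
          have "pderiv (specialize x p) \<noteq> 0" using that(2) by (simp add: pderiv_eq_0_iff)
          then show ?thesis
            using cl(1) that(1) unfolding roots_of_def specialize_formal_deriv[symmetric] by blast
        qed
        have sg: "sgn (poly ?P z) = sgn (poly ?P' (m z))" if "z \<in> ?Z" for z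
        proof (rule root_sign_by_remainder[OF closed TS(2) inT p(1) _ const that])
          show "degree x \<le> degree p" if "x \<in> T" for x using pmax TS(2) that by blast
        qed (use sm[OF same_cell_self[OF Z(2) that]] in auto)
        obtain m1 where m1: "strict_mono_on (?Z \<union> {t. poly ?P t = 0}) m1" "\<forall>z\<in>?Z. m1 z = m z"
          "m1 ` (?Z \<union> {t. poly ?P t = 0}) = m ` ?Z \<union> {t. poly ?P' t = 0}"
          "\<forall>t t'. same_cell (?Z \<union> {t. poly ?P t = 0}) m1 t t' \<longrightarrow> sgn (poly ?P t) = sgn (poly ?P' t')"
          using match_roots_step[OF Z(1,2) P(1-4) d[OF _ P(5)] _ sg] d[OF _ P(6)] unfolding Z(3) by blast
        have R: "roots_of e S = ?Z \<union> {t. poly ?P t = 0}" "roots_of e' S = m ` ?Z \<union> {t. poly ?P' t = 0}"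
          unfolding S roots_of_insert using P(2,3) Z(3) by auto
        have "sgn (poly (specialize e x) t) = sgn (poly (specialize e' x) t')"
          if t: "same_cell (roots_of e S) m1 t t'" and x: "x \<in> S" for t t' x
        proof (cases "x = p")
          case True
          then show ?thesis using m1(4) t unfolding R by blast
        next
          case False
          have "same_cell ?Z m t t'" using t m1(2) unfolding R same_cell_def by auto
          then show ?thesis using sm x False by (auto simp: S)
        qed
        then have "sign_match e e' S m1"
          unfolding sign_match_def using m1(1,3) R by auto
        then show ?thesis by blast
      qed
    qed
  qed
qed

lemma polyfun_as_poly:
  assumes "f \<in> polyfun C (insert i I)"
  shows "\<exists>P\<in>polys_over (polyfun C I). \<forall>e. f e = poly (specialize e P) (e i)"
  using assms
proof (induction rule: polyfun.induct)
  case polyfun_minus_one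
  show ?case
    by (intro bexI[of _ "[:- 1:]"] polys_over_intros[OF subring_set_polyfun] polyfun.intros) (simp add: fun_Compl_def)
next
  case (polyfun_const c)
  then show ?case
    by (intro bexI[of _ "[:\<lambda>_. c:]"] polys_over_intros[OF subring_set_polyfun] polyfun.intros) simp_all
next
  case (polyfun_var j)
  show ?case
  proof (cases "j = i")
    case True
    then show ?thesis
      by (intro bexI[of _ "monom 1 1"] polys_over_intros[OF subring_set_polyfun] subring_setD[OF subring_set_polyfun])
        (simp add: poly_monom)
  next
    case False
    then show ?thesis using polyfun_var
      by (intro bexI[of _ "[:\<lambda>e. e j:]"] polys_over_intros[OF subring_set_polyfun] polyfun.intros) auto
  qed
next
  case (polyfun_add f g)
  then obtain P Q where "P \<in> polys_over (polyfun C I)" "\<forall>e. f e = poly (specialize e P) (e i)"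
    "Q \<in> polys_over (polyfun C I)" "\<forall>e. g e = poly (specialize e Q) (e i)" by blast
  then show ?case
    by (intro bexI[of _ "P + Q"] polys_over_intros[OF subring_set_polyfun]) auto
next
  case (polyfun_mult f g)
  then obtain P Q where "P \<in> polys_over (polyfun C I)" "\<forall>e. f e = poly (specialize e P) (e i)"
    "Q \<in> polys_over (polyfun C I)" "\<forall>e. g e = poly (specialize e Q) (e i)" by blast
  then show ?case
    by (intro bexI[of _ "P * Q"] polys_over_intros[OF subring_set_polyfun]) auto
qed

lemma polyfun_mono: "f \<in> polyfun C I \<Longrightarrow> C \<subseteq> C' \<Longrightarrow> I \<subseteq> I' \<Longrightarrow> f \<in> polyfun C' I'"
  by (induction rule: polyfun.induct) (auto intro: polyfun.intros)

lemma polyfun_independent: "f \<in> polyfun C I \<Longrightarrow> i \<notin> I \<Longrightarrow> f (e(i := a)) = f e"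
  by (induction rule: polyfun.induct) (auto simp: fun_Compl_def)

lemma specialize_independent:
  "P \<in> polys_over (polyfun C I) \<Longrightarrow> i \<notin> I \<Longrightarrow> specialize (e(i := a)) P = specialize e P"
  using polys_over_coeff[of P "polyfun C I"] polyfun_independent[of _ C I i]
  by (simp add: poly_eq_iff)

lemma trm_val_polyfun: "(\<lambda>e. trm_val e s) \<in> polyfun {} UNIV"
proof (induction s)
  case Zero
  have "(\<lambda>e. trm_val e Zero) = 0" by (simp add: fun_eq_iff)
  then show ?case using subring_setD(2)[OF subring_set_polyfun] by metis
next
  case One
  have "(\<lambda>e. trm_val e trm.One) = 1" by (simp add: fun_eq_iff)
  then show ?case using subring_setD(1)[OF subring_set_polyfun] by metis
next
  case (Plus s t)
  have "(\<lambda>e. trm_val e (Plus s t)) = (\<lambda>e. trm_val e s) + (\<lambda>e. trm_val e t)" by (simp add: fun_eq_iff)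
  then show ?case using polyfun_add[OF Plus] by metis
next
  case (Times s t)
  have "(\<lambda>e. trm_val e (Times s t)) = (\<lambda>e. trm_val e s) * (\<lambda>e. trm_val e t)" by (simp add: fun_eq_iff)
  then show ?case using polyfun_mult[OF Times] by metis
qed (simp add: polyfun_var)

text \<open>
  Quantifier elimination in semantic form: the truth of a formula is a function of the signs of
  finitely many polynomial functions.
\<close>

definition sign_decides :: "((nat \<Rightarrow> real) \<Rightarrow> real) set \<Rightarrow> fml \<Rightarrow> bool" where
  "sign_decides T F \<longleftrightarrow> (\<forall>e e'. (\<forall>f\<in>T. sgn (f e) = sgn (f e')) \<longrightarrow> sat e F = sat e' F)"

text \<open>
  For an existential quantifier regard the polynomials deciding the matrix as polynomials in the
  quantified variable and close them under elimination. If two environments agree on the signs of the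
  members of degree 0, a witness for one of them is carried to a witness for the other by a sign
  matching. The members of degree 0 therefore decide the quantified formula.
\<close>

lemma sign_decides_exists:
  "\<exists>T. finite T \<and> T \<subseteq> polyfun {} UNIV \<and> sign_decides T F"
proof (induction F)
  case (Equal s t)
  have "(\<lambda>e. trm_val e s) - (\<lambda>e. trm_val e t) \<in> polyfun {} UNIV"
    by (intro subring_setD[OF subring_set_polyfun] trm_val_polyfun)
  moreover have "sign_decides {(\<lambda>e. trm_val e s) - (\<lambda>e. trm_val e t)} (Equal s t)"
    by (auto simp: sign_decides_def sgn_if split: if_splits)
  ultimately show ?case by blast
next
  case (LessEq s t)
  have "(\<lambda>e. trm_val e s) - (\<lambda>e. trm_val e t) \<in> polyfun {} UNIV"
    by (intro subring_setD[OF subring_set_polyfun] trm_val_polyfun)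
  moreover have "sign_decides {(\<lambda>e. trm_val e s) - (\<lambda>e. trm_val e t)} (LessEq s t)"
    by (auto simp: sign_decides_def sgn_if split: if_splits)
  ultimately show ?case by blast
next
  case (Neg F)
  then obtain T where "finite T" "T \<subseteq> polyfun {} UNIV" "sign_decides T F" by blast
  then show ?case by (intro exI[of _ T]) (auto simp: sign_decides_def)
next
  case (Conj F1 F2)
  then obtain T1 T2 where "finite T1" "T1 \<subseteq> polyfun {} UNIV" "sign_decides T1 F1"
    "finite T2" "T2 \<subseteq> polyfun {} UNIV" "sign_decides T2 F2" by blast
  then show ?case
    by (intro exI[of _ "T1 \<union> T2"]) (simp add: sign_decides_def ball_Un, blast)
next
  case (Exists i F)
  then obtain T where T: "finite T" "T \<subseteq> polyfun {} UNIV" "sign_decides T F" by blast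
  let ?A = "polyfun {} (UNIV - {i})"
  have "\<forall>f\<in>T. \<exists>P\<in>polys_over ?A. \<forall>e. f e = poly (specialize e P) (e i)"
    using T(2) polyfun_as_poly[of _ "{}" i "UNIV - {i}"] by (simp add: insert_Diff_if subset_iff insert_absorb)
  then obtain P where P: "\<And>f. f \<in> T \<Longrightarrow> P f \<in> polys_over ?A"
    "\<And>f e. f \<in> T \<Longrightarrow> f e = poly (specialize e (P f)) (e i)" by metis
  have "finite (P ` T)" "P ` T \<subseteq> polys_over ?A" using T(1) P(1) by auto
  from elimination_closure_exists[OF subring_set_polyfun this]
  obtain S where S: "finite S" "P ` T \<subseteq> S" "S \<subseteq> polys_over ?A" "elimination_closed S"
    by blast
  let ?T' = "(\<lambda>p. coeff p 0) ` {p \<in> S. degree p = 0}"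
  have T': "finite ?T'" "?T' \<subseteq> polyfun {} UNIV"
  proof -
    show "finite ?T'" using S(1) by simp
    have "coeff p 0 \<in> polyfun {} UNIV" if "p \<in> S" for p
      using polyfun_mono[OF polys_over_coeff[of p ?A]] S(3) that by blast
    then show "?T' \<subseteq> polyfun {} UNIV" by blast
  qed
  have transfer: "sat e' (Exists i F)"
    if sgn: "\<forall>f\<in>?T'. sgn (f e) = sgn (f e')" and sat: "sat e (Exists i F)" for e e'
  proof -
    obtain a where a: "sat (e(i := a)) F" using sat by auto
    have "\<exists>m. sign_match e e' S m"
      using sgn by (intro sign_match_exists[OF S(1,4)]) simp
    then obtain m where m: "sign_match e e' S m" ..
    then have "strict_mono_on (roots_of e S) m" unfolding sign_match_def ..
    from same_cell_exists(1)[OF finite_roots_of[OF S(1)] this]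
    obtain a' where "same_cell (roots_of e S) m a a'" ..
    with m have sgn_S: "sgn (poly (specialize e p) a) = sgn (poly (specialize e' p) a')" if "p \<in> S" for p
      using that unfolding sign_match_def by blast
    have "sgn (f (e(i := a))) = sgn (f (e'(i := a')))" if "f \<in> T" for f
    proof -
      have "P f \<in> S" using that S(2) by blast
      moreover have "specialize (x(i := b)) (P f) = specialize x (P f)" for x b
        using specialize_independent[OF P(1)[OF that], of i] by simp
      ultimately show ?thesis using sgn_S by (simp add: P(2)[OF that])
    qed
    then have "sat (e(i := a)) F = sat (e'(i := a')) F" 
      by (rule T(3)[unfolded sign_decides_def, rule_format])
    then show ?thesis using a by auto
  qed
  have "sign_decides ?T' (Exists i F)"
    unfolding sign_decides_def 
  proof (intro allI impI)
    fix e e' assume eq: "\<forall>f\<in>?T'. sgn (f e) = sgn (f e')"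
    then have eq': "\<forall>f\<in>?T'. sgn (f e') = sgn (f e)" by (metis (no_types))
    show "sat e (Exists i F) = sat e' (Exists i F)"
      using transfer[OF eq] transfer[OF eq'] by (rule iffI)
  qed
  then show ?case using T' by (intro exI[of _ ?T'] conjI)
qed

section \<open>The locus of a point\<close>

lemma polyfun_continuous: "f \<in> polyfun C I \<Longrightarrow> continuous_on UNIV f"
proof (induction rule: polyfun.induct)
  case (polyfun_var i)
  show ?case by (rule continuous_on_product_coordinates)
qed (auto simp: plus_fun_def times_fun_def fun_Compl_def one_fun_def intro!: continuous_intros)

lemma polyfun_nonzero_nearby:
  assumes "f \<in> polyfun C I" and "f x \<noteq> 0"
  shows "\<forall>\<^sub>F z in nhds x. sgn (f z) = sgn (f x)"
proof -
  have "open (f -` {y. sgn y = sgn (f x)})"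
  proof (rule open_vimage)
    have "{y. sgn y = sgn (f x)} = (if f x > 0 then {0<..} else {..<0})"
      using assms(2) by (auto simp: sgn_if split: if_splits)
    then show "open {y. sgn y = sgn (f x)}" by simp
  qed (rule polyfun_continuous[OF assms(1)])
  then show ?thesis unfolding eventually_nhds by (intro exI conjI) auto
qed

lemma polyfun_eq_poly:
  assumes "P \<in> polys_over (polyfun C I)"
  shows "(\<lambda>e. poly (specialize e P) (e i)) \<in> polyfun C (insert i I)"
proof -
  let ?A = "polyfun C (insert i I)"
  have pw: "(\<lambda>e. e i) ^ k \<in> ?A" for k
  proof (induction k)
    case 0
    show ?case unfolding power_0 by (rule subring_setD[OF subring_set_polyfun])
  next
    case (Suc k)
    then show ?case unfolding power_Suc by (intro polyfun.intros) auto
  qed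
  have "(\<lambda>e. poly (specialize e P) (e i)) = (\<Sum>k\<le>degree P. coeff P k * (\<lambda>e. e i) ^ k)"
  proof
    fix e
    have "poly (specialize e P) (e i) = (\<Sum>k\<le>degree P. coeff (specialize e P) k * e i ^ k)"
      unfolding poly_altdef using degree_specialize_le[of e P]
      by (intro sum.mono_neutral_left) (auto simp del: coeff_specialize simp: coeff_eq_0)
    then show "poly (specialize e P) (e i) = (\<Sum>k\<le>degree P. coeff P k * (\<lambda>e. e i) ^ k) e"
      by (simp add: sum_fun_apply' power_fun_apply')
  qed
  also have "\<dots> \<in> ?A"
    using pw polyfun_mono[OF polys_over_coeff[OF assms], of C "insert i I"]
    by (intro subring_set_sum[OF subring_set_polyfun] polyfun.intros) auto
  finally show ?thesis .
qed

text \<open>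
  The polynomials \<open>Q\<close> cut out, near \<open>x\<close>, the common zeros of all polynomials over \<open>C\<close> vanishing at \<open>x\<close>. The
  induction on the number of variables avoids the Hilbert basis theorem: to the polynomials chosen for
  the first \<open>n\<close> coordinates add, if there is one, a polynomial \<open>P0\<close> of least degree in the last variable
  that vanishes at \<open>x\<close>, but not identically in that variable after the first \<open>n\<close> coordinates of \<open>x\<close> have
  been inserted. The remainder of any other polynomial
  vanishing at \<open>x\<close> modulo \<open>P0\<close> then has coefficients vanishing at the first \<open>n\<close> coordinates, hence
  vanishing on the locus nearby, where moreover the leading coefficient of \<open>P0\<close> stays nonzero.
\<close>

lemma generic_locus:
  fixes x :: "nat \<Rightarrow> real"
  shows "\<exists>Q. finite Q \<and> Q \<subseteq> polyfun C {..<n} \<and> (\<forall>q\<in>Q. q x = 0) \<and>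
    (\<forall>f\<in>polyfun C {..<n}. f x = 0 \<longrightarrow> (\<forall>\<^sub>F z in nhds x. (\<forall>q\<in>Q. q z = 0) \<longrightarrow> f z = 0))"
proof (induction n)
  case 0
  have const: "f e = f e'" if "f \<in> polyfun C {}" for f and e e' :: "nat \<Rightarrow> real"
    using that by (induction rule: polyfun.induct) (auto simp: fun_Compl_def)
  have "f z = 0" if "f \<in> polyfun C {}" "f x = 0" for f z using const[OF that(1), of z x] that(2) by simp
  then show ?case by (intro exI[of _ "{}"]) simp
next
  case (Suc n)
  let ?A = "polyfun C {..<n}"
  have ins: "{..<Suc n} = insert n {..<n}" by auto
  obtain Q where Q: "finite Q" "Q \<subseteq> ?A" "\<forall>q\<in>Q. q x = 0"
    "\<And>f. f \<in> ?A \<Longrightarrow> f x = 0 \<Longrightarrow> \<forall>\<^sub>F z in nhds x. (\<forall>q\<in>Q. q z = 0) \<longrightarrow> f z = 0"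
    using Suc.IH by blast
  have Q': "Q \<subseteq> polyfun C {..<Suc n}" using Q(2) polyfun_mono[of _ C "{..<n}" C "{..<Suc n}"] by auto
  have van: "\<forall>\<^sub>F z in nhds x. (\<forall>q\<in>Q. q z = 0) \<longrightarrow> specialize z P = 0"
    if P: "P \<in> polys_over ?A" "specialize x P = 0" for P
  proof -
    have "\<forall>\<^sub>F z in nhds x. \<forall>k\<in>{..degree P}. (\<forall>q\<in>Q. q z = 0) \<longrightarrow> coeff P k z = 0"
    proof (intro eventually_ball_finite ballI)
      fix k
      have "coeff P k x = 0" using P(2) coeff_specialize[of x P k] by simp
      then show "\<forall>\<^sub>F z in nhds x. (\<forall>q\<in>Q. q z = 0) \<longrightarrow> coeff P k z = 0"
        using Q(4) polys_over_coeff[OF P(1)] by blast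
    qed simp
    then show ?thesis
    proof (rule eventually_mono, intro impI)
      fix z assume "\<forall>k\<in>{..degree P}. (\<forall>q\<in>Q. q z = 0) \<longrightarrow> coeff P k z = 0" "\<forall>q\<in>Q. q z = 0"
      then have "coeff P k z = 0" for k by (cases "k \<le> degree P") (auto simp: coeff_eq_0)
      then show "specialize z P = 0" by (simp add: poly_eq_iff)
    qed
  qed
  let ?D = "{P \<in> polys_over ?A. specialize x P \<noteq> 0 \<and> poly (specialize x P) (x n) = 0}"
  show ?case
  proof (cases "?D = {}")
    case True
    have "\<forall>\<^sub>F z in nhds x. (\<forall>q\<in>Q. q z = 0) \<longrightarrow> f z = 0" if f: "f \<in> polyfun C {..<Suc n}" "f x = 0" for f
    proof -
      obtain P where P: "P \<in> polys_over ?A" "\<And>e. f e = poly (specialize e P) (e n)"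
        using polyfun_as_poly f(1) unfolding ins by blast
      then have "specialize x P = 0" using True f(2) by auto
      from van[OF P(1) this] show ?thesis by (rule eventually_mono) (simp add: P(2))
    qed
    then show ?thesis using Q(1,3) Q' by (intro exI[of _ Q]) simp
  next
    case False
    then obtain P0 where P0: "P0 \<in> ?D" "\<And>P. P \<in> ?D \<Longrightarrow> degree P0 \<le> degree P"
      using ex_has_least_nat[of "\<lambda>P. P \<in> ?D" _ degree] by blast
    have d0: "degree P0 > 0"
    proof (rule ccontr)
      assume "\<not> degree P0 > 0"
      then have "degree (specialize x P0) = 0" using degree_specialize_le[of x P0] by simp
      then obtain c where "specialize x P0 = [:c:]" by (rule degree_eq_zeroE)
      then show False using P0(1) by auto
    qed
    have lc: "lead_coeff P0 x \<noteq> 0"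
    proof
      assume "lead_coeff P0 x = 0"
      then have eq: "specialize x (truncate_lead P0) = specialize x P0" by (rule specialize_truncate_lead)
      have "truncate_lead P0 \<in> polys_over ?A"
        using P0(1) unfolding truncate_lead_def
        by (auto intro!: polys_over_intros[OF subring_set_polyfun] intro: polys_over_coeff)
      then have "truncate_lead P0 \<in> ?D" using P0(1) eq by simp
      then show False using P0(2) degree_truncate_lead[OF d0] by fastforce
    qed
    define q0 where "q0 e = poly (specialize e P0) (e n)" for e
    have "q0 \<in> polyfun C {..<Suc n}"
      unfolding q0_def[abs_def] ins using P0(1) by (intro polyfun_eq_poly) simp
    moreover have "q0 x = 0" using P0(1) by (simp add: q0_def)
    moreover have "\<forall>\<^sub>F z in nhds x. (\<forall>q\<in>insert q0 Q. q z = 0) \<longrightarrow> f z = 0"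
      if f: "f \<in> polyfun C {..<Suc n}" "f x = 0" for f
    proof -
      obtain P where P: "P \<in> polys_over ?A" "\<And>e. f e = poly (specialize e P) (e n)"
        using polyfun_as_poly f(1) unfolding ins by blast
      obtain a r k where r: "r \<in> polys_over ?A" "smult (lead_coeff P0 ^ k) P = a * P0 + r" "degree r < degree P0"
        using pseudo_division[OF subring_set_polyfun _ d0 P(1)] P0(1) by blast
      have eq: "lead_coeff P0 z ^ k * f z = poly (specialize z a) (z n) * q0 z + poly (specialize z r) (z n)" for z
        using arg_cong[OF r(2), of "\<lambda>u. poly (specialize z u) (z n)"]
        by (simp add: P(2) q0_def power_fun_apply')
      have "poly (specialize x r) (x n) = 0" using eq[of x] f(2) \<open>q0 x = 0\<close> by simp
      then have "specialize x r = 0" using P0(2)[of r] r(1,3) by force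
      note ev1 = van[OF r(1) this]
      have "lead_coeff P0 \<in> ?A" using P0(1) polys_over_coeff by blast
      note ev2 = polyfun_nonzero_nearby[OF this lc]
      from ev1 ev2 show ?thesis
      proof eventually_elim
        case (elim z)
        show ?case
        proof
          assume z: "\<forall>q\<in>insert q0 Q. q z = 0"
          then have "lead_coeff P0 z ^ k * f z = 0" using eq[of z] elim(1) by simp
          moreover have "lead_coeff P0 z \<noteq> 0" using elim(2) lc by (metis sgn_0_0)
          ultimately show "f z = 0" by simp
        qed
      qed
    qed
    ultimately show ?thesis using Q(1,3) Q' by (intro exI[of _ "insert q0 Q"]) simp
  qed
qed

lemma countable_polyfun:
  assumes "countable C"
  shows "countable (polyfun C I)"
proof -
  define B where "B = {- 1} \<union> (\<lambda>c _. c) ` C \<union> range (\<lambda>i (e :: nat \<Rightarrow> real). e i)"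
  define S where "S = rec_nat B (\<lambda>_ X. X \<union> (\<lambda>(f, g). f + g) ` (X \<times> X) \<union> (\<lambda>(f, g). f * g) ` (X \<times> X))"
  have S0: "S 0 = B"
    and SS: "S (Suc k) = S k \<union> (\<lambda>(f, g). f + g) ` (S k \<times> S k) \<union> (\<lambda>(f, g). f * g) ` (S k \<times> S k)" for k
    by (simp_all add: S_def)
  have "countable (S k)" for k
  proof (induction k)
    case 0
    show ?case using assms by (simp add: S0 B_def)
  next
    case (Suc k)
    then show ?case unfolding SS by (intro countable_Un countable_image countable_SIGMA)
  qed
  then have "countable (\<Union>k. S k)" by simp
  moreover have mono: "S j \<subseteq> S k" if "j \<le> k" for j k
    using that by (rule lift_Suc_mono_le[rotated]) (auto simp: SS)
  have "polyfun C I \<subseteq> (\<Union>k. S k)"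
  proof
    fix f assume "f \<in> polyfun C I"
    then show "f \<in> (\<Union>k. S k)"
    proof (induction rule: polyfun.induct)
      case (polyfun_add f g)
      then obtain j k where "f \<in> S j" "g \<in> S k" by blast
      then have "f \<in> S (max j k)" "g \<in> S (max j k)" using mono[of j "max j k"] mono[of k "max j k"] by auto
      then have "f + g \<in> S (Suc (max j k))" unfolding SS by blast
      then show ?case by blast
    next
      case (polyfun_mult f g)
      then obtain j k where "f \<in> S j" "g \<in> S k" by blast
      then have "f \<in> S (max j k)" "g \<in> S (max j k)" using mono[of j "max j k"] mono[of k "max j k"] by auto
      then have "f * g \<in> S (Suc (max j k))" unfolding SS by blast
      then show ?case by blast
    next
      case polyfun_minus_one
      have "- 1 \<in> S 0" unfolding S0 B_def by blast
      then show ?case by blast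
    next
      case (polyfun_const c)
      then have "(\<lambda>_. c) \<in> S 0" unfolding S0 B_def by blast
      then show ?case by blast
    next
      case (polyfun_var i)
      have "(\<lambda>e. e i) \<in> S 0" unfolding S0 B_def by blast
      then show ?case by blast
    qed
  qed
  ultimately show ?thesis using countable_subset by blast
qed

lemma polyfun_finite_support:
  "f \<in> polyfun C I \<Longrightarrow> \<exists>C0. finite C0 \<and> C0 \<subseteq> C \<and> f \<in> polyfun C0 I"
proof (induction rule: polyfun.induct)
  case (polyfun_const c)
  then show ?case by (intro exI[of _ "{c}"] conjI polyfun.polyfun_const) auto
next
  case (polyfun_add f g)
  then obtain C1 C2 where C12: "finite C1" "C1 \<subseteq> C" "f \<in> polyfun C1 I" "finite C2" "C2 \<subseteq> C" "g \<in> polyfun C2 I"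
    by blast
  then have "f + g \<in> polyfun (C1 \<union> C2) I"
    by (intro polyfun.polyfun_add polyfun_mono[OF C12(3)] polyfun_mono[OF C12(6)]) auto
  then show ?case using C12 by (intro exI[of _ "C1 \<union> C2"]) blast
next
  case (polyfun_mult f g)
  then obtain C1 C2 where C12: "finite C1" "C1 \<subseteq> C" "f \<in> polyfun C1 I" "finite C2" "C2 \<subseteq> C" "g \<in> polyfun C2 I"
    by blast
  then have "f * g \<in> polyfun (C1 \<union> C2) I"
    by (intro polyfun.polyfun_mult polyfun_mono[OF C12(3)] polyfun_mono[OF C12(6)]) auto
  then show ?case using C12 by (intro exI[of _ "C1 \<union> C2"]) blast
next
  case polyfun_minus_one
  show ?case by (intro exI[of _ "{}"] conjI polyfun.polyfun_minus_one) auto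
next
  case (polyfun_var i)
  then show ?case by (intro exI[of _ "{}"] conjI polyfun.polyfun_var) auto
qed

lemma polyfun_subst:
  assumes "f \<in> polyfun {} UNIV" and "\<And>i. (\<lambda>z. u z i) \<in> polyfun C I"
  shows "(\<lambda>z. f (u z)) \<in> polyfun C I"
  using assms(1)
proof (induction rule: polyfun.induct)
  case polyfun_minus_one
  have "(\<lambda>z. (- 1 :: (nat \<Rightarrow> real) \<Rightarrow> real) (u z)) = - 1" by (simp add: fun_eq_iff fun_Compl_def)
  then show ?case by (simp only: polyfun.polyfun_minus_one)
next
  case (polyfun_add f g)
  have "(\<lambda>z. (f + g) (u z)) = (\<lambda>z. f (u z)) + (\<lambda>z. g (u z))" by (simp add: fun_eq_iff)
  then show ?case by (simp only: polyfun.polyfun_add[OF polyfun_add.IH])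
next
  case (polyfun_mult f g)
  have "(\<lambda>z. (f * g) (u z)) = (\<lambda>z. f (u z)) * (\<lambda>z. g (u z))" by (simp add: fun_eq_iff)
  then show ?case by (simp only: polyfun.polyfun_mult[OF polyfun_mult.IH])
qed (use assms(2) in auto)

text \<open>
  Lists of length \<open>n\<close> are embedded into the Polish space \<open>nat \<Rightarrow> real\<close>, padded with zeros, so that all
  dimensions live in one topological type.
\<close>

definition point_of :: "real list \<Rightarrow> nat \<Rightarrow> real" where
  "point_of x i = (if i < length x then x ! i else 0)"

definition list_of :: "nat \<Rightarrow> (nat \<Rightarrow> real) \<Rightarrow> real list" where
  "list_of n z = map z [0..<n]"

lemma length_list_of [simp]: "length (list_of n z) = n"
  by (simp add: list_of_def)

lemma nth_list_of [simp]: "i < n \<Longrightarrow> list_of n z ! i = z i"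
  by (simp add: list_of_def)

lemma list_of_point_of: "length x = n \<Longrightarrow> list_of n (point_of x) = x"
  by (rule nth_equalityI) (auto simp: point_of_def)

lemma inj_on_list_of: "inj_on (list_of n) {z. \<forall>i\<ge>n. z i = 0}"
proof (rule inj_onI, rule ext)
  fix z z' i assume z: "z \<in> {z. \<forall>i\<ge>n. z i = 0}" "z' \<in> {z. \<forall>i\<ge>n. z i = 0}" "list_of n z = list_of n z'"
  then show "z i = z' i" using nth_list_of[of i n z] nth_list_of[of i n z'] by (cases "i < n") auto
qed

lemma point_of_support: "length x = n \<Longrightarrow> point_of x \<in> {z. \<forall>i\<ge>n. z i = 0}"
  by (auto simp: point_of_def)

text \<open>
  The formula is decided by the signs of polynomials in \<open>z\<close> with coefficients from \<open>C\<close>. Those that vanish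
  at \<open>x\<close> vanish on the locus near \<open>x\<close>, the others keep their sign.
\<close>

lemma formula_persists_on_locus:
  assumes sat: "sat (\<lambda>i. if i < 2 * n then (x @ y) ! i else p i) F"
    and len: "length x = n" "length y = n" and C: "range p \<union> set y \<subseteq> C"
    and locus: "\<And>f. f \<in> polyfun C {..<n} \<Longrightarrow> f (point_of x) = 0 \<Longrightarrow>
      \<forall>\<^sub>F z in nhds (point_of x). (\<forall>q\<in>Q. q z = 0) \<longrightarrow> f z = 0"
  shows "\<forall>\<^sub>F z in nhds (point_of x). (\<forall>q\<in>Q. q z = 0) \<longrightarrow>
    sat (\<lambda>i. if i < 2 * n then (list_of n z @ y) ! i else p i) F"
proof -
  define R where "R z \<longleftrightarrow> (\<forall>q\<in>Q. q z = 0)" for z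
  define u where "u z i = (if i < 2 * n then (list_of n z @ y) ! i else p i)" for z i
  obtain T where T: "finite T" "T \<subseteq> polyfun {} UNIV" "sign_decides T F"
    using sign_decides_exists[of F] by blast
  have coord: "(\<lambda>z. u z i) \<in> polyfun C {..<n}" for i
  proof -
    consider "i < n" | "n \<le> i" "i < 2 * n" | "2 * n \<le> i" by linarith
    then show ?thesis
    proof cases
      case 1
      then have "(\<lambda>z. u z i) = (\<lambda>z. z i)" by (simp add: u_def fun_eq_iff nth_append)
      then show ?thesis using 1 by (simp add: polyfun_var)
    next
      case 2
      then have "(\<lambda>z. u z i) = (\<lambda>_. y ! (i - n))" by (simp add: u_def fun_eq_iff nth_append)
      moreover have "y ! (i - n) \<in> C" using 2 len(2) C by auto
      ultimately show ?thesis by (simp add: polyfun_const)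
    next
      case 3
      then have "(\<lambda>z. u z i) = (\<lambda>_. p i)" by (simp add: u_def fun_eq_iff)
      moreover have "p i \<in> C" using C by auto
      ultimately show ?thesis by (simp add: polyfun_const)
    qed
  qed
  have "\<forall>\<^sub>F z in nhds (point_of x). \<forall>f\<in>T. R z \<longrightarrow> sgn (f (u (point_of x))) = sgn (f (u z))"
  proof (intro eventually_ball_finite T(1) ballI)
    fix f assume "f \<in> T"
    then have "f \<in> polyfun {} UNIV" using T(2) by blast
    then have g: "(\<lambda>z. f (u z)) \<in> polyfun C {..<n}" using coord by (rule polyfun_subst)
    show "\<forall>\<^sub>F z in nhds (point_of x). R z \<longrightarrow> sgn (f (u (point_of x))) = sgn (f (u z))"
    proof (cases "f (u (point_of x)) = 0")
      case True
      show ?thesis using locus[OF g True, folded R_def] by (rule eventually_mono) (simp add: True)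
    next
      case False
      show ?thesis using polyfun_nonzero_nearby[OF g False] by (rule eventually_mono) simp
    qed
  qed
  then show ?thesis
    unfolding R_def[symmetric]
  proof (rule eventually_mono, intro impI)
    fix z assume "\<forall>f\<in>T. R z \<longrightarrow> sgn (f (u (point_of x))) = sgn (f (u z))" "R z"
    then have "\<forall>f\<in>T. sgn (f (u (point_of x))) = sgn (f (u z))" by blast
    then have "sat (u (point_of x)) F = sat (u z) F" using T(3) unfolding sign_decides_def by (elim allE impE)
    moreover have "u (point_of x) = (\<lambda>i. if i < 2 * n then (x @ y) ! i else p i)"
      by (simp add: u_def fun_eq_iff list_of_point_of[OF len(1)])
    ultimately show "sat (\<lambda>i. if i < 2 * n then (list_of n z @ y) ! i else p i) F"
      using sat by (simp add: u_def[abs_def])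
  qed
qed

section \<open>A Cantor scheme in a Polish space\<close>

text \<open>
  The nodes of the binary tree are numbered as the intervals of the Cantor graph: the root is 2, and
  the children of \<open>j\<close> are \<open>2 * j - 1\<close> and \<open>2 * j\<close>.
\<close>

fun branch_node :: "(nat \<Rightarrow> bool) \<Rightarrow> nat \<Rightarrow> nat" where
  "branch_node f 0 = 2"
| "branch_node f (Suc n) = (if f n then 2 * branch_node f n else 2 * branch_node f n - 1)"

lemma branch_node_ge: "n + 2 \<le> branch_node f n"
  by (induction n) auto

lemma branch_node_cong: "(\<And>i. i < n \<Longrightarrow> f i = g i) \<Longrightarrow> branch_node f n = branch_node g n"
  by (induction n) auto

lemma branch_node_parent: "(branch_node f (Suc n) + 1) div 2 = branch_node f n"
  using branch_node_ge[of n f] by auto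

lemma odd_branch_node_Suc: "odd (branch_node f (Suc n)) \<longleftrightarrow> \<not> f n"
  using branch_node_ge[of n f] by auto

definition condensation_points :: "'a::topological_space set \<Rightarrow> 'a set" where
  "condensation_points D = {z \<in> D. \<forall>W. open W \<and> z \<in> W \<longrightarrow> uncountable (D \<inter> W)}"

lemma uncountable_condensation_points:
  fixes D :: "'a::second_countable_topology set"
  assumes "uncountable (D \<inter> W)" and "open W"
  shows "uncountable (condensation_points D \<inter> W)"
proof
  assume cnt: "countable (condensation_points D \<inter> W)"
  obtain B :: "'a set set" where B: "countable B" "topological_basis B"
    using ex_countable_basis by blast
  have "D \<inter> W \<subseteq> (condensation_points D \<inter> W) \<union> (\<Union>b\<in>{b \<in> B. countable (D \<inter> b)}. D \<inter> b)"
  proof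
    fix z assume z: "z \<in> D \<inter> W"
    show "z \<in> (condensation_points D \<inter> W) \<union> (\<Union>b\<in>{b \<in> B. countable (D \<inter> b)}. D \<inter> b)"
    proof (cases "z \<in> condensation_points D")
      case False
      then obtain Q where Q: "open Q" "z \<in> Q" "countable (D \<inter> Q)"
        using z unfolding condensation_points_def by blast
      then obtain b where b: "b \<in> B" "z \<in> b" "b \<subseteq> Q" using topological_basisE[OF B(2)] by metis
      then have "countable (D \<inter> b)" using Q(3) by (meson Int_mono countable_subset order_refl)
      then show ?thesis using b z by blast
    qed (use z in blast)
  qed
  moreover have "countable (\<Union>b\<in>{b \<in> B. countable (D \<inter> b)}. D \<inter> b)"
    using B(1) by (intro countable_UN) auto
  ultimately show False using cnt assms(1) by (meson countable_Un countable_subset)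
qed

lemma two_condensation_points:
  fixes D :: "'a::{metric_space, second_countable_topology} set"
  assumes "z \<in> condensation_points D" and "0 < r" and "finite S"
  shows "\<exists>a b. a \<in> condensation_points D \<and> b \<in> condensation_points D \<and> a \<noteq> b \<and>
    a \<in> ball z r - S \<and> b \<in> ball z r - S"
proof -
  have "uncountable (D \<inter> ball z r)"
    using assms(1,2) unfolding condensation_points_def by auto
  then have "uncountable (condensation_points D \<inter> ball z r)"
    by (rule uncountable_condensation_points) simp
  then have unc: "uncountable (condensation_points D \<inter> ball z r - S)"
    using assms(3) by (simp add: countable_finite uncountable_minus_countable)
  then obtain a where a: "a \<in> condensation_points D \<inter> ball z r - S" by (metis countable_empty all_not_in_conv)
  have "uncountable (condensation_points D \<inter> ball z r - S - {a})"
    using unc by (simp add: uncountable_minus_countable)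
  then obtain b where "b \<in> condensation_points D \<inter> ball z r - S - {a}" by (metis countable_empty all_not_in_conv)
  then show ?thesis using a by blast
qed

text \<open>
  By recursion on the numbering each node receives a condensation point \<open>c j\<close> of the uncountable set, a
  radius \<open>r j\<close> and an index \<open>Y j\<close>. The two children of \<open>p\<close> get distinct condensation points in the open
  ball of \<open>p\<close> and radii small enough to make their balls disjoint; since every condensation point lies
  in infinitely many of the open sets \<open>U y\<close>, the index can be chosen different from all earlier ones,
  and the radius such that the closed ball lies in \<open>U (Y j)\<close>. Along a branch the balls shrink to a point
  of the closed set \<open>V\<close>. To keep these limit points apart from the indices, the balls of both children
  of \<open>p\<close> avoid the indices of all nodes below \<open>2 * p - 1\<close>, the number of the first child.
\<close>

lemma cantor_scheme:
  fixes V :: "'a::{complete_space, second_countable_topology} set" and U :: "'a \<Rightarrow> 'a set"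
  assumes V: "closed V" and U: "\<And>y. open (U y)"
    and unc: "uncountable {z \<in> V. infinite {y. z \<in> U y}}"
  shows "\<exists>Y X. inj_on Y {2..} \<and> inj X \<and>
    (\<forall>f. X f \<in> V \<and> (\<forall>k. X f \<in> U (Y (branch_node f k))) \<and> X f \<notin> Y ` {2..})"
proof -
  define D where "D = {z \<in> V. infinite {y. z \<in> U y}}"
  define K where "K = condensation_points D"
  have KD: "K \<subseteq> D" by (auto simp: K_def condensation_points_def)
  have "uncountable (K \<inter> UNIV)"
    unfolding K_def using unc by (intro uncountable_condensation_points) (simp_all add: D_def)
  then obtain z0 where z0: "z0 \<in> K" by (metis countable_empty all_not_in_conv inf_top_right)
  define fork where "fork z r S = (SOME ab. fst ab \<in> K \<and> snd ab \<in> K \<and> fst ab \<noteq> snd ab \<and>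
    fst ab \<in> ball z r - S \<and> snd ab \<in> ball z r - S)" for z r S
  have fork: "fst (fork z r S) \<in> K" "snd (fork z r S) \<in> K" "fst (fork z r S) \<noteq> snd (fork z r S)"
    "fst (fork z r S) \<in> ball z r - S" "snd (fork z r S) \<in> ball z r - S"
    if "z \<in> K" "0 < r" "finite S" for z r S
  proof -
    have "\<exists>ab. fst ab \<in> K \<and> snd ab \<in> K \<and> fst ab \<noteq> snd ab \<and> fst ab \<in> ball z r - S \<and> snd ab \<in> ball z r - S"
      using two_condensation_points[of z D r S] that unfolding K_def by simp
    from someI_ex[OF this, folded fork_def]
    show "fst (fork z r S) \<in> K" "snd (fork z r S) \<in> K" "fst (fork z r S) \<noteq> snd (fork z r S)"
      "fst (fork z r S) \<in> ball z r - S" "snd (fork z r S) \<in> ball z r - S" by auto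
  qed
  \<comment> \<open>a fresh index and a small ball for a given centre\<close>
  have extend: "\<exists>r y. y \<notin> N \<and> 0 < r \<and> r \<le> d \<and> cball z r \<subseteq> U y \<inter> W"
    if asm: "z \<in> K" "finite N" "open W" "z \<in> W" "0 < d" for z N W d
  proof -
    have "infinite ({y. z \<in> U y} - N)" using asm(1,2) KD by (auto simp: D_def)
    then obtain y where y: "y \<notin> N" "z \<in> U y" by (metis (mono_tags, lifting) DiffE finite.emptyI ex_in_conv mem_Collect_eq)
    have "open (U y \<inter> W)" using U asm(3) by blast
    then obtain r where "0 < r" "cball z r \<subseteq> U y \<inter> W" using y(2) asm(4) open_contains_cball by (metis IntI)
    then show ?thesis using y(1) asm(5)
      by (intro exI[of _ "min r d"] exI[of _ y]) (auto simp: subset_iff)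
  qed
  \<comment> \<open>the state at \<open>j\<close> is \<open>(centre, radius, index)\<close>; \<open>F\<close> holds the states of earlier nodes\<close>
  define P where "P F j s \<longleftrightarrow> (case s of (z, r, y) \<Rightarrow>
      z \<in> K \<and> 0 < r \<and> cball z r \<subseteq> U y \<and> y \<notin> (snd \<circ> snd \<circ> F) ` {..<j} \<and>
      (2 < j \<longrightarrow>
        (case F ((j + 1) div 2) of (zp, rp, yp) \<Rightarrow>
          let S = (snd \<circ> snd \<circ> F) ` {..<2 * ((j + 1) div 2) - 1}; ab = fork zp rp S in
          z = (if odd j then fst ab else snd ab) \<and> r \<le> rp / 2 \<and> r \<le> dist (fst ab) (snd ab) / 3 \<and>
          cball z r \<subseteq> ball zp rp - S)))" for F :: "nat \<Rightarrow> 'a \<times> real \<times> 'a" and j s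
  have "\<exists>F. \<forall>j. P F j (F j)"
  proof (rule dependent_wf_choice[of less_than])
    fix f g :: "nat \<Rightarrow> 'a \<times> real \<times> 'a" and j s
    assume eq: "\<And>i. (i, j) \<in> less_than \<Longrightarrow> f i = g i"
    have im: "(snd \<circ> snd \<circ> f) ` {..<i} = (snd \<circ> snd \<circ> g) ` {..<i}" if "i \<le> j" for i
      using eq that by (intro image_cong) auto
    show "P f j s = P g j s"
    proof (cases "2 < j")
      case True
      then have "f ((j + 1) div 2) = g ((j + 1) div 2)" "2 * ((j + 1) div 2) - 1 \<le> j"
        using eq by auto
      then show ?thesis using im[of j] im[of "2 * ((j + 1) div 2) - 1"] unfolding P_def by simp
    next
      case False
      then show ?thesis using im[of j] unfolding P_def by simp
    qed
  next
    fix j and F :: "nat \<Rightarrow> 'a \<times> real \<times> 'a"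
    assume IH: "\<And>i. (i, j) \<in> less_than \<Longrightarrow> P F i (F i)"
    let ?N = "(snd \<circ> snd \<circ> F) ` {..<j}"
    show "\<exists>s. P F j s"
    proof (cases "2 < j")
      case False
      obtain r y where "y \<notin> ?N" "0 < r" "cball z0 r \<subseteq> U y \<inter> UNIV"
        using extend[OF z0, of ?N UNIV 1] by auto
      then show ?thesis using z0 False unfolding P_def by (intro exI[of _ "(z0, r, y)"]) simp
    next
      case True
      obtain zp rp yp where p: "F ((j + 1) div 2) = (zp, rp, yp)" by (metis prod_cases3)
      define S where "S = (snd \<circ> snd \<circ> F) ` {..<2 * ((j + 1) div 2) - 1}"
      have "P F ((j + 1) div 2) (F ((j + 1) div 2))" using IH True by simp
      then have zp: "zp \<in> K" "0 < rp" unfolding P_def p by auto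
      have "finite S" by (simp add: S_def)
      note fk = fork[OF zp this]
      define z where "z = (if odd j then fst (fork zp rp S) else snd (fork zp rp S))"
      have z: "z \<in> K" "z \<in> ball zp rp - S" using fk by (auto simp: z_def)
      have "open (ball zp rp - S)" using \<open>finite S\<close> by (intro open_Diff finite_imp_closed) auto
      moreover have "0 < min (rp / 2) (dist (fst (fork zp rp S)) (snd (fork zp rp S)) / 3)"
        using zp(2) fk(3) by simp
      ultimately obtain r y where "y \<notin> ?N" "0 < r" "r \<le> min (rp / 2) (dist (fst (fork zp rp S)) (snd (fork zp rp S)) / 3)"
        "cball z r \<subseteq> U y \<inter> (ball zp rp - S)"
        using extend[OF z(1) _ _ z(2), of ?N] by blast
      then have "P F j (z, r, y)"
        using z(1) unfolding P_def p S_def[symmetric] by (simp add: Let_def z_def)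
      then show ?thesis ..
    qed
  qed simp
  then obtain F where F: "\<And>j. P F j (F j)" by blast
  define c where "c j = fst (F j)" for j
  define r where "r j = fst (snd (F j))" for j
  define Y where "Y j = snd (snd (F j))" for j
  have Fj: "F j = (c j, r j, Y j)" for j by (simp add: c_def r_def Y_def)
  have Ysnd: "snd \<circ> snd \<circ> F = Y" by (auto simp: Y_def)
  have node: "c j \<in> K" "0 < r j" "cball (c j) (r j) \<subseteq> U (Y j)" "Y j \<notin> Y ` {..<j}" for j
    using F[of j] unfolding P_def Fj Ysnd by auto
  have child: "c j = (if odd j then fst ab else snd ab)" "r j \<le> r p / 2" "r j \<le> dist (fst ab) (snd ab) / 3"
    "cball (c j) (r j) \<subseteq> ball (c p) (r p) - S"
    if "2 < j" "p = (j + 1) div 2" "S = Y ` {..<2 * p - 1}" "ab = fork (c p) (r p) S" for j p S ab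
  proof -
    have *: "c j = (if odd j then fst ab else snd ab) \<and> r j \<le> r p / 2 \<and> r j \<le> dist (fst ab) (snd ab) / 3 \<and>
      cball (c j) (r j) \<subseteq> ball (c p) (r p) - S"
      using F[of j] \<open>2 < j\<close> unfolding P_def Fj Ysnd that(2-4) prod.case Let_def by (elim conjE impE) (assumption | intro conjI)+
    then show "c j = (if odd j then fst ab else snd ab)" by (rule conjunct1)
    from * show "r j \<le> r p / 2" by (elim conjE)
    from * show "r j \<le> dist (fst ab) (snd ab) / 3" by (elim conjE)
    from * show "cball (c j) (r j) \<subseteq> ball (c p) (r p) - S" by (elim conjE)
  qed
  have "inj Y"
  proof (rule linorder_injI)
    fix i j :: nat assume "i < j"
    then have "Y i \<in> Y ` {..<j}" by blast
    then show "Y i \<noteq> Y j" using node(4)[of j] by auto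
  qed
  define n where "n = branch_node"
  have n2: "2 < n f (Suc k)" for f k using branch_node_ge[of "Suc k" f] by (simp add: n_def)
  have par: "n f k = (n f (Suc k) + 1) div 2" for f k unfolding n_def by (simp only: branch_node_parent)
  have nest: "cball (c (n f (Suc k))) (r (n f (Suc k))) \<subseteq> cball (c (n f k)) (r (n f k))" for f k
    using child(4)[OF n2 par refl refl, of f k] ball_subset_cball by blast
  have nest': "cball (c (n f m)) (r (n f m)) \<subseteq> cball (c (n f k)) (r (n f k))" if "k \<le> m" for f k m
    using that by (rule lift_Suc_antimono_le[rotated]) (rule nest)
  have small: "r (n f k) \<le> r 2 / 2 ^ k" for f k
  proof (induction k)
    case (Suc k)
    then show ?case using child(2)[OF n2 par refl refl, of f k] by simp
  qed (simp add: n_def)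
  have lim: "(\<lambda>k. r 2 / 2 ^ k) \<longlonglongrightarrow> 0"
    by (rule LIMSEQ_divide_realpow_zero) simp
  have inb: "dist (c (n f k)) (c (n f m)) \<le> r (n f k)" if "k \<le> m" for f k m
  proof -
    have "c (n f m) \<in> cball (c (n f m)) (r (n f m))" using node(2)[of "n f m"] by simp
    then have "c (n f m) \<in> cball (c (n f k)) (r (n f k))" using nest'[OF that, of f] by blast
    then show ?thesis by simp
  qed
  have "\<exists>x. (\<lambda>k. c (n f k)) \<longlonglongrightarrow> x" for f
  proof -
    have "Cauchy (\<lambda>k. c (n f k))"
    proof (rule metric_CauchyI)
      fix \<epsilon> :: real assume "0 < \<epsilon>"
      then have "\<forall>\<^sub>F k in sequentially. r 2 / 2 ^ k < \<epsilon> / 2"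
        by (intro order_tendstoD(2)[OF lim]) simp
      then obtain M where M: "r 2 / 2 ^ M < \<epsilon> / 2" unfolding eventually_sequentially by blast
      have "dist (c (n f i)) (c (n f j)) < \<epsilon>" if "M \<le> i" "M \<le> j" for i j
        using inb[OF that(1), of f] inb[OF that(2), of f] small[of f M] M
          dist_triangle3[of "c (n f i)" "c (n f j)" "c (n f M)"] by linarith
      then show "\<exists>M. \<forall>i\<ge>M. \<forall>j\<ge>M. dist (c (n f i)) (c (n f j)) < \<epsilon>" by blast
    qed
    then show ?thesis unfolding Cauchy_convergent_iff convergent_def .
  qed
  then obtain X where lim_X: "\<And>f. (\<lambda>k. c (n f k)) \<longlonglongrightarrow> X f" by metis
  have X: "X f \<in> cball (c (n f k)) (r (n f k))" for f k
  proof (rule Lim_in_closed_set[OF closed_cball _ sequentially_bot lim_X])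
    show "\<forall>\<^sub>F i in sequentially. c (n f i) \<in> cball (c (n f k)) (r (n f k))"
      using eventually_ge_at_top[of k] by eventually_elim (simp add: inb)
  qed
  have cV: "c j \<in> V" for j using node(1)[of j] KD by (auto simp: D_def)
  have "X f \<in> V" for f
    by (rule Lim_in_closed_set[OF V _ sequentially_bot lim_X]) (simp add: cV)
  moreover have "X f \<in> U (Y (branch_node f k))" for f k
    using X[of f k] node(3)[of "n f k"] unfolding n_def by blast
  moreover have "X f \<noteq> Y j" for f j
  proof -
    have "j < 2 * n f j - 1" using branch_node_ge[of j f] by (simp add: n_def)
    moreover have "X f \<notin> Y ` {..<2 * n f j - 1}"
      using child(4)[OF n2 par refl refl, of f j] X[of f "Suc j"] by blast
    ultimately show ?thesis by blast
  qed
  moreover have "inj X"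
  proof (rule injI, rule ccontr)
    fix f g assume eq: "X f = X g" and "f \<noteq> g"
    then have "\<exists>k. f k \<noteq> g k" by (simp add: fun_eq_iff)
    then obtain k where k: "f k \<noteq> g k" "\<forall>i<k. \<not> f i \<noteq> g i"
      unfolding exists_least_iff[of "\<lambda>k. f k \<noteq> g k"] by blast
    have nk: "n f k = n g k" unfolding n_def by (rule branch_node_cong) (use k(2) in simp)
    define ab where "ab = fork (c (n f k)) (r (n f k)) (Y ` {..<2 * n f k - 1})"
    have ch: "dist (X h) (if h k then snd ab else fst ab) \<le> dist (fst ab) (snd ab) / 3"
      if "n h k = n f k" for h
    proof -
      have "c (n h (Suc k)) = (if h k then snd ab else fst ab)"
        using child(1)[OF n2 par refl refl, of h k] odd_branch_node_Suc[of h k]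
        unfolding that ab_def[symmetric] n_def[symmetric] by simp
      moreover have "r (n h (Suc k)) \<le> dist (fst ab) (snd ab) / 3"
        using child(3)[OF n2 par refl refl, of h k] unfolding that ab_def[symmetric] .
      ultimately show ?thesis using X[of h "Suc k"] by (simp add: dist_commute del: branch_node.simps)
    qed
    have "fst ab \<noteq> snd ab" unfolding ab_def using fork(3) node(1,2) by simp
    then have "0 < dist (fst ab) (snd ab)" by simp
    moreover have "dist (fst ab) (snd ab) \<le> dist (X f) (fst ab) + dist (X f) (snd ab)"
      by (rule dist_triangle3)
    moreover have "dist (X f) (fst ab) \<le> dist (fst ab) (snd ab) / 3 \<and>
      dist (X f) (snd ab) \<le> dist (fst ab) (snd ab) / 3"
      using ch[OF refl] ch[OF nk[symmetric]] k(1) unfolding eq by (cases "f k") simp_all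
    ultimately show False by linarith
  qed
  ultimately show ?thesis using \<open>inj Y\<close> by (intro exI[of _ Y] exI[of _ X]) (auto intro: inj_on_subset)
qed

section \<open>The intervals of the Cantor graph\<close>

lemma cantor_interval_child:
  assumes "2 \<le> j"
  shows "cantor_interval (2 * j - 1) = (fst (cantor_interval j),
      fst (cantor_interval j) + (snd (cantor_interval j) - fst (cantor_interval j)) / 3)"
    and "cantor_interval (2 * j) = (snd (cantor_interval j) - (snd (cantor_interval j) - fst (cantor_interval j)) / 3,
      snd (cantor_interval j))"
proof -
  have "2 < 2 * j - 1" "(2 * j - 1 + 1) div 2 = j" "odd (2 * j - 1)" using assms by auto
  then show "cantor_interval (2 * j - 1) = (fst (cantor_interval j),
      fst (cantor_interval j) + (snd (cantor_interval j) - fst (cantor_interval j)) / 3)"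
    by (subst cantor_interval.simps) (simp add: case_prod_beta)
  have "2 < 2 * j" "(2 * j + 1) div 2 = j" "even (2 * j)" using assms by auto
  then show "cantor_interval (2 * j) = (snd (cantor_interval j) - (snd (cantor_interval j) - fst (cantor_interval j)) / 3,
      snd (cantor_interval j))"
    by (subst cantor_interval.simps) (simp add: case_prod_beta)
qed

lemma cantor_interval_branch_Suc:
  "cantor_interval (branch_node f (Suc k)) =
    (let (a, b) = cantor_interval (branch_node f k) in
      if f k then (b - (b - a) / 3, b) else (a, a + (b - a) / 3))"
  using cantor_interval_child[of "branch_node f k"] branch_node_ge[of k f]
  by (simp add: case_prod_beta del: One_nat_def)

lemma cantor_interval_length_branch:
  "snd (cantor_interval (branch_node f k)) - fst (cantor_interval (branch_node f k)) = 1 / 3 ^ k"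
proof (induction k)
  case 0
  show ?case by (simp add: cantor_interval_values)
next
  case (Suc k)
  have "snd (cantor_interval (branch_node f (Suc k))) - fst (cantor_interval (branch_node f (Suc k))) =
    (snd (cantor_interval (branch_node f k)) - fst (cantor_interval (branch_node f k))) / 3"
    unfolding cantor_interval_branch_Suc by (simp add: case_prod_beta)
  then show ?case unfolding Suc.IH by simp
qed

lemma parent_cases:
  assumes "2 < (j :: nat)"
  obtains "j = 2 * ((j + 1) div 2) - 1" "odd j" | "j = 2 * ((j + 1) div 2)" "even j"
  using assms by (cases "odd j") (auto elim!: oddE evenE)

lemma cantor_interval_nonempty: "fst (cantor_interval j) < snd (cantor_interval j)"
proof (induction j rule: less_induct)
  case (less j)
  show ?case
  proof (cases "j \<le> 2")
    case True
    then show ?thesis by (simp add: cantor_interval.simps)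
  next
    case False
    let ?p = "(j + 1) div 2"
    have p: "2 \<le> ?p" "?p < j" using False by auto
    have "fst (cantor_interval (2 * ?p - 1)) < snd (cantor_interval (2 * ?p - 1))"
      "fst (cantor_interval (2 * ?p)) < snd (cantor_interval (2 * ?p))"
      unfolding cantor_interval_child[OF p(1)] fst_conv snd_conv using less[OF p(2)] by (auto simp: field_simps)
    moreover have "j = 2 * ?p - 1 \<or> j = 2 * ?p" using False by presburger
    ultimately show ?thesis by metis
  qed
qed

lemma cantor_adj_child:
  assumes "2 \<le> j"
  defines "a \<equiv> fst (cantor_interval j)" and "b \<equiv> snd (cantor_interval j)"
  shows "cantor_adj (2 * j - 1) x \<longleftrightarrow> a \<le> x \<and> x \<le> a + (b - a) / 3"
    and "cantor_adj (2 * j) x \<longleftrightarrow> b - (b - a) / 3 \<le> x \<and> x \<le> b"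
  unfolding cantor_adj_def cantor_interval_child[OF assms(1)] a_def b_def by simp_all

lemma cantor_adj_parent:
  assumes "2 < j" "cantor_adj j x"
  shows "cantor_adj ((j + 1) div 2) x"
proof -
  let ?p = "(j + 1) div 2"
  have p: "2 \<le> ?p" using assms(1) by auto
  have "j = 2 * ?p - 1 \<or> j = 2 * ?p" using assms(1) by presburger
  then have "cantor_adj (2 * ?p - 1) x \<or> cantor_adj (2 * ?p) x" using assms(2) by metis
  then have "fst (cantor_interval ?p) \<le> x \<and> x \<le> snd (cantor_interval ?p)"
    unfolding cantor_adj_child[OF p] using cantor_interval_nonempty[of ?p] by (auto simp: field_simps)
  then show ?thesis unfolding cantor_adj_def by simp
qed

lemma cantor_adj_children_disjoint:
  assumes "2 \<le> j" "cantor_adj (2 * j) x"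
  shows "\<not> cantor_adj (2 * j - 1) x"
  using assms(2) cantor_interval_nonempty[of j] unfolding cantor_adj_child[OF assms(1)] by (auto simp: field_simps)

lemma branch_point_exists: "\<exists>x. \<forall>k. cantor_adj (branch_node f k) x"
proof -
  define a where "a k = fst (cantor_interval (branch_node f k))" for k
  define b where "b k = snd (cantor_interval (branch_node f k))" for k
  have ab: "a k < b k" for k unfolding a_def b_def by (rule cantor_interval_nonempty)
  have step: "a k \<le> a (Suc k) \<and> b (Suc k) \<le> b k" for k
    using ab[of k] unfolding a_def b_def cantor_interval_branch_Suc by (auto simp: case_prod_beta field_simps)
  have a: "a i \<le> a j" if "i \<le> j" for i j using lift_Suc_mono_le[of a i j] step that by blast
  have b: "b j \<le> b i" if "i \<le> j" for i j using lift_Suc_antimono_le[of b i j] step that by blast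
  have ab': "a i \<le> b j" for i j
  proof -
    have "a i \<le> a (max i j)" by (rule a) simp
    also have "\<dots> \<le> b (max i j)" using ab[of "max i j"] by simp
    also have "\<dots> \<le> b j" by (rule b) simp
    finally show ?thesis .
  qed
  have "bdd_above (range a)" using ab'[of _ 0] by (intro bdd_aboveI[of _ "b 0"]) auto
  then have "a k \<le> (SUP i. a i)" "(SUP i. a i) \<le> b k" for k
    using ab' by (auto intro!: cSUP_upper cSUP_least)
  then show ?thesis unfolding cantor_adj_def a_def b_def by (intro exI[of _ "SUP i. a i"]) (simp add: a_def)
qed

definition branch_point :: "(nat \<Rightarrow> bool) \<Rightarrow> real" where
  "branch_point f = (SOME x. \<forall>k. cantor_adj (branch_node f k) x)"

lemma cantor_adj_branch_point: "cantor_adj (branch_node f k) (branch_point f)"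
  unfolding branch_point_def using someI_ex[OF branch_point_exists[of f]] by blast

lemma branch_point_in_unit: "branch_point f \<in> {0..1}"
  using cantor_adj_branch_point[of f 0] by (simp add: cantor_adj_def cantor_interval_values)

lemma inj_branch_point: "inj branch_point"
proof (rule injI, rule ccontr)
  fix f g assume eq: "branch_point f = branch_point g" and "f \<noteq> g"
  then have "\<exists>k. f k \<noteq> g k" by (simp add: fun_eq_iff)
  then obtain k where k: "f k \<noteq> g k" "\<forall>i<k. \<not> f i \<noteq> g i"
    unfolding exists_least_iff[of "\<lambda>k. f k \<noteq> g k"] by blast
  have nk: "branch_node f k = branch_node g k" by (rule branch_node_cong) (use k(2) in simp)
  have "2 \<le> branch_node f k" using branch_node_ge[of k f] by simp
  moreover have "cantor_adj (2 * branch_node f k) (branch_point f)"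
    "cantor_adj (2 * branch_node f k - 1) (branch_point f)"
    using k(1) cantor_adj_branch_point[of f "Suc k"] cantor_adj_branch_point[of g "Suc k"] eq nk
    by (cases "f k"; simp)+
  ultimately show False using cantor_adj_children_disjoint by blast
qed

fun interval_path :: "real \<Rightarrow> nat \<Rightarrow> nat" where
  "interval_path x 0 = 2"
| "interval_path x (Suc k) = (if cantor_adj (2 * interval_path x k) x then 2 * interval_path x k
     else 2 * interval_path x k - 1)"

definition digit :: "real \<Rightarrow> nat \<Rightarrow> bool" where
  "digit x k \<longleftrightarrow> cantor_adj (2 * interval_path x k) x"

text \<open>
  The path of \<open>x\<close> goes on forever, choosing left children once \<open>x\<close> has dropped out; \<open>x\<close> lies in the Cantor
  set exactly if it survives all stages.
\<close>

definition survives :: "real \<Rightarrow> nat \<Rightarrow> bool" where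
  "survives x k \<longleftrightarrow> (\<forall>i\<le>k. cantor_adj (interval_path x i) x)"

lemma interval_path_eq_branch_node: "interval_path x k = branch_node (digit x) k"
  by (induction k) (auto simp: digit_def)

lemma cantor_adj_imp_path:
  assumes "2 \<le> j" "cantor_adj j x"
  shows "\<exists>k. j = interval_path x k \<and> survives x k"
  using assms
proof (induction j rule: less_induct)
  case (less j)
  show ?case
  proof (cases "j = 2")
    case True
    then show ?thesis using less.prems by (intro exI[of _ 0]) (simp add: survives_def)
  next
    case False
    then have j: "2 < j" using less.prems by simp
    let ?p = "(j + 1) div 2"
    have p: "2 \<le> ?p" "?p < j" using j by auto
    obtain k where k: "?p = interval_path x k" "survives x k"
      using less.IH[OF p(2,1)] cantor_adj_parent[OF j less.prems(2)] by blast
    from j have "j = interval_path x (Suc k)"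
    proof (cases rule: parent_cases)
      case 1
      then have "\<not> cantor_adj (2 * ?p) x"
        using cantor_adj_children_disjoint[OF p(1), of x] less.prems(2) by metis
      then show ?thesis using 1(1) k(1) by simp
    next
      case 2
      then have "cantor_adj (2 * ?p) x" using less.prems(2) by metis
      then show ?thesis using 2(1) k(1) by simp
    qed
    moreover have "survives x (Suc k)"
      using k(2) less.prems(2) calculation unfolding survives_def by (metis le_Suc_eq)
    ultimately show ?thesis by blast
  qed
qed

text \<open>
  The Dedekind cut of a real, as a sequence of bits.
\<close>

definition cut_code :: "real \<Rightarrow> nat \<Rightarrow> bool" where
  "cut_code x n \<longleftrightarrow> of_rat (from_nat n) < x"

lemma inj_cut_code: "inj cut_code"
proof (rule linorder_injI)
  fix x y :: real assume "x < y"
  then obtain q where "x < of_rat q" "of_rat q < y" using of_rat_dense by blast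
  then have "cut_code x (to_nat q) \<noteq> cut_code y (to_nat q)" by (simp add: cut_code_def)
  then show "cut_code x \<noteq> cut_code y" by metis
qed

text \<open>
  The Cantor graph also has vertices \<open>x\<close> outside the Cantor set, continuum many of which lie in the same
  finitely many intervals. To give all of them branches of their own, the tree is thinned out: the
  bit at an even place tells whether \<open>x\<close> has dropped out, and as long as it has not, the next bit is
  the digit of \<open>x\<close>. Afterwards the odd places spell out \<open>x\<close> itself; every bit of its code is repeated
  infinitely often, so that no matter when \<open>x\<close> drops out its code can be read off.
\<close>

definition spread_branch :: "real \<Rightarrow> nat \<Rightarrow> bool" where
  "spread_branch x n \<longleftrightarrow>
     (if even n then \<not> survives x (Suc (n div 2))
      else if survives x (Suc (n div 2)) then digit x (n div 2)
      else cut_code x (fst (prod_decode (n div 2))))"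

text \<open>
  The image of the interval \<open>j\<close> in the thinned tree: each step down becomes a step to the left child
  (the even place with the bit \<open>False\<close>), followed by the original step.
\<close>

fun spread_node :: "nat \<Rightarrow> nat" where
  "spread_node j = (if j \<le> 2 then 2 else
     if odd j then 4 * spread_node ((j + 1) div 2) - 3 else 4 * spread_node ((j + 1) div 2) - 2)"

declare spread_node.simps [simp del]

lemma spread_node_ge: "2 \<le> spread_node j"
proof (induction j rule: less_induct)
  case (less j)
  show ?case
  proof (cases "j \<le> 2")
    case True
    then show ?thesis by (simp add: spread_node.simps)
  next
    case False
    then have "2 \<le> spread_node ((j + 1) div 2)" by (intro less) auto
    then show ?thesis using False by (subst spread_node.simps) auto
  qed
qed

lemma inj_on_spread_node: "inj_on spread_node {2..}"
proof -
  have "2 \<le> i \<Longrightarrow> 2 \<le> j \<Longrightarrow> spread_node i = spread_node j \<Longrightarrow> i = j" for i j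
  proof (induction i arbitrary: j rule: less_induct)
    case (less i)
    let ?p = "\<lambda>i. (i + 1) div 2 :: nat"
    have big: "spread_node k = (if odd k then 4 * spread_node (?p k) - 3 else 4 * spread_node (?p k) - 2)"
      "2 \<le> spread_node (?p k)" if "2 < k" for k
      using that spread_node_ge by (subst spread_node.simps, auto)
    have two: "spread_node 2 = 2" by (simp add: spread_node.simps)
    have gt: "2 < spread_node k" if "2 < k" for k using big[OF that] by auto
    show ?case
    proof (cases "i = 2 \<or> j = 2")
      case True
      then show ?thesis using less.prems gt[of i] gt[of j] two by fastforce
    next
      case False
      then have ij: "2 < i" "2 < j" using less.prems by auto
      obtain m n where m: "spread_node (?p i) = m + 2" and n: "spread_node (?p j) = n + 2"
        using spread_node_ge by (metis le_Suc_ex add.commute)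
      have "(if odd i then 4 * m + 5 else 4 * m + 6) = (if odd j then 4 * n + 5 else 4 * n + 6)"
        using big(1)[OF ij(1)] big(1)[OF ij(2)] less.prems(3) m n by (auto split: if_splits)
      then have *: "odd i = odd j" "m = n" by (auto split: if_splits; presburger)+
      then have "?p i = ?p j" using less.IH[of "?p i" "?p j"] ij m n by auto
      then show ?thesis using parent_cases[OF ij(1)] parent_cases[OF ij(2)] *(1) by metis
    qed
  qed
  then show ?thesis by (auto simp: inj_on_def)
qed

lemma branch_node_spread:
  "survives x k \<Longrightarrow> branch_node (spread_branch x) (2 * k) = spread_node (interval_path x k)"
proof (induction k)
  case 0
  show ?case by (simp add: spread_node.simps)
next
  case (Suc k)
  let ?p = "interval_path x k"
  have "survives x k" using Suc.prems by (auto simp: survives_def)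
  then have IH: "branch_node (spread_branch x) (2 * k) = spread_node ?p" by (rule Suc.IH)
  have p: "2 \<le> ?p" unfolding interval_path_eq_branch_node using branch_node_ge[of k "digit x"] by simp
  have even: "\<not> spread_branch x (2 * k)" and odd: "spread_branch x (Suc (2 * k)) = digit x k"
    using Suc.prems by (auto simp: spread_branch_def)
  have "branch_node (spread_branch x) (2 * Suc k) =
    (if digit x k then 2 * (2 * spread_node ?p - 1) else 2 * (2 * spread_node ?p - 1) - 1)"
    using IH even odd by simp
  moreover have "spread_node (2 * ?p) = 4 * spread_node ?p - 2" "spread_node (2 * ?p - 1) = 4 * spread_node ?p - 3"
    using p by (subst spread_node.simps, auto)+
  ultimately show ?case by (auto simp: digit_def)
qed

lemma inj_spread_branch: "inj spread_branch"
proof (rule injI)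
  fix x y assume eq: "spread_branch x = spread_branch y"
  have sv: "survives x (Suc i) = survives y (Suc i)" for i
    using fun_cong[OF eq, of "2 * i"] by (simp add: spread_branch_def)
  show "x = y"
  proof (cases "\<forall>i. survives x (Suc i)")
    case True
    have "digit x i = digit y i" for i
      using fun_cong[OF eq, of "Suc (2 * i)"] True sv by (simp add: spread_branch_def)
    then have "digit x = digit y" by blast
    then have "cantor_adj (branch_node (digit x) k) x \<and> cantor_adj (branch_node (digit x) k) y" for k
      using True sv unfolding survives_def interval_path_eq_branch_node by (metis le_SucI le_refl)
    then have "\<bar>x - y\<bar> \<le> 1 / 3 ^ k" for k
      using cantor_interval_length_branch[of "digit x" k] unfolding cantor_adj_def by (smt (verit) atLeastAtMost_iff)
    then have "\<bar>x - y\<bar> \<le> 0"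
      by (intro LIMSEQ_le_const[OF LIMSEQ_divide_realpow_zero[of 3 1]]) auto
    then show ?thesis by simp
  next
    case False
    then obtain m where m: "\<not> survives x (Suc m)" by blast
    have dead: "\<not> survives x (Suc i)" if "m \<le> i" for i
      using m that unfolding survives_def by (meson Suc_le_mono order_trans)
    have "cut_code x n = cut_code y n" for n
    proof -
      define i where "i = prod_encode (n, m)"
      have "m \<le> i" unfolding i_def by (rule le_prod_encode_2)
      then show ?thesis
        using fun_cong[OF eq, of "Suc (2 * i)"] dead sv by (simp add: spread_branch_def i_def)
    qed
    then have "cut_code x = cut_code y" by blast
    then show ?thesis by (rule injD[OF inj_cut_code])
  qed
qed

text \<open>
  A list of reals is determined by the set of all pairs of an index and a rational below the entry at
  that index.
\<close>

lemma inj_real_list_real: "\<exists>h :: real list \<Rightarrow> real. inj h"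
proof -
  define S where "S l = {(i, q :: rat). i < length l \<and> of_rat q < l ! i}" for l :: "real list"
  have "inj S"
  proof (rule injI)
    fix l l' assume eq: "S l = S l'"
    have len: "i < length l \<longleftrightarrow> (\<exists>q. (i, q) \<in> S l)" for i and l :: "real list"
      using of_rat_dense[of "l ! i - 1" "l ! i"] by (auto simp: S_def)
    have "length l = length l'" using len[of _ l] len[of _ l'] eq by (metis linorder_less_linear less_irrefl)
    moreover have "l ! i = l' ! i" if "i < length l" for i
    proof -
      have "cut_code (l ! i) n = cut_code (l' ! i) n" for n
        using eq that calculation unfolding S_def cut_code_def by (auto simp: set_eq_iff)
      then have "cut_code (l ! i) = cut_code (l' ! i)" by blast
      then show ?thesis by (rule injD[OF inj_cut_code])
    qed
    ultimately show "l = l'" by (rule nth_equalityI) simp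
  qed
  moreover have "inj (\<lambda>(A :: (nat \<times> rat) set) n. from_nat n \<in> A)"
    by (rule injI) (metis (no_types, lifting) from_nat_to_nat set_eqI)
  ultimately have "inj (branch_point \<circ> (\<lambda>A n. from_nat n \<in> A) \<circ> S)"
    using inj_branch_point by (intro inj_compose)
  then show ?thesis by blast
qed

section \<open>Cantor graphs inside a graph\<close>

text \<open>
  A copy of the Cantor graph as a not necessarily induced subgraph, given by its two vertex maps.
\<close>

definition cantor_system :: "'v graph \<Rightarrow> (nat \<Rightarrow> 'v) \<Rightarrow> (real \<Rightarrow> 'v) \<Rightarrow> bool" where
  "cantor_system G y w \<longleftrightarrow> inj_on y {2..} \<and> inj_on w {0..1} \<and> y ` {2..} \<inter> w ` {0..1} = {} \<and>
     y ` {2..} \<subseteq> verts G \<and> w ` {0..1} \<subseteq> verts G \<and>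
     (\<forall>j\<ge>2. \<forall>x\<in>{0..1}. cantor_adj j x \<longrightarrow> (y j, w x) \<in> edges G)"

lemma contains_cantor_graph_iff:
  assumes "is_graph G"
  shows "contains_a G cantor_graph \<longleftrightarrow> (\<exists>y w. cantor_system G y w)"
proof
  assume "contains_a G cantor_graph"
  then obtain G' f where G': "subgraph G' G" "bij_betw f (verts cantor_graph) (verts G')"
    "\<And>a b. a \<in> verts cantor_graph \<Longrightarrow> b \<in> verts cantor_graph \<Longrightarrow>
      (a, b) \<in> edges cantor_graph \<longleftrightarrow> (f a, f b) \<in> edges G'"
    unfolding contains_a_def isomorphic_graphs_def by blast
  have V: "verts cantor_graph = Inl ` {2..} \<union> Inr ` {0..1}" by (simp add: cantor_graph_def)
  have inj: "inj_on f (Inl ` {2..} \<union> Inr ` {0..1})" using G'(2) V by (simp add: bij_betw_def)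
  have im: "f ` (Inl ` {2..} \<union> Inr ` {0..1}) \<subseteq> verts G"
    using G'(1,2) V by (auto simp: bij_betw_def subgraph_def)
  have "cantor_system G (f \<circ> Inl) (f \<circ> Inr)"
    unfolding cantor_system_def
  proof (intro conjI allI ballI impI)
    show "inj_on (f \<circ> Inl) {2..}" "inj_on (f \<circ> Inr) {0..1}"
      using inj by (auto simp: inj_on_def)
    show "(f \<circ> Inl) ` {2..} \<inter> (f \<circ> Inr) ` {0..1} = {}"
      using inj by (auto simp: inj_on_def)
    show "(f \<circ> Inl) ` {2..} \<subseteq> verts G" "(f \<circ> Inr) ` {0..1} \<subseteq> verts G" using im by auto
    fix j :: nat and x :: real assume jx: "2 \<le> j" "x \<in> {0..1}" "cantor_adj j x"
    then have "(Inl j, Inr x) \<in> edges cantor_graph" by (auto simp: cantor_graph_def)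
    then show "((f \<circ> Inl) j, (f \<circ> Inr) x) \<in> edges G"
      using G'(3)[of "Inl j" "Inr x"] jx G'(1) V by (auto simp: subgraph_def)
  qed
  then show "\<exists>y w. cantor_system G y w" by blast
next
  assume "\<exists>y w. cantor_system G y w"
  then obtain y w where yw: "cantor_system G y w" by blast
  define f where "f = case_sum y w"
  define G' where "G' = (f ` verts cantor_graph, (\<lambda>(a, b). (f a, f b)) ` edges cantor_graph)"
  have V: "verts cantor_graph = Inl ` {2..} \<union> Inr ` {0..1}" by (simp add: cantor_graph_def)
  have E: "edges cantor_graph \<subseteq> verts cantor_graph \<times> verts cantor_graph" "sym (edges cantor_graph)"
    "irrefl (edges cantor_graph)"
    by (auto simp: cantor_graph_def sym_def irrefl_def)
  have inj: "inj_on f (verts cantor_graph)"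
    unfolding V inj_on_Un
  proof (intro conjI)
    have "inj_on (f \<circ> Inl) {2..}" "inj_on (f \<circ> Inr) {0..1}"
      using yw by (simp_all add: f_def cantor_system_def comp_def)
    then show "inj_on f (Inl ` {2..})" "inj_on f (Inr ` {0..1})" by (simp_all add: inj_on_imageI)
    have "f ` Inl ` {2..} \<inter> f ` Inr ` {0..1} = {}"
      using yw by (simp add: f_def cantor_system_def image_image)
    then show "f ` (Inl ` {2..} - Inr ` {0..1}) \<inter> f ` (Inr ` {0..1} - Inl ` {2..}) = {}" by blast
  qed
  have symG: "sym (edges G)" using assms by (simp add: is_graph_def)
  have G'I: "(f a, f b) \<in> edges G'" if "(a, b) \<in> edges cantor_graph" for a b
    unfolding G'_def snd_conv by (rule image_eqI[OF _ that]) simp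
  have EG: "edges G' \<subseteq> edges G"
  proof -
    have adj: "(f a, f b) \<in> edges G" if ab: "(a, b) \<in> edges cantor_graph" for a b
    proof -
      obtain j x where jx: "2 \<le> j" "x \<in> {0..1}" "cantor_adj j x"
        "a = Inl j \<and> b = Inr x \<or> a = Inr x \<and> b = Inl j"
        using ab by (auto simp: cantor_graph_def)
      have "(y j, w x) \<in> edges G" using yw jx(1-3) unfolding cantor_system_def by blast
      then show ?thesis using jx(4) symD[OF symG] unfolding f_def by (elim disjE) simp_all
    qed
    show ?thesis
    proof
      fix e assume "e \<in> edges G'"
      then obtain a b where "(a, b) \<in> edges cantor_graph" "e = (f a, f b)" by (auto simp: G'_def)
      then show "e \<in> edges G" using adj by simp
    qed
  qed
  have "is_graph G'"
    unfolding is_graph_def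
  proof (intro conjI)
    show "edges G' \<subseteq> verts G' \<times> verts G'"
    proof
      fix e assume "e \<in> edges G'"
      then obtain a b where "(a, b) \<in> edges cantor_graph" "e = (f a, f b)" by (auto simp: G'_def)
      then show "e \<in> verts G' \<times> verts G'" using E(1) by (auto simp: G'_def)
    qed
    show "sym (edges G')"
    proof (rule symI)
      fix u v assume "(u, v) \<in> edges G'"
      then obtain a b where "(a, b) \<in> edges cantor_graph" "u = f a" "v = f b" by (auto simp: G'_def)
      moreover from this have "(b, a) \<in> edges cantor_graph" using symD[OF E(2)] by blast
      ultimately show "(v, u) \<in> edges G'" using G'I by simp
    qed
    show "irrefl (edges G')" using EG assms by (auto simp: is_graph_def irrefl_on_def)
  qed
  moreover have "verts G' \<subseteq> verts G"
    using yw unfolding G'_def cantor_graph_def f_def cantor_system_def by auto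
  ultimately have "subgraph G' G" using assms EG by (simp add: subgraph_def)
  moreover have "isomorphic_graphs cantor_graph G'"
    unfolding isomorphic_graphs_def
  proof (intro exI conjI ballI)
    show "bij_betw f (verts cantor_graph) (verts G')" using inj by (simp add: bij_betw_def G'_def)
    fix a b assume ab: "a \<in> verts cantor_graph" "b \<in> verts cantor_graph"
    show "(a, b) \<in> edges cantor_graph \<longleftrightarrow> (f a, f b) \<in> edges G'"
    proof
      assume "(f a, f b) \<in> edges G'"
      then obtain a' b' where "(a', b') \<in> edges cantor_graph" "f a = f a'" "f b = f b'"
        by (auto simp: G'_def)
      moreover from this have "a = a'" "b = b'"
        using E(1) ab inj_onD[OF inj, of a a'] inj_onD[OF inj, of b b'] by blast+
      ultimately show "(a, b) \<in> edges cantor_graph" by simp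
    next
      assume "(a, b) \<in> edges cantor_graph"
      then show "(f a, f b) \<in> edges G'" by (rule G'I)
    qed
  qed
  ultimately show "contains_a G cantor_graph" unfolding contains_a_def by blast
qed

text \<open>
  The color \<open>\<iota> j i\<close> is the \<open>i\<close>-th color in the list of the interval \<open>j\<close>. A choice function \<open>g\<close> is coded as a
  branch \<open>enc g\<close> and thereby owns the vertex \<open>x g\<close>, which lies in the intervals \<open>b g k\<close>; its list
  consists of the colors that \<open>g\<close> gives to these intervals. If a coloring induces \<open>g\<close> on the intervals,
  then whatever color it gives to \<open>x g\<close> is that of one of the adjacent intervals.
\<close>

lemma cantor_system_not_list_colorable:
  fixes G :: "'v graph"
  assumes yw: "cantor_system G y w" and inf: "infinite (UNIV :: 'c set)"
  shows "\<exists>\<Lambda> :: 'v \<Rightarrow> 'c set. (\<forall>v. countable (\<Lambda> v) \<and> infinite (\<Lambda> v)) \<and>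
    \<not> (\<exists>\<phi>. proper_coloring G \<phi> \<and> list_coloring G \<Lambda> \<phi>)"
proof -
  obtain \<iota>0 :: "nat \<Rightarrow> 'c" where \<iota>0: "inj \<iota>0" using inf infinite_countable_subset by blast
  define \<iota> where "\<iota> j i = \<iota>0 (prod_encode (j, i))" for j i
  have \<iota>: "\<iota> j i = \<iota> j' i' \<longleftrightarrow> j = j' \<and> i = i'" for j i j' i'
    using \<iota>0 by (auto simp: \<iota>_def inj_eq)
  define enc where "enc g n \<longleftrightarrow> g (fst (prod_decode n)) = snd (prod_decode n)" for g :: "nat \<Rightarrow> nat" and n
  have enc: "enc g = enc g' \<Longrightarrow> g = g'" for g g'
  proof
    fix i assume "enc g = enc g'"
    then have "enc g (prod_encode (i, g i)) = enc g' (prod_encode (i, g i))" by simp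
    then show "g i = g' i" by (simp add: enc_def)
  qed
  define x where "x g = w (branch_point (enc g))" for g
  have inj_x: "x g = x g' \<Longrightarrow> g = g'" for g g'
    using yw branch_point_in_unit inj_branch_point enc unfolding x_def cantor_system_def
    by (metis inj_onD injD)
  have y: "inj_on y {2..}" "\<And>j g. 2 \<le> j \<Longrightarrow> y j \<noteq> x g"
    using yw branch_point_in_unit unfolding cantor_system_def x_def by blast+
  define b where "b g k = branch_node (enc g) k" for g k
  have b: "2 \<le> b g k" for g k using branch_node_ge[of k "enc g"] by (simp add: b_def)
  define \<Lambda> where "\<Lambda> v = (if \<exists>j\<ge>2. v = y j then range (\<iota> (THE j. 2 \<le> j \<and> v = y j))
    else if \<exists>g. v = x g then range (\<lambda>k. \<iota> (b (THE g. v = x g) k) ((THE g. v = x g) (b (THE g. v = x g) k)))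
    else range \<iota>0)" for v
  have \<Lambda>y: "\<Lambda> (y j) = range (\<iota> j)" if "2 \<le> j" for j
  proof -
    have "(THE j'. 2 \<le> j' \<and> y j = y j') = j" using y(1) that by (auto simp: inj_on_def)
    then show ?thesis using that by (auto simp: \<Lambda>_def)
  qed
  have \<Lambda>x: "\<Lambda> (x g) = range (\<lambda>k. \<iota> (b g k) (g (b g k)))" for g
  proof -
    have "(THE g'. x g = x g') = g" using inj_x by blast
    moreover have "\<not> (\<exists>j\<ge>2. x g = y j)" using y(2) by metis
    moreover have "\<exists>g'. x g = x g'" by blast
    ultimately show ?thesis unfolding \<Lambda>_def by (simp, blast)
  qed
  have "strict_mono (b g)" for g
    unfolding strict_mono_Suc_iff
  proof
    show "b g k < b g (Suc k)" for k
      using branch_node_ge[of k "enc g"] by (auto simp: b_def)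
  qed
  then have inj_b: "inj (b g)" for g by (rule strict_mono_imp_inj_on)
  have inf_x: "infinite (range (\<lambda>k. \<iota> (b g k) (g (b g k))))" for g
    by (rule range_inj_infinite, rule injI) (use inj_b[of g] in \<open>auto simp: \<iota> inj_eq\<close>)
  have "countable (\<Lambda> v) \<and> infinite (\<Lambda> v)" for v
  proof -
    have "infinite (range (\<iota> j))" for j by (rule range_inj_infinite) (auto simp: inj_on_def \<iota>)
    moreover have "infinite (range \<iota>0)" using \<iota>0 by (rule range_inj_infinite)
    moreover have "\<Lambda> v = range \<iota>0" if "\<nexists>j. 2 \<le> j \<and> v = y j" "\<nexists>g. v = x g"
      using that unfolding \<Lambda>_def by (simp, blast)
    ultimately show ?thesis
      using \<Lambda>y \<Lambda>x inf_x by (metis countable_image countableI_type)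
  qed
  moreover have "\<not> (\<exists>\<phi>. proper_coloring G \<phi> \<and> list_coloring G \<Lambda> \<phi>)"
  proof
    assume "\<exists>\<phi>. proper_coloring G \<phi> \<and> list_coloring G \<Lambda> \<phi>"
    then obtain \<phi> where \<phi>: "proper_coloring G \<phi>" "list_coloring G \<Lambda> \<phi>" by blast
    have "\<exists>i. \<phi> (y j) = \<iota> j i" if "2 \<le> j" for j
    proof -
      have "y j \<in> verts G" using yw that unfolding cantor_system_def by auto
      then have "\<phi> (y j) \<in> \<Lambda> (y j)" using \<phi>(2) unfolding list_coloring_def by blast
      then show ?thesis unfolding \<Lambda>y[OF that] by blast
    qed
    then obtain g where g: "\<And>j. 2 \<le> j \<Longrightarrow> \<phi> (y j) = \<iota> j (g j)" by metis
    have "x g \<in> verts G" using yw branch_point_in_unit unfolding cantor_system_def x_def by blast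
    then have "\<phi> (x g) \<in> \<Lambda> (x g)" using \<phi>(2) unfolding list_coloring_def by blast
    then obtain k where k: "\<phi> (x g) = \<iota> (b g k) (g (b g k))" unfolding \<Lambda>x by blast
    have "cantor_adj (b g k) (branch_point (enc g))" unfolding b_def by (rule cantor_adj_branch_point)
    then have "(y (b g k), x g) \<in> edges G"
      using yw b[of g k] branch_point_in_unit[of "enc g"] unfolding cantor_system_def x_def by blast
    then have "\<phi> (y (b g k)) \<noteq> \<phi> (x g)" using \<phi>(1) unfolding proper_coloring_def by blast
    then show False using g[OF b] k by simp
  qed
  ultimately show ?thesis by blast
qed

section \<open>The equivalence\<close>

lemma spread_node_branch:
  assumes "2 \<le> j"
  shows "\<exists>f k. spread_node j = branch_node f k"
proof -
  have "cantor_adj j (fst (cantor_interval j))"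
    using cantor_interval_nonempty[of j] by (simp add: cantor_adj_def)
  from cantor_adj_imp_path[OF assms this] show ?thesis using branch_node_spread by metis
qed

lemma cantor_system_from_scheme:
  fixes G :: "real list graph"
  assumes Y: "inj_on Y {2..}" "\<And>f k. Y (branch_node f k) \<in> point_of ` verts G"
    and X: "inj X" "\<And>f. X f \<in> {z. \<forall>i\<ge>n. z i = 0}" "\<And>f. X f \<notin> Y ` {2..}"
    and len: "\<And>v. v \<in> verts G \<Longrightarrow> length v = n" and G: "is_graph G"
    and adj: "\<And>f k. (list_of n (X f), list_of n (Y (branch_node f k))) \<in> edges G"
  shows "cantor_system G (\<lambda>j. list_of n (Y (spread_node j))) (\<lambda>x. list_of n (X (spread_branch x)))"
proof -
  let ?Z = "{z :: nat \<Rightarrow> real. \<forall>i\<ge>n. z i = 0}"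
  have YG: "Y (spread_node j) \<in> point_of ` verts G" if "2 \<le> j" for j
  proof -
    from spread_node_branch[OF that] obtain f k where "spread_node j = branch_node f k" by blast
    then show ?thesis using Y(2)[of f k] by simp
  qed
  have YZ: "Y (spread_node j) \<in> ?Z" if "2 \<le> j" for j
  proof -
    from YG[OF that] obtain v where v: "v \<in> verts G" "Y (spread_node j) = point_of v" by blast
    show ?thesis unfolding v(2) by (rule point_of_support[OF len[OF v(1)]])
  qed
  have sp: "spread_node j \<in> {2..}" for j using spread_node_ge by simp
  have VV: "a \<in> verts G \<and> b \<in> verts G" if "(a, b) \<in> edges G" for a b
    using that G by (auto simp: is_graph_def)
  show ?thesis
    unfolding cantor_system_def
  proof (intro conjI allI ballI impI)
    show "inj_on (\<lambda>j. list_of n (Y (spread_node j))) {2..}"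
    proof (rule inj_onI)
      fix i j :: nat assume ij: "i \<in> {2..}" "j \<in> {2..}"
        and "list_of n (Y (spread_node i)) = list_of n (Y (spread_node j))"
      then have "Y (spread_node i) = Y (spread_node j)"
        using inj_onD[OF inj_on_list_of] YZ[of i] YZ[of j] by simp
      then have "spread_node i = spread_node j" using inj_onD[OF Y(1)] sp by blast
      then show "i = j" using inj_onD[OF inj_on_spread_node] ij by blast
    qed
    show "inj_on (\<lambda>x. list_of n (X (spread_branch x))) {0..1}"
    proof (rule inj_onI)
      fix a b assume "list_of n (X (spread_branch a)) = list_of n (X (spread_branch b))"
      then have "X (spread_branch a) = X (spread_branch b)" by (rule inj_onD[OF inj_on_list_of _ X(2) X(2)])
      then show "a = b" using injD[OF X(1)] injD[OF inj_spread_branch] by blast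
    qed
    show "(\<lambda>j. list_of n (Y (spread_node j))) ` {2..} \<inter> (\<lambda>x. list_of n (X (spread_branch x))) ` {0..1} = {}"
    proof -
      have "list_of n (Y (spread_node j)) \<noteq> list_of n (X (spread_branch x))" if "2 \<le> j" for j x
      proof
        assume "list_of n (Y (spread_node j)) = list_of n (X (spread_branch x))"
        then have "Y (spread_node j) = X (spread_branch x)"
          by (rule inj_onD[OF inj_on_list_of _ YZ[OF that] X(2)])
        then show False using X(3)[of "spread_branch x"] imageI[OF sp[of j], of Y] by simp
      qed
      then show ?thesis by auto
    qed
    show "(\<lambda>j. list_of n (Y (spread_node j))) ` {2..} \<subseteq> verts G"
    proof (rule image_subsetI)
      fix j :: nat assume "j \<in> {2..}"
      then obtain v where v: "v \<in> verts G" "Y (spread_node j) = point_of v" using YG[of j] by auto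
      show "list_of n (Y (spread_node j)) \<in> verts G"
        unfolding v(2) list_of_point_of[OF len[OF v(1)]] by (rule v(1))
    qed
    show "(\<lambda>x. list_of n (X (spread_branch x))) ` {0..1} \<subseteq> verts G" using adj VV by blast
    fix j :: nat and x :: real assume "2 \<le> j" "cantor_adj j x"
    then obtain k where "j = interval_path x k" "survives x k" using cantor_adj_imp_path by blast
    then have "spread_node j = branch_node (spread_branch x) (2 * k)" using branch_node_spread by simp
    then have "(list_of n (X (spread_branch x)), list_of n (Y (spread_node j))) \<in> edges G"
      using adj[of "spread_branch x" "2 * k"] by simp
    then show "(list_of n (Y (spread_node j)), list_of n (X (spread_branch x))) \<in> edges G"
      using G by (auto simp: is_graph_def dest: symD)
  qed
qed

text \<open>
  Here \<open>U Q u\<close> is the interior of the set of points that are off the locus of \<open>Q\<close> or adjacent to \<open>u\<close>, so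
  that on the locus it is the relative interior of the neighbourhood of \<open>u\<close>. Without a Cantor system
  the sets \<open>D Q\<close> are countable, and the operation \<open>op\<close> adjoins them for all \<open>Q\<close> with coefficients from a
  given finite set of vertices and the parameters \<open>C0\<close>.
\<close>

lemma cantor_system_if_no_finite_back_order:
  fixes G :: "real list graph"
  assumes G: "sigma_semialgebraic_graph G" and no: "\<nexists>r. finite_back_order (edges G) (verts G) r"
  shows "\<exists>y w. cantor_system G y w"
proof (rule ccontr)
  assume no_cantor: "\<not> (\<exists>y w. cantor_system G y w)"
  let ?V = "verts G" and ?E = "edges G"
  have isG: "is_graph G" using G by (simp add: sigma_semialgebraic_graph_def)
  have EV: "a \<in> ?V \<and> b \<in> ?V" if "(a, b) \<in> ?E" for a b
    using that isG by (auto simp: is_graph_def)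
  obtain n where n: "sigma_semialgebraic n ?V" "sigma_semialgebraic (2 * n) {x @ y |x y. (x, y) \<in> ?E}"
    using G unfolding sigma_semialgebraic_graph_def by blast
  obtain SV where SV: "\<forall>S\<in>SV. semialgebraic n S" "?V = \<Union>SV"
    using n(1) unfolding sigma_semialgebraic_def by (elim exE conjE)
  obtain SE where SE: "countable SE" "\<forall>S\<in>SE. semialgebraic (2 * n) S"
    "{x @ y |x y. (x, y) \<in> ?E} = \<Union>SE"
    using n(2) unfolding sigma_semialgebraic_def by (elim exE conjE)
  have len: "length v = n" if "v \<in> ?V" for v
  proof -
    from that obtain S where "v \<in> S" "semialgebraic n S" using SV by blast
    then show ?thesis unfolding semialgebraic_def by blast
  qed
  obtain F p where Fp: "\<And>S. S \<in> SE \<Longrightarrow>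
      S = {x. length x = 2 * n \<and> sat (\<lambda>i. if i < 2 * n then x ! i else p S i) (F S)}"
  proof -
    have "\<forall>S\<in>SE. \<exists>F p. S = {x. length x = 2 * n \<and> sat (\<lambda>i. if i < 2 * n then x ! i else p i) F}"
      using SE(2) unfolding semialgebraic_def .
    from this[unfolded bchoice_iff] obtain F p where
      "\<forall>S\<in>SE. S = {x. length x = 2 * n \<and> sat (\<lambda>i. if i < 2 * n then x ! i else p S i) (F S)}"
      by (elim exE)
    then show ?thesis using that by blast
  qed
  define C0 where "C0 = (\<Union>S\<in>SE. range (p S))"
  have "countable C0" using SE(1) by (simp add: C0_def)
  define Z where "Z = {z :: nat \<Rightarrow> real. \<forall>i\<ge>n. z i = 0}"
  define locus where "locus Q = {z \<in> Z. \<forall>q\<in>Q. q z = 0}" for Q :: "((nat \<Rightarrow> real) \<Rightarrow> real) set"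
  define U where "U Q u = (if u \<in> point_of ` ?V
      then interior {z. z \<in> locus Q \<longrightarrow> (list_of n z, list_of n u) \<in> ?E} else {})" for Q u
  define D where "D Q = {z \<in> locus Q. infinite {u. z \<in> U Q u}}" for Q
  define op where "op A = (\<Union>Q\<in>{Q. finite Q \<and> Q \<subseteq> polyfun (C0 \<union> \<Union>(set ` A)) {..<n}}. list_of n ` D Q)"
    for A :: "real list set"
  have U_E: "(list_of n z, list_of n u) \<in> ?E" "u \<in> point_of ` ?V" if "z \<in> U Q u" "z \<in> locus Q" for z Q u
  proof -
    from that(1) show u: "u \<in> point_of ` ?V" unfolding U_def by (metis empty_iff)
    have "z \<in> {z. z \<in> locus Q \<longrightarrow> (list_of n z, list_of n u) \<in> ?E}"
      using that(1) u interior_subset unfolding U_def by (metis (no_types, lifting) subsetD)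
    then show "(list_of n z, list_of n u) \<in> ?E" using that(2) by blast
  qed
  have D_countable: "countable (D Q)" if Q: "Q \<subseteq> polyfun C {..<n}" for C Q
  proof (rule ccontr)
    assume unc: "\<not> countable (D Q)"
    have "closed (locus Q)"
    proof -
      have "closed {z :: nat \<Rightarrow> real. f z = 0}" if "continuous_on UNIV f" for f :: "(nat \<Rightarrow> real) \<Rightarrow> real"
        using that by (intro closed_Collect_eq) auto
      then have "closed ((\<Inter>q\<in>Q. {z. q z = 0}) \<inter> (\<Inter>i\<in>{n..}. {z. z i = 0}))"
        using Q polyfun_continuous by (intro closed_Int closed_INT ballI) (auto intro: continuous_on_product_coordinates)
      also have "(\<Inter>q\<in>Q. {z. q z = 0}) \<inter> (\<Inter>i\<in>{n..}. {z. z i = 0}) = locus Q"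
        by (auto simp: locus_def Z_def)
      finally show ?thesis .
    qed
    moreover have "open (U Q u)" for u by (simp add: U_def)
    moreover obtain Y X where YX: "inj_on Y {2..}" "inj X"
      "\<And>f. X f \<in> locus Q" "\<And>f k. X f \<in> U Q (Y (branch_node f k))" "\<And>f. X f \<notin> Y ` {2..}"
    proof -
      have "\<exists>Y X. inj_on Y {2..} \<and> inj X \<and>
        (\<forall>f. X f \<in> locus Q \<and> (\<forall>k. X f \<in> U Q (Y (branch_node f k))) \<and> X f \<notin> Y ` {2..})"
        using calculation unc unfolding D_def by (rule cantor_scheme[of "locus Q" "U Q"])
      then show ?thesis using that by (elim exE conjE) blast
    qed
    have "cantor_system G (\<lambda>j. list_of n (Y (spread_node j))) (\<lambda>x. list_of n (X (spread_branch x)))"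
    proof (rule cantor_system_from_scheme[OF YX(1) _ YX(2) _ YX(5) len isG])
      show "Y (branch_node f k) \<in> point_of ` ?V" for f k by (rule U_E(2)[OF YX(4,3)])
      show "X f \<in> {z. \<forall>i\<ge>n. z i = 0}" for f using YX(3)[of f] unfolding locus_def Z_def by blast
      show "(list_of n (X f), list_of n (Y (branch_node f k))) \<in> ?E" for f k by (rule U_E(1)[OF YX(4,3)])
    qed
    then show False using no_cantor by blast
  qed
  have "\<exists>r. finite_back_order ?E ?V r"
  proof (rule finite_back_order_exists)
    fix A :: "real list set" assume "finite A"
    then have "countable (\<Union>(set ` A))" by (intro countable_finite) auto
    then have "countable (polyfun (C0 \<union> \<Union>(set ` A)) {..<n})"
      using \<open>countable C0\<close> by (intro countable_polyfun) auto
    then have "countable {Q. finite Q \<and> Q \<subseteq> polyfun (C0 \<union> \<Union>(set ` A)) {..<n}}"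
      by (rule countable_Collect_finite_subset)
    then show "countable (op A)"
      unfolding op_def using D_countable by (intro countable_UN countable_image) auto
  next
    have "list_of n z \<in> ?V" if "z \<in> D Q" for z Q
    proof -
      have "{u. z \<in> U Q u} \<noteq> {}" using that unfolding D_def by force
      then obtain u where "z \<in> U Q u" by blast
      moreover have "z \<in> locus Q" using that unfolding D_def by blast
      ultimately show ?thesis using EV[OF U_E(1)] by blast
    qed
    then have "op A \<subseteq> ?V" for A unfolding op_def by (intro UN_least image_subsetI)
    then show "op_closed op ?V" unfolding op_closed_def by (intro allI impI)
  next
    fix M x assume M: "op_closed op M" "M \<subseteq> ?V" and x: "x \<in> ?V - M"
    show "finite {y \<in> M. (x, y) \<in> ?E}"
    proof (rule ccontr)
      assume inf: "infinite {y \<in> M. (x, y) \<in> ?E}"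
      define C where "C = C0 \<union> \<Union>(set ` M)"
      have lx: "length x = n" using x len by blast
      obtain Q where Q: "finite Q" "Q \<subseteq> polyfun C {..<n}" "\<forall>q\<in>Q. q (point_of x) = 0"
        "\<And>f. f \<in> polyfun C {..<n} \<Longrightarrow> f (point_of x) = 0 \<Longrightarrow>
          \<forall>\<^sub>F z in nhds (point_of x). (\<forall>q\<in>Q. q z = 0) \<longrightarrow> f z = 0"
      proof -
        from generic_locus[of C n "point_of x"] obtain Q where "finite Q" "Q \<subseteq> polyfun C {..<n}"
          "\<forall>q\<in>Q. q (point_of x) = 0" "\<forall>f\<in>polyfun C {..<n}. f (point_of x) = 0 \<longrightarrow>
            (\<forall>\<^sub>F z in nhds (point_of x). (\<forall>q\<in>Q. q z = 0) \<longrightarrow> f z = 0)"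
          by (elim exE conjE)
        then show ?thesis by (intro that[of Q]) simp_all
      qed
      have x_locus: "point_of x \<in> locus Q" using Q(3) point_of_support[OF lx] by (simp add: locus_def Z_def)
      have nbr: "point_of x \<in> U Q (point_of y)" if y: "y \<in> M" "(x, y) \<in> ?E" for y
      proof -
        have ly: "length y = n" using y EV len by blast
        obtain S where S: "S \<in> SE" "x @ y \<in> S" using SE(3) y(2) by auto
        have "\<forall>\<^sub>F z in nhds (point_of x). (\<forall>q\<in>Q. q z = 0) \<longrightarrow>
          sat (\<lambda>i. if i < 2 * n then (list_of n z @ y) ! i else p S i) (F S)"
        proof (rule formula_persists_on_locus[OF _ lx ly _ Q(4)])
          show "sat (\<lambda>i. if i < 2 * n then (x @ y) ! i else p S i) (F S)"
            using S(2) by (subst (asm) Fp[OF S(1)]) simp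
          show "range (p S) \<union> set y \<subseteq> C" using S(1) y(1) unfolding C_def C0_def by blast
        qed
        then have "\<forall>\<^sub>F z in nhds (point_of x). z \<in> locus Q \<longrightarrow> (list_of n z, y) \<in> ?E"
        proof (rule eventually_mono, intro impI)
          fix z assume *: "(\<forall>q\<in>Q. q z = 0) \<longrightarrow>
            sat (\<lambda>i. if i < 2 * n then (list_of n z @ y) ! i else p S i) (F S)" "z \<in> locus Q"
          have "\<forall>q\<in>Q. q z = 0" using *(2) unfolding locus_def by blast
          with *(1) have "sat (\<lambda>i. if i < 2 * n then (list_of n z @ y) ! i else p S i) (F S)" by (rule mp)
          moreover have "length (list_of n z @ y) = 2 * n" using ly by simp
          ultimately have "list_of n z @ y \<in> S" by (subst Fp[OF S(1)]) simp
          then obtain a b where "list_of n z @ y = a @ b" "(a, b) \<in> ?E" using S(1) SE(3) by blast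
          moreover from this have "length a = n" using EV len by blast
          ultimately show "(list_of n z, y) \<in> ?E" by simp
        qed
        then have "point_of x \<in> interior {z. z \<in> locus Q \<longrightarrow> (list_of n z, y) \<in> ?E}"
          unfolding eventually_nhds interior_def by blast
        then show ?thesis using y EV list_of_point_of[OF ly] unfolding U_def by auto
      qed
      have "inj_on point_of ?V"
        by (rule inj_on_inverseI[of _ "list_of n"]) (rule list_of_point_of[OF len])
      then have "inj_on point_of {y \<in> M. (x, y) \<in> ?E}" by (rule inj_on_subset) (use M(2) in blast)
      then have "infinite (point_of ` {y \<in> M. (x, y) \<in> ?E})" using inf finite_imageD by blast
      moreover have "point_of ` {y \<in> M. (x, y) \<in> ?E} \<subseteq> {u. point_of x \<in> U Q u}" using nbr by blast
      ultimately have "infinite {u. point_of x \<in> U Q u}" using finite_subset by blast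
      then have xD: "point_of x \<in> D Q" using x_locus by (simp add: D_def)
      \<comment> \<open>only finitely many vertices of \<open>M\<close> enter into the coefficients of \<open>Q\<close>\<close>
      have "\<forall>q\<in>Q. \<exists>B. finite B \<and> B \<subseteq> C \<and> q \<in> polyfun B {..<n}"
        using Q(2) polyfun_finite_support by blast
      then obtain B where B: "\<And>q. q \<in> Q \<Longrightarrow> finite (B q) \<and> B q \<subseteq> C \<and> q \<in> polyfun (B q) {..<n}" by metis
      have "\<forall>c\<in>(\<Union>q\<in>Q. B q) - C0. \<exists>v. v \<in> M \<and> c \<in> set v" using B unfolding C_def by blast
      then obtain h where h: "\<And>c. c \<in> (\<Union>q\<in>Q. B q) - C0 \<Longrightarrow> h c \<in> M \<and> c \<in> set (h c)" by metis
      define A where "A = h ` ((\<Union>q\<in>Q. B q) - C0)"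
      have A: "finite A" "A \<subseteq> M" using Q(1) B h by (auto simp: A_def)
      have "B q \<subseteq> C0 \<union> \<Union>(set ` A)" if "q \<in> Q" for q
        using h that unfolding A_def by blast
      then have "Q \<subseteq> polyfun (C0 \<union> \<Union>(set ` A)) {..<n}"
        using B polyfun_mono[OF _ _ order_refl] by blast
      then have "list_of n (point_of x) \<in> op A" unfolding op_def using Q(1) xD by blast
      moreover have "op A \<subseteq> M" using M(1) A unfolding op_closed_def by blast
      ultimately have "x \<in> M" unfolding list_of_point_of[OF lx] by blast
      then show False using x by blast
    qed
  qed
  then show False using no by blast
qed

theorem theorem1p4:
  fixes G :: "real list graph"
  assumes "|UNIV :: real set| \<le>o |UNIV :: 'c set|"
    and "sigma_semialgebraic_graph G"
  shows "((list_chromatic_number G :: 'c rel) \<le>o natLeq \<longleftrightarrow> coloring_number G \<le>o natLeq) \<and>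
         (coloring_number G \<le>o natLeq \<longleftrightarrow> \<not> contains_a G cantor_graph)"
proof -
  have G: "is_graph G" using assms(2) by (simp add: sigma_semialgebraic_graph_def)
  have inf_c: "infinite (UNIV :: 'c set)"
    using assms(1) card_of_ordLeq_infinite[of "UNIV :: real set" "UNIV :: 'c set"] infinite_UNIV_char_0 by blast
  have "|verts G| \<le>o |UNIV :: real set|"
    using inj_real_list_real inj_on_subset[OF _ subset_UNIV] unfolding card_of_ordLeq[symmetric] by blast
  then have le: "|verts G| \<le>o |UNIV :: 'c set|" using assms(1) by (rule ordLeq_transitive)
  note chi = list_chromatic_number_le_natLeq_iff[OF G le inf_c]
  note col = coloring_number_le_natLeq_iff[of G, OF infinite_UNIV_listI]
  have "(list_chromatic_number G :: 'c rel) \<le>o natLeq" if "coloring_number G \<le>o natLeq"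
  proof -
    from that obtain r where r: "finite_back_order (edges G) (verts G) r" unfolding col ..
    show ?thesis
      unfolding chi
    proof (intro allI impI)
      fix \<Lambda> :: "real list \<Rightarrow> 'c set"
      assume "\<forall>x\<in>verts G. countable (\<Lambda> x) \<and> infinite (\<Lambda> x)"
      then show "\<exists>\<phi>. proper_coloring G \<phi> \<and> list_coloring G \<Lambda> \<phi>"
        by (intro greedy_list_coloring[OF G r]) simp
    qed
  qed
  moreover have "\<not> contains_a G cantor_graph" if "(list_chromatic_number G :: 'c rel) \<le>o natLeq"
  proof
    assume "contains_a G cantor_graph"
    then obtain y w where "cantor_system G y w" unfolding contains_cantor_graph_iff[OF G] by (elim exE)
    from cantor_system_not_list_colorable[OF this inf_c] obtain \<Lambda> :: "real list \<Rightarrow> 'c set"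
      where "\<forall>v. countable (\<Lambda> v) \<and> infinite (\<Lambda> v)" "\<not> (\<exists>\<phi>. proper_coloring G \<phi> \<and> list_coloring G \<Lambda> \<phi>)"
      by (elim exE conjE)
    then show False using that unfolding chi by simp
  qed
  moreover have "coloring_number G \<le>o natLeq" if "\<not> contains_a G cantor_graph"
    using that cantor_system_if_no_finite_back_order[OF assms(2)]
    unfolding col contains_cantor_graph_iff[OF G] by (rule contrapos_np)
  ultimately show ?thesis by argo
qed

end
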